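(* Let $K$ be a field. Let $E$ be a graph which arises as a hair extension of a totally looped finite graph $F$, and let $\varepsilon$ be a nonzero idempotent in $L_K(E)$. Then the corner algebra $\varepsilon L_K(E)\varepsilon$ is isomorphic (as a $K$-algebra) to a Leavitt path algebra. More specifically, $\varepsilon L_K(E)\varepsilon$ is isomorphic to the Leavitt path algebra over $K$ of a hair extension of $F_T$, where $F_T$ is the (totally looped) restriction graph of $F$ to some hereditary subset $T$ of $F^0$. Moreover, in case $\varepsilon$ is a full idempotent in $L_K(E)$, then $\varepsilon L_K(E)\varepsilon$ is isomorphic to the Leavitt path algebra over $K$ of a hair extension of $F$ itself.
   Context: A (directed) graph $E=(E^0,E^1,s,r)$ consists of disjoint sets $E^0$ (vertices) and $E^1$ (edges) and maps $s,r:E^1\to E^0$. It is finite if $E^0$ and $E^1$ are finite; the vertex set is nonempty. A vertex $v$ is a sink if $s^{-1}(v)=\emptyset$; in a finite graph, a vertex is regular if it is not a sink. A loop based at $v$ is an edge $e$ with $s(e)=r(e)=v$. A graph is totally looped if every regular vertex is the base of at least one loop. The Leavitt path algebra $L_K(E)$ is the $K$-algebra generated by $E^0\cup E^1\cup\{e^*\mid e\in E^1\}$ subject to, for all $v,w\in E^0$ and $e,f\in E^1$: (1) $vw=\delta_{v,w}w$; (2) $s(e)e=e=er(e)$ and $r(e)e^*=e^*=e^*s(e)$; (3) $e^*f=\delta_{e,f}r(e)$; (4) $v=\sum_{e\in s^{-1}(v)}ee^*$ for every regular vertex $v$. For finite $E$ it is unital with identity $\sum_{v\in E^0}v$. Hair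 extension: for a finite graph $E$ with $E^0=\{v_1,\dots,v_t\}$ and positive integers $n_1,\dots,n_t$, the hair extension $E^+(n_1,\dots,n_t)$ is obtained from $E$ by adding, for each $i$, new vertices $v_i^1,\dots,v_i^{n_i-1}$ and new edges $e_i^1,\dots,e_i^{n_i-1}$ with $s(e_i^j)=v_i^j$, $r(e_i^1)=v_i$, and $r(e_i^j)=v_i^{j-1}$ for $j\ge 2$ (nothing is added at $v_i$ if $n_i=1$). "A hair extension of $E$" means $E^+(n_1,\dots,n_t)$ for some positive integers $n_1,\dots,n_t$. A subset $H\subseteq E^0$ is hereditary if whenever $v\in H$ and there is a path (possibly of length $0$) from $v$ to $w$, then $w\in H$. For a hereditary subset $H$, the restriction graph $E_H$ has $E_H^0=H$, $E_H^1=\{e\in E^1\mid s(e)\in H\}$, with source and range maps restricted from $E$. An idempotent $f$ in a unital ring $R$ is full if $R=RfR$; for a nonzero idempotent $f$, the corner of $R$ by $f$ is $fRf$. *)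

theory Defs
  imports
    "Graph_Theory.Digraph"
    "HOL-Algebra.Module"
    "HOL-Algebra.QuotRing"
    "HOL-Algebra.Ideal_Product"
    "HOL-Library.Poly_Mapping"
begin

text \<open>
  Graphs are \<^typ>\<open>('v, 'e) pre_digraph\<close>s, with \<^const>\<open>tail\<close> as the source map, \<^const>\<open>head\<close> as the
  range map and \<^term>\<open>out_arcs E v\<close> as the set of edges with source \<open>v\<close>.  Finite graphs
  are those satisfying \<^const>\<open>fin_digraph\<close>; that locale admits the empty graph, so nonemptiness
  of the vertex set is always stated separately.  \<open>reachable\<close> includes paths of length \<open>0\<close>.
\<close>

section \<open>Graphs\<close>

text \<open>For finite graphs only; in general \<open>v\<close> must also emit only finitely many edges.\<close>

definition regular :: "('v, 'e) pre_digraph \<Rightarrow> 'v \<Rightarrow> bool" where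
  "regular E v \<longleftrightarrow> v \<in> verts E \<and> out_arcs E v \<noteq> {}"

definition totally_looped :: "('v, 'e) pre_digraph \<Rightarrow> bool" where
  "totally_looped E \<longleftrightarrow> (\<forall>v. regular E v \<longrightarrow> (\<exists>e\<in>arcs E. tail E e = v \<and> head E e = v))"

definition hereditary :: "('v, 'e) pre_digraph \<Rightarrow> 'v set \<Rightarrow> bool" where
  "hereditary E H \<longleftrightarrow> H \<subseteq> verts E \<and> (\<forall>v\<in>H. \<forall>w. v \<rightarrow>\<^sup>*\<^bsub>E\<^esub> w \<longrightarrow> w \<in> H)"

definition restriction_graph :: "('v, 'e) pre_digraph \<Rightarrow> 'v set \<Rightarrow> ('v, 'e) pre_digraph" where
  "restriction_graph E H =
     \<lparr>verts = H, arcs = {e \<in> arcs E. tail E e \<in> H}, tail = tail E, head = head E\<rparr>"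

text \<open>
  In the hair extension, \<open>(v, 0)\<close> is the original vertex \<open>v\<close> and \<open>(v, j)\<close> with \<open>1 \<le> j < n v\<close> is
  the \<open>j\<close>-th new vertex over \<open>v\<close>; \<open>Inl e\<close> is an original edge and \<open>Inr (v, j)\<close> is the new edge
  from \<open>(v, j)\<close> to \<open>(v, j - 1)\<close>.  The numbers \<open>n v\<close> are meant to be positive.
\<close>

definition hair_extension ::
    "('v, 'e) pre_digraph \<Rightarrow> ('v \<Rightarrow> nat) \<Rightarrow> ('v \<times> nat, 'e + 'v \<times> nat) pre_digraph" where
  "hair_extension E n =
     \<lparr>verts = {(v, j). v \<in> verts E \<and> j < n v},
      arcs = Inl ` arcs E \<union> Inr ` {(v, j). v \<in> verts E \<and> 1 \<le> j \<and> j < n v},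
      tail = case_sum (\<lambda>e. (tail E e, 0)) (\<lambda>(v, j). (v, j)),
      head = case_sum (\<lambda>e. (head E e, 0)) (\<lambda>(v, j). (v, j - 1))\<rparr>"


section \<open>Algebras over a field\<close>

text \<open>
  A unital algebra over \<open>'k\<close> is a \<^typ>\<open>('k, 'a) module\<close> record that forms a ring; the locale
  \<open>algebra\<close> of \<open>HOL-Algebra\<close> is not applicable because it requires commutativity.
\<close>

definition algebra_iso :: "('k, 'a) module \<Rightarrow> ('k, 'b) module \<Rightarrow> bool" (infix \<open>\<cong>\<^sub>a\<close> 50) where
  "A \<cong>\<^sub>a B \<longleftrightarrow>
     (\<exists>h\<in>ring_iso A B. \<forall>c. \<forall>x\<in>carrier A. h (c \<odot>\<^bsub>A\<^esub> x) = c \<odot>\<^bsub>B\<^esub> h x)"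

definition idempotent_elem :: "('a, 'b) ring_scheme \<Rightarrow> 'a \<Rightarrow> bool" where
  "idempotent_elem R f \<longleftrightarrow> f \<in> carrier R \<and> f \<otimes>\<^bsub>R\<^esub> f = f"

text \<open>\<^const>\<open>ideal_prod\<close> closes the products \<open>(r f) s\<close> under finite sums, so it yields \<open>RfR\<close>.\<close>

definition full_idempotent :: "('a, 'b) ring_scheme \<Rightarrow> 'a \<Rightarrow> bool" where
  "full_idempotent R f \<longleftrightarrow> idempotent_elem R f \<and>
     carrier R = ideal_prod R {r \<otimes>\<^bsub>R\<^esub> f | r. r \<in> carrier R} (carrier R)"

definition corner :: "('k, 'a) module \<Rightarrow> 'a \<Rightarrow> ('k, 'a) module" where
  "corner A f = A\<lparr>carrier := {f \<otimes>\<^bsub>A\<^esub> x \<otimes>\<^bsub>A\<^esub> f | x. x \<in> carrier A}, one := f\<rparr>"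


section \<open>Free algebras\<close>

datatype 'g free_monoid = Word (letters: "'g list")

instantiation free_monoid :: (type) monoid_add
begin

definition "0 = Word []"

definition "v + w = Word (letters v @ letters w)"

instance
  by standard (simp_all add: zero_free_monoid_def plus_free_monoid_def)

end

text \<open>
  Finitely supported functions on words, with the convolution product of \<^typ>\<open>'a \<Rightarrow>\<^sub>0 'b\<close>.
\<close>

type_synonym ('k, 'g) free_alg = "'g free_monoid \<Rightarrow>\<^sub>0 'k"

definition gen :: "'g \<Rightarrow> ('k :: field, 'g) free_alg" where
  "gen x = Poly_Mapping.single (Word [x]) 1"

definition free_algebra :: "'g set \<Rightarrow> ('k :: field, ('k, 'g) free_alg) module" where
  "free_algebra X =
     \<lparr>carrier = {p. \<forall>w\<in>Poly_Mapping.keys p. set (letters w) \<subseteq> X},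
      mult = (*), one = 1, zero = 0, add = (+),
      smult = (\<lambda>c p. Poly_Mapping.single 0 c * p)\<rparr>"

text \<open>The elements without constant term form the free non-unital algebra on \<open>X\<close>.\<close>

definition augmentation_ideal :: "'g set \<Rightarrow> ('k :: field, 'g) free_alg set" where
  "augmentation_ideal X = {p \<in> carrier (free_algebra X). Poly_Mapping.lookup p 0 = 0}"


section \<open>Leavitt path algebras\<close>

datatype ('v, 'e) lpa_gen = Vertex 'v | Edge 'e | Ghost 'e

definition lpa_gens :: "('v, 'e) pre_digraph \<Rightarrow> ('v, 'e) lpa_gen set" where
  "lpa_gens E = Vertex ` verts E \<union> Edge ` arcs E \<union> Ghost ` arcs E"

text \<open>\<open>p \<in> lpa_relators E\<close> stands for the defining relation \<open>p = 0\<close>.\<close>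

inductive_set lpa_relators ::
    "('v, 'e) pre_digraph \<Rightarrow> ('k :: field, ('v, 'e) lpa_gen) free_alg set"
  for E where
  vertex_mult: "\<lbrakk>v \<in> verts E; w \<in> verts E\<rbrakk> \<Longrightarrow>
    gen (Vertex v) * gen (Vertex w) - (if v = w then gen (Vertex w) else 0) \<in> lpa_relators E"
| source_edge: "e \<in> arcs E \<Longrightarrow>
    gen (Vertex (tail E e)) * gen (Edge e) - gen (Edge e) \<in> lpa_relators E"
| edge_range: "e \<in> arcs E \<Longrightarrow>
    gen (Edge e) * gen (Vertex (head E e)) - gen (Edge e) \<in> lpa_relators E"
| range_ghost: "e \<in> arcs E \<Longrightarrow>
    gen (Vertex (head E e)) * gen (Ghost e) - gen (Ghost e) \<in> lpa_relators E"
| ghost_source: "e \<in> arcs E \<Longrightarrow>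
    gen (Ghost e) * gen (Vertex (tail E e)) - gen (Ghost e) \<in> lpa_relators E"
| ghost_edge: "\<lbrakk>e \<in> arcs E; f \<in> arcs E\<rbrakk> \<Longrightarrow>
    gen (Ghost e) * gen (Edge f) - (if e = f then gen (Vertex (head E e)) else 0)
      \<in> lpa_relators E"
| cuntz_krieger: "regular E v \<Longrightarrow>
    gen (Vertex v) - (\<Sum>e\<in>out_arcs E v. gen (Edge e) * gen (Ghost e)) \<in> lpa_relators E"

definition lpa_ideal ::
    "('v, 'e) pre_digraph \<Rightarrow> ('k :: field, ('v, 'e) lpa_gen) free_alg set" where
  "lpa_ideal E = genideal (free_algebra (lpa_gens E)) (lpa_relators E)"

definition lpa_class :: "('v, 'e) pre_digraph \<Rightarrow>
    ('k :: field, ('v, 'e) lpa_gen) free_alg \<Rightarrow> ('k, ('v, 'e) lpa_gen) free_alg set" where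
  "lpa_class E p = lpa_ideal E +>\<^bsub>free_algebra (lpa_gens E)\<^esub> p"

text \<open>
  The presentation is that of a not necessarily unital algebra: it is the free non-unital algebra
  modulo the ideal generated by the relators.  All relators lie in the augmentation ideal, so the
  ideal they generate in the unital free algebra is the same as the one (closed under scalar
  multiples) that they generate in the augmentation ideal.  For a finite graph the sum of the
  vertices is an identity element; it is recorded in the \<^const>\<open>one\<close> field.
\<close>

definition leavitt_path_algebra :: "'k :: field itself \<Rightarrow> ('v, 'e) pre_digraph \<Rightarrow>
    ('k, ('k, ('v, 'e) lpa_gen) free_alg set) module" where
  "leavitt_path_algebra K E =
     \<lparr>carrier = lpa_class E ` augmentation_ideal (lpa_gens E),
      mult = rcoset_mult (free_algebra (lpa_gens E)) (lpa_ideal E),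
      one = lpa_class E (\<Sum>v\<in>verts E. gen (Vertex v)),
      zero = lpa_ideal E,
      add = set_add (free_algebra (lpa_gens E)),
      smult = (\<lambda>c A. \<Union>p\<in>A. lpa_class E (c \<odot>\<^bsub>free_algebra (lpa_gens E)\<^esub> p))\<rparr>"

end

theory Submission
  imports Defs "Graph_Theory.Arc_Walk"
begin

text \<open>
  Write \<open>L\<close> for the Leavitt path algebra of \<open>E\<close> and \<open>P\<close> for the span of the paths of \<open>E\<close> in
  \<open>L\<close>.  Everything rests on one observation.  A ghost edge cancels against the next edge, so for
  every \<open>x\<close> in \<open>L\<close> the products \<open>x \<alpha>\<close> lie in \<open>P\<close> for all paths \<open>\<alpha>\<close> of a sufficiently large length
  \<open>k\<close> and for all shorter \<open>\<alpha>\<close> that end in a sink (\<open>aug_in_D\<close>).  By the Cuntz--Krieger relations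
  the elements \<open>\<alpha> \<alpha>\<^sup>*\<close> for these \<open>\<alpha>\<close> add up to \<open>1\<close>, so \<open>x\<close> is the sum of the \<open>(x \<alpha>) \<alpha>\<^sup>*\<close>, and
  statements about \<open>L\<close> can be checked in \<open>P\<close>.

  The first consequence is that a homomorphism out of \<open>L\<close> is injective as soon as the images of
  the paths are linearly independent (\<open>val_faithful\<close>).  There is a representation of \<open>L\<close> by
  operators for which this holds, the independence being forced by a grading
  (\<open>branching_independent\<close>); from then on \<open>L\<close> is an algebra of operators.

  The second consequence is that for an idempotent \<open>\<epsilon>\<close> the right ideal \<open>\<epsilon>L\<close> is a finite direct sum
  of right ideals \<open>vL\<close> with \<open>v\<close> a vertex (\<open>idempotent_frame\<close>).  Indeed \<open>M = {x \<in> P. \<epsilon>x = x}\<close> is a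
  right ideal of \<open>P\<close>, and a right ideal of a path algebra is free on elements whose leading
  words are minimal for the prefix order, as for free algebras.  Since \<open>\<epsilon>\<close> is the sum of the
  \<open>(\<epsilon>\<alpha>) \<alpha>\<^sup>*\<close>, it lies in \<open>ML\<close>, and elements that are independent over \<open>P\<close> remain independent over
  \<open>L\<close>.  In terms of elements this gives a \<open>frame\<close>: vertices \<open>\<nu> i\<close> and elements \<open>a i\<close>, \<open>l i\<close> for \<open>i\<close> in
  a finite set with \<open>l i a j = \<delta>\<^sub>i\<^sub>j \<nu> i\<close> and \<open>\<epsilon> = \<Sum> a i l i\<close>.

  Now let \<open>E\<close> be a hair extension of \<open>F\<close>.  The vertices on a hair are equivalent to its foot, so
  all \<open>\<nu> i\<close> can be taken in \<open>F\<close>.  At a regular vertex \<open>v\<close> the Cuntz--Krieger relation replaces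
  a copy of \<open>v\<close> by one copy of the range of each edge leaving \<open>v\<close>, and the loop at \<open>v\<close> gives
  back \<open>v\<close> itself.  So the set \<open>T\<close> of the vertices that occur can be enlarged
  until it is hereditary (\<open>supp_hereditary\<close>).  If \<open>v\<close> in \<open>T\<close> occurs \<open>m v\<close> times, then the elements
  \<open>a e l\<close> for edges \<open>e\<close> of the restriction \<open>F\<^sub>T\<close>, and the matrix units \<open>a l\<close> that link the copies of
  one vertex, form a Leavitt family for the hair extension of \<open>F\<^sub>T\<close> by \<open>m\<close>.  Its paths are
  independent, and it generates \<open>\<epsilon>L\<epsilon>\<close> (\<open>image_eq_corner\<close>).

  Finally, the loops make a hereditary set \<open>T\<close> saturated.  If \<open>T\<close> is not all of \<open>F\<close>, then there is
  a nonzero representation that vanishes on \<open>T\<close>, hence on \<open>\<epsilon>\<close>; so \<open>\<epsilon>\<close> is not full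
  (\<open>full_hereditary_support\<close>).
\<close>

section \<open>Evaluation of noncommutative polynomials\<close>

abbreviation keys :: "('a \<Rightarrow>\<^sub>0 'b :: zero) \<Rightarrow> 'a set" where
  "keys \<equiv> Poly_Mapping.keys"

abbreviation lookup :: "('a \<Rightarrow>\<^sub>0 'b :: zero) \<Rightarrow> 'a \<Rightarrow> 'b" where
  "lookup \<equiv> Poly_Mapping.lookup"

abbreviation single :: "'a \<Rightarrow> 'b \<Rightarrow> ('a \<Rightarrow>\<^sub>0 'b :: zero)" where
  "single \<equiv> Poly_Mapping.single"

lemma poly_mapping_sum_induct [case_names zero single add]:
  assumes "P 0" "\<And>w c. w \<in> keys q \<Longrightarrow> P (single w c)" "\<And>x y. P x \<Longrightarrow> P y \<Longrightarrow> P (x + y)"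
  shows "P (q :: 'a \<Rightarrow>\<^sub>0 'b :: comm_monoid_add)"
proof -
  have "P (\<Sum>w\<in>A. single w (lookup q w))" if "finite A" "A \<subseteq> keys q" for A
    using that by (induction A) (auto intro: assms)
  moreover have "(\<Sum>w\<in>keys q. single w (lookup q w)) = q"
    by (rule poly_mapping_eqI) (simp add: lookup_sum lookup_single when_def in_keys_iff)
  ultimately show ?thesis
    by (metis finite_keys order_refl)
qed

text \<open>
  A unital \<open>'k\<close>-algebra structure on the ring \<open>'a\<close>, given by its structure map.
\<close>

locale central_scalars =
  fixes sc :: "'k :: field \<Rightarrow> 'a :: ring_1"
  assumes sc_add: "sc (a + b) = sc a + sc b"
    and sc_mult: "sc (a * b) = sc a * sc b"
    and sc_one [simp]: "sc 1 = 1"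
    and sc_commute: "x * sc a = sc a * x"
begin

lemma sc_zero [simp]: "sc 0 = 0"
  using sc_add[of 0 0] by simp

lemma sc_left_commute: "x * (sc a * y) = sc a * (x * y)"
  by (metis mult.assoc sc_commute)

definition ev :: "('g \<Rightarrow> 'a) \<Rightarrow> ('k, 'g) free_alg \<Rightarrow> 'a" where
  "ev f q = (\<Sum>w\<in>keys q. sc (lookup q w) * prod_list (map f (letters w)))"

lemma ev_superset:
  assumes "finite A" "keys q \<subseteq> A"
  shows "ev f q = (\<Sum>w\<in>A. sc (lookup q w) * prod_list (map f (letters w)))"
  unfolding ev_def using assms by (intro sum.mono_neutral_left) (auto simp: in_keys_iff)

lemma ev_zero [simp]: "ev f 0 = 0"
  by (simp add: ev_def)

lemma ev_single: "ev f (single w c) = sc c * prod_list (map f (letters w))"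
  by (subst ev_superset[of "{w}"]) auto

lemma ev_add: "ev f (q + r) = ev f q + ev f r"
proof -
  let ?A = "keys q \<union> keys r"
  have "keys (q + r) \<subseteq> ?A" by (rule keys_add)
  then show ?thesis
    by (simp add: ev_superset[of ?A] lookup_add sc_add algebra_simps sum.distrib)
qed

lemma ev_one [simp]: "ev f 1 = 1"
  by (simp add: ev_single zero_free_monoid_def flip: single_one)

lemma ev_gen [simp]: "ev f (gen x) = f x"
  by (simp add: gen_def ev_single)

lemma ev_uminus: "ev f (- q) = - ev f q"
  using ev_add[of f "- q" q] by (simp add: eq_neg_iff_add_eq_0)

lemma ev_diff: "ev f (q - r) = ev f q - ev f r"
  using ev_add[of f q "- r"] by (simp add: ev_uminus)

lemma ev_sum: "ev f (sum g A) = (\<Sum>x\<in>A. ev f (g x))"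
  by (induction A rule: infinite_finite_induct) (auto simp: ev_add)

lemma ev_mult: "ev f (q * r) = ev f q * ev f r"
proof (induction q rule: poly_mapping_sum_induct)
  case (single w c)
  show ?case
  proof (induction r rule: poly_mapping_sum_induct)
    case (single u d)
    have "sc c * prod_list (map f (letters w)) * (sc d * prod_list (map f (letters u)))
      = sc c * (sc d * (prod_list (map f (letters w)) * prod_list (map f (letters u))))"
      by (simp only: mult.assoc sc_left_commute[of "prod_list (map f (letters w))"])
    then show ?case
      by (simp add: mult_single ev_single plus_free_monoid_def sc_mult mult.assoc)
  qed (auto simp: algebra_simps ev_add)
qed (auto simp: algebra_simps ev_add)

end

lemma word_eq_prod_gen: "single (Word xs) (1 :: 'k :: field) = prod_list (map gen xs)"
proof (induction xs)
  case Nil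
  then show ?case by (metis list.simps(8) prod_list.Nil single_one zero_free_monoid_def)
next
  case (Cons x xs)
  have "single (Word (x # xs)) (1 :: 'k) = gen x * single (Word xs) 1"
    by (simp add: gen_def mult_single plus_free_monoid_def)
  then show ?case using Cons by simp
qed

lemma single_eq_scaled_word:
  "single w (c :: 'k :: field) = single 0 c * prod_list (map gen (letters w))"
  by (cases w) (simp add: mult_single flip: word_eq_prod_gen)

lemma constant_central: "q * single 0 c = single 0 (c :: 'k :: field) * (q :: ('k, 'g) free_alg)"
  by (induction q rule: poly_mapping_sum_induct) (auto simp: algebra_simps mult_single)

text \<open>
  Free algebras are themselves algebras in this sense, so that \<open>sc_left_commute\<close> moves scalars
  inside polynomials as well.
\<close>

interpretation free_scalars: central_scalars "single (0 :: 'g free_monoid) :: 'k :: field \<Rightarrow> _"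
  by standard (simp_all add: single_add mult_single, rule constant_central)

section \<open>The free algebra on a set of generators\<close>

lemma free_carrier_simps [simp]:
  "\<one>\<^bsub>free_algebra X\<^esub> = 1" "\<zero>\<^bsub>free_algebra X\<^esub> = 0"
  "x \<otimes>\<^bsub>free_algebra X\<^esub> y = x * y" "x \<oplus>\<^bsub>free_algebra X\<^esub> y = x + y"
  "c \<odot>\<^bsub>free_algebra X\<^esub> x = single 0 c * x"
  by (simp_all add: free_algebra_def)

abbreviation polys :: "'g set \<Rightarrow> ('k :: field, 'g) free_alg set" where
  "polys X \<equiv> carrier (free_algebra X)"

lemma in_free_carrier:
  "p \<in> polys X \<longleftrightarrow> (\<forall>w\<in>keys p. set (letters w) \<subseteq> X)"
  by (simp add: free_algebra_def)

lemma fc_add: "p \<in> polys X \<Longrightarrow> q \<in> polys X \<Longrightarrow> p + q \<in> polys X"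
  unfolding in_free_carrier using keys_add[of p q] by blast

lemma fc_mult: "p \<in> polys X \<Longrightarrow> q \<in> polys X \<Longrightarrow> p * q \<in> polys X"
  unfolding in_free_carrier using keys_mult[of p q] by (fastforce simp: plus_free_monoid_def)

lemma fc_single: "set (letters w) \<subseteq> X \<Longrightarrow> single w c \<in> polys X"
  unfolding in_free_carrier by auto

lemma fc_const: "single 0 c \<in> polys X"
  by (rule fc_single) (simp add: zero_free_monoid_def)

lemma fc_zero: "0 \<in> polys X"
  and fc_one: "1 \<in> polys X"
  unfolding in_free_carrier by (auto simp: zero_free_monoid_def)

lemma fc_uminus: "p \<in> polys X \<Longrightarrow> - p \<in> polys X"
  unfolding in_free_carrier by (auto simp: in_keys_iff)

lemma fc_diff: "p \<in> polys X \<Longrightarrow> q \<in> polys X \<Longrightarrow> p - q \<in> polys X"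
  by (metis ab_group_add_class.ab_diff_conv_add_uminus fc_add fc_uminus)

lemma fc_gen: "x \<in> X \<Longrightarrow> gen x \<in> polys X"
  unfolding gen_def by (rule fc_single) simp

lemma fc_sum: "(\<And>i. i \<in> A \<Longrightarrow> f i \<in> polys X) \<Longrightarrow> sum f A \<in> polys X"
  by (induction A rule: infinite_finite_induct) (auto simp: fc_zero fc_add)

lemma fc_prod_list: "(\<And>x. x \<in> set xs \<Longrightarrow> x \<in> polys X) \<Longrightarrow> prod_list xs \<in> polys X"
  by (induction xs) (auto simp: fc_one fc_mult)

lemmas fc_intros = fc_zero fc_one fc_add fc_mult fc_uminus fc_diff fc_const fc_gen fc_sum fc_prod_list

lemma free_algebra_ring: "ring (free_algebra X :: ('k :: field, ('k, 'g) free_alg) module)"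
proof (rule ringI)
  show "abelian_group (free_algebra X :: ('k, ('k, 'g) free_alg) module)"
  proof (rule abelian_groupI, goal_cases)
    case (6 x)
    then show ?case by (intro bexI[of _ "- x"]) (auto simp: fc_uminus)
  qed (auto simp: fc_intros algebra_simps)
  show "monoid (free_algebra X :: ('k, ('k, 'g) free_alg) module)"
    by (rule monoidI) (auto simp: fc_intros algebra_simps)
qed (auto simp: algebra_simps)

text \<open>
  The augmentation ideal is spanned by the nonempty words, so it is enough to treat these.
\<close>

lemma aug_sum_induct [consumes 1, case_names zero word add]:
  assumes q: "q \<in> augmentation_ideal X"
    and "P 0" "\<And>x xs c. set (x # xs) \<subseteq> X \<Longrightarrow> P (single 0 c * prod_list (map gen (x # xs)))"
    and "\<And>x y. P x \<Longrightarrow> P y \<Longrightarrow> P (x + y)"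
  shows "P q"
proof (induction q rule: poly_mapping_sum_induct)
  case (single w c)
  have "w \<noteq> 0" "set (letters w) \<subseteq> X"
    using q single by (auto simp: augmentation_ideal_def in_free_carrier in_keys_iff)
  then obtain x xs where "letters w = x # xs"
    by (metis free_monoid.exhaust_sel neq_Nil_conv zero_free_monoid_def)
  with \<open>set (letters w) \<subseteq> X\<close> show ?case
    using assms(3)[of x xs c] by (simp add: single_eq_scaled_word[of w c])
qed (use assms in auto)

section \<open>Calculating modulo the Leavitt relations\<close>

definition path_elem :: "'e list \<Rightarrow> 'v \<Rightarrow> ('k :: field, ('v, 'e) lpa_gen) free_alg" where
  "path_elem w b = prod_list (map (\<lambda>e. gen (Edge e)) w) * gen (Vertex b)"

text \<open>
  Working with representatives in the free algebra, the span has to contain the ideal of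
  relations; this makes it a union of classes.
\<close>

inductive_set path_span :: "('v, 'e) pre_digraph \<Rightarrow> ('k :: field, ('v, 'e) lpa_gen) free_alg set"
  for E where
  paths_ideal: "x \<in> lpa_ideal E \<Longrightarrow> x \<in> path_span E"
| paths_walk: "pre_digraph.awalk E a w b \<Longrightarrow> single 0 c * path_elem w b \<in> path_span E"
| paths_add: "x \<in> path_span E \<Longrightarrow> y \<in> path_span E \<Longrightarrow> x + y \<in> path_span E"

text \<open>
  Level \<open>k\<close> consists of the \<open>x\<close> for which \<open>x \<alpha>\<close> is a combination of paths whenever \<open>\<alpha>\<close> is a path of
  length \<open>k\<close>, or a shorter one that ends in a sink.  At a sink there is no further edge that
  could cancel a ghost edge, so there the product itself must be free of ghost edges.
\<close>

fun ghost_filtration ::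
    "('v, 'e) pre_digraph \<Rightarrow> nat \<Rightarrow> ('k :: field, ('v, 'e) lpa_gen) free_alg set" where
  "ghost_filtration E 0 = path_span E"
| "ghost_filtration E (Suc k) = {x \<in> polys (lpa_gens E).
     (\<forall>e\<in>arcs E. x * gen (Edge e) \<in> ghost_filtration E k) \<and>
     (\<forall>v\<in>verts E. \<not> regular E v \<longrightarrow> x * gen (Vertex v) \<in> path_span E)}"

locale lpa = fin_digraph E for E :: "('v, 'e) pre_digraph" +
  fixes K :: "'k :: field itself"
begin

abbreviation C :: "('k, ('v, 'e) lpa_gen) free_alg set" where
  "C \<equiv> polys (lpa_gens E)"

abbreviation I :: "('k, ('v, 'e) lpa_gen) free_alg set" where
  "I \<equiv> lpa_ideal E"

abbreviation V :: "'v \<Rightarrow> ('k, ('v, 'e) lpa_gen) free_alg" where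
  "V v \<equiv> gen (Vertex v)"
abbreviation Ed :: "'e \<Rightarrow> ('k, ('v, 'e) lpa_gen) free_alg" where
  "Ed e \<equiv> gen (Edge e)"
abbreviation Gh :: "'e \<Rightarrow> ('k, ('v, 'e) lpa_gen) free_alg" where
  "Gh e \<equiv> gen (Ghost e)"

lemma V_C: "v \<in> verts E \<Longrightarrow> V v \<in> C"
  and Ed_C: "e \<in> arcs E \<Longrightarrow> Ed e \<in> C"
  and Gh_C: "e \<in> arcs E \<Longrightarrow> Gh e \<in> C"
  by (auto intro!: fc_gen simp: lpa_gens_def)

lemma finite_out_arcs [simp]: "finite (out_arcs E v)"
  by (rule finite_subset[of _ "arcs E"]) (auto simp: out_arcs_def)

lemma relators_in_C: "lpa_relators E \<subseteq> C"
proof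
  fix x :: "('k, ('v, 'e) lpa_gen) free_alg"
  assume "x \<in> lpa_relators E"
  then show "x \<in> C"
    by cases (auto intro!: fc_diff fc_mult fc_sum V_C Ed_C Gh_C fc_zero simp: regular_def)
qed

lemma ideal_I: "ideal I (free_algebra (lpa_gens E))"
  unfolding lpa_ideal_def by (intro ring.genideal_ideal free_algebra_ring relators_in_C)

lemma relator_in_I: "x \<in> lpa_relators E \<Longrightarrow> x \<in> I"
  unfolding lpa_ideal_def using ring.genideal_self[OF free_algebra_ring relators_in_C] by blast

lemma I_sub_C: "x \<in> I \<Longrightarrow> x \<in> C"
  using ideal_I by (meson additive_subgroup.a_Hcarr ideal.axioms(1))

lemma I_add: "x \<in> I \<Longrightarrow> y \<in> I \<Longrightarrow> x + y \<in> I"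
  using additive_subgroup.a_closed[OF ideal.axioms(1)[OF ideal_I]] by simp

lemma I_left: "x \<in> C \<Longrightarrow> y \<in> I \<Longrightarrow> x * y \<in> I"
  using ideal.I_l_closed[OF ideal_I] by simp

lemma I_right: "x \<in> I \<Longrightarrow> y \<in> C \<Longrightarrow> x * y \<in> I"
  using ideal.I_r_closed[OF ideal_I] by simp

lemma I_zero: "0 \<in> I"
  using additive_subgroup.zero_closed[OF ideal.axioms(1)[OF ideal_I]] by simp

lemma I_uminus: "x \<in> I \<Longrightarrow> - x \<in> I"
  using I_left[OF fc_uminus[OF fc_one]] by fastforce

definition eqv :: "('k, ('v, 'e) lpa_gen) free_alg \<Rightarrow> ('k, ('v, 'e) lpa_gen) free_alg \<Rightarrow> bool" (infix "\<approx>" 50) where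
  "x \<approx> y \<longleftrightarrow> x \<in> C \<and> y \<in> C \<and> x - y \<in> I"

lemma eqv_refl: "x \<in> C \<Longrightarrow> x \<approx> x"
  by (simp add: eqv_def I_zero)

lemma eqv_sym: "x \<approx> y \<Longrightarrow> y \<approx> x"
  unfolding eqv_def using I_uminus[of "x - y"] by simp

lemma eqv_trans [trans]: "x \<approx> y \<Longrightarrow> y \<approx> z \<Longrightarrow> x \<approx> z"
  unfolding eqv_def using I_add[of "x - y" "y - z"] by simp

lemma eqv_add: "x \<approx> y \<Longrightarrow> z \<approx> w \<Longrightarrow> x + z \<approx> y + w"
  unfolding eqv_def using I_add[of "x - y" "z - w"] by (simp add: fc_add algebra_simps)

lemma eqv_mult: assumes "x \<approx> y" "z \<approx> w" shows "x * z \<approx> y * w"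
proof -
  have "x * z - y * w = (x - y) * z + y * (z - w)" by (simp add: algebra_simps)
  moreover have "(x - y) * z \<in> I" "y * (z - w) \<in> I" "x * z \<in> C" "y * w \<in> C"
    using assms unfolding eqv_def by (simp_all add: I_left I_right fc_mult)
  ultimately show ?thesis unfolding eqv_def by (simp add: I_add)
qed

lemma eqv_sum: "(\<And>i. i \<in> A \<Longrightarrow> f i \<approx> g i) \<Longrightarrow> sum f A \<approx> sum g A"
  by (induction A rule: infinite_finite_induct) (auto intro: eqv_refl fc_zero eqv_add)

lemma eqv_C: "x \<approx> y \<Longrightarrow> x \<in> C" "x \<approx> y \<Longrightarrow> y \<in> C"
  by (auto simp: eqv_def)

lemma eqv_left: "x \<in> C \<Longrightarrow> y \<approx> z \<Longrightarrow> x * y \<approx> x * z"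
  by (rule eqv_mult[OF eqv_refl])

lemma eqv_right: "x \<in> C \<Longrightarrow> y \<approx> z \<Longrightarrow> y * x \<approx> z * x"
  by (rule eqv_mult[OF _ eqv_refl])

lemma eqv_0_iff: "x \<approx> 0 \<longleftrightarrow> x \<in> I"
  by (auto simp: eqv_def I_sub_C fc_zero)

lemma V_V: "v \<in> verts E \<Longrightarrow> w \<in> verts E \<Longrightarrow> V v * V w \<approx> (if v = w then V w else 0)"
  unfolding eqv_def using lpa_relators.vertex_mult[of v E w]
  by (auto intro!: fc_mult V_C fc_zero relator_in_I simp del: diff_zero)

lemma V_V_same: "v \<in> verts E \<Longrightarrow> V v * V v \<approx> V v"
  and V_V_diff: "v \<in> verts E \<Longrightarrow> w \<in> verts E \<Longrightarrow> v \<noteq> w \<Longrightarrow> V v * V w \<approx> 0"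
  using V_V[of v v] V_V[of v w] by simp_all

lemma V_Ed: "e \<in> arcs E \<Longrightarrow> V (tail E e) * Ed e \<approx> Ed e"
  and Ed_V: "e \<in> arcs E \<Longrightarrow> Ed e * V (head E e) \<approx> Ed e"
  and V_Gh: "e \<in> arcs E \<Longrightarrow> V (head E e) * Gh e \<approx> Gh e"
  and Gh_V: "e \<in> arcs E \<Longrightarrow> Gh e * V (tail E e) \<approx> Gh e"
  unfolding eqv_def
  by (auto intro!: fc_mult V_C Ed_C Gh_C relator_in_I lpa_relators.intros)

lemma Gh_Ed: "e \<in> arcs E \<Longrightarrow> f \<in> arcs E \<Longrightarrow> Gh e * Ed f \<approx> (if e = f then V (head E e) else 0)"
  unfolding eqv_def using lpa_relators.ghost_edge[of e E f]
  by (auto intro!: fc_mult V_C Ed_C Gh_C fc_zero relator_in_I simp del: diff_zero)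

lemma CK: "regular E v \<Longrightarrow> V v \<approx> (\<Sum>e\<in>out_arcs E v. Ed e * Gh e)"
  unfolding eqv_def using lpa_relators.cuntz_krieger[of E v]
  by (auto intro!: fc_mult fc_sum V_C Ed_C Gh_C relator_in_I simp: regular_def)

text \<open>
  An element with source \<open>u\<close> is annihilated by all vertices other than \<open>u\<close>; hence the sum of
  the vertices fixes it.
\<close>

lemma V_left:
  assumes x: "x \<in> C" "V u * x \<approx> x" and uv: "u \<in> verts E" "v \<in> verts E"
  shows "V v * x \<approx> (if v = u then x else 0)"
proof (cases "v = u")
  case False
  have "V v * x \<approx> V v * (V u * x)" using uv by (intro eqv_left V_C eqv_sym[OF x(2)])
  also have "\<dots> = V v * V u * x" by (simp add: mult.assoc)
  also have "\<dots> \<approx> 0 * x" by (intro eqv_right x(1) V_V_diff uv False)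
  finally show ?thesis using False by simp
qed (use x in simp)

lemma V_right:
  assumes x: "x \<in> C" "x * V u \<approx> x" and uv: "u \<in> verts E" "v \<in> verts E"
  shows "x * V v \<approx> (if v = u then x else 0)"
proof (cases "v = u")
  case False
  have "x * V v \<approx> x * V u * V v" using uv by (intro eqv_right V_C eqv_sym[OF x(2)])
  also have "\<dots> = x * (V u * V v)" by (simp add: mult.assoc)
  also have "\<dots> \<approx> x * 0" by (intro eqv_left x(1) V_V_diff uv not_sym[OF False])
  finally show ?thesis using False by simp
qed (use x in simp)

lemma V_Ed': "e \<in> arcs E \<Longrightarrow> v \<in> verts E \<Longrightarrow> V v * Ed e \<approx> (if v = tail E e then Ed e else 0)"
  and Gh_V': "e \<in> arcs E \<Longrightarrow> v \<in> verts E \<Longrightarrow> Gh e * V v \<approx> (if v = tail E e then Gh e else 0)"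
  by (intro V_left V_right Ed_C Gh_C V_Ed Gh_V tail_in_verts; assumption)+

definition one_V :: "('k, ('v, 'e) lpa_gen) free_alg" where
  "one_V = (\<Sum>v\<in>verts E. V v)"

lemma one_V_C: "one_V \<in> C"
  by (auto simp: one_V_def intro!: fc_sum V_C)

lemma one_V_left:
  assumes "V u * x \<approx> x" "u \<in> verts E"
  shows "one_V * x \<approx> x"
proof -
  have "one_V * x \<approx> (\<Sum>v\<in>verts E. if v = u then x else 0)"
    unfolding one_V_def sum_distrib_right by (intro eqv_sum V_left assms eqv_C(2)[OF assms(1)])
  then show ?thesis using assms(2) by simp
qed

lemma one_V_right:
  assumes "x * V u \<approx> x" "u \<in> verts E"
  shows "x * one_V \<approx> x"
proof -
  have "x * one_V \<approx> (\<Sum>v\<in>verts E. if v = u then x else 0)"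
    unfolding one_V_def sum_distrib_left by (intro eqv_sum V_right assms eqv_C(2)[OF assms(1)])
  then show ?thesis using assms(2) by simp
qed

lemma one_V_gen:
  assumes "x \<in> lpa_gens E"
  shows "one_V * gen x \<approx> gen x" "gen x * one_V \<approx> gen x"
proof -
  have "one_V * gen x \<approx> gen x \<and> gen x * one_V \<approx> gen x"
    using assms unfolding lpa_gens_def
  proof (elim UnE imageE)
    fix v assume x: "x = Vertex v" "v \<in> verts E"
    show ?thesis unfolding x(1)
      by (intro conjI one_V_left[OF V_V_same] one_V_right[OF V_V_same] x(2))
  next
    fix e assume x: "x = Edge e" "e \<in> arcs E"
    show ?thesis unfolding x(1)
      by (intro conjI one_V_left[OF V_Ed] one_V_right[OF Ed_V] tail_in_verts head_in_verts x(2))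
  next
    fix e assume x: "x = Ghost e" "e \<in> arcs E"
    show ?thesis unfolding x(1)
      by (intro conjI one_V_left[OF V_Gh] one_V_right[OF Gh_V] tail_in_verts head_in_verts x(2))
  qed
  then show "one_V * gen x \<approx> gen x" "gen x * one_V \<approx> gen x" by auto
qed

lemma aug_C: "x \<in> augmentation_ideal (lpa_gens E) \<Longrightarrow> x \<in> C"
  by (simp add: augmentation_ideal_def)

text \<open>
  The sum of the vertices fixes both ends of a nonempty word, hence the augmentation ideal.  It
  is not congruent to the constant \<open>1\<close>, which lies outside the algebra.
\<close>

lemma one_V_unit:
  assumes "x \<in> augmentation_ideal (lpa_gens E)"
  shows "one_V * x \<approx> x" "x * one_V \<approx> x"
proof -
  have "one_V * x \<approx> x \<and> x * one_V \<approx> x"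
    using assms
  proof (induction rule: aug_sum_induct)
    case zero
    then show ?case by (simp add: eqv_refl fc_zero)
  next
    case (add x y)
    then show ?case by (auto simp: algebra_simps intro: eqv_add)
  next
    case (word g gs c)
    let ?c = "single 0 c" and ?w = "prod_list (map gen gs)"
    have w: "?w \<in> C" using word by (intro fc_prod_list) (auto intro: fc_gen)
    have c: "?c \<in> C" by (rule fc_const)
    have "?c * (one_V * gen g) * ?w \<approx> ?c * gen g * ?w"
      using word by (intro eqv_right eqv_left w c one_V_gen) auto
    moreover have "one_V * (?c * (gen g * ?w)) = ?c * (one_V * gen g) * ?w"
      by (simp only: mult.assoc free_scalars.sc_left_commute[of one_V])
    moreover obtain hs h where h: "g # gs = hs @ [h]" by (metis rev_exhaust list.distinct(1))
    have "?c * prod_list (map gen hs) * (gen h * one_V) \<approx> ?c * prod_list (map gen hs) * gen h"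
    proof (intro eqv_left one_V_gen fc_mult c fc_prod_list)
      show "h \<in> lpa_gens E" using word h
        by (metis in_set_conv_decomp subset_code(1))
      show "x \<in> set (map gen hs) \<Longrightarrow> x \<in> C" for x using word h
        by (auto intro!: fc_gen)
    qed
    moreover have eq: "gen g * ?w = prod_list (map gen hs) * gen h"
      using arg_cong[OF h, of "\<lambda>l. prod_list (map gen l)"] by simp
    have "?c * (gen g * ?w) * one_V = ?c * prod_list (map gen hs) * (gen h * one_V)"
      "?c * (gen g * ?w) = ?c * prod_list (map gen hs) * gen h"
      by (simp_all only: eq mult.assoc)
    ultimately show ?case by (simp only: mult.assoc list.map prod_list.Cons)
  qed
  then show "one_V * x \<approx> x" "x * one_V \<approx> x" by auto
qed

section \<open>The span of the paths\<close>

abbreviation path :: "'e list \<Rightarrow> 'v \<Rightarrow> ('k, ('v, 'e) lpa_gen) free_alg" where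
  "path \<equiv> path_elem"
lemmas path_def = path_elem_def

abbreviation Paths :: "('k, ('v, 'e) lpa_gen) free_alg set" where
  "Paths \<equiv> path_span E"

lemmas paths_ideal = path_span.paths_ideal and paths_walk = path_span.paths_walk and paths_add = path_span.paths_add

lemma path_C: assumes "awalk a w b" shows "path w b \<in> C"
  unfolding path_def using assms awalk_last_in_verts[OF assms]
  by (intro fc_mult fc_prod_list V_C) (auto intro!: Ed_C simp: awalk_def)

lemma path_C': "awalk a w b \<Longrightarrow> single 0 c * path w b \<in> C"
  by (intro fc_mult fc_const path_C)

lemma paths_C: "x \<in> Paths \<Longrightarrow> x \<in> C"
  by (induction rule: path_span.induct) (auto intro: I_sub_C fc_add path_C')

lemma paths_eqv: assumes "x \<in> Paths" "y \<approx> x" shows "y \<in> Paths"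
proof -
  have "x + (y - x) \<in> Paths" using assms(2) by (intro paths_add assms(1) paths_ideal) (auto simp: eqv_def)
  then show ?thesis by simp
qed

lemma paths_zero: "0 \<in> Paths" by (intro paths_ideal I_zero)

lemma paths_scale: "x \<in> Paths \<Longrightarrow> single 0 c * x \<in> Paths"
proof (induction rule: path_span.induct)
  case (paths_walk a w b d)
  have "single 0 c * (single 0 d * path w b) = single 0 (c * d) * path w b"
    by (simp add: mult_single flip: mult.assoc)
  then show ?case using paths_walk path_span.paths_walk by metis
qed (auto simp: algebra_simps intro: path_span.intros I_left fc_const)

lemma paths_walk1: "awalk a w b \<Longrightarrow> path w b \<in> Paths"
  using paths_walk[of E a w b 1] by simp

lemma path_V: assumes "awalk a w b" "v \<in> verts E"
  shows "path w b * V v \<approx> (if b = v then path w b else 0)"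
proof -
  have "b \<in> verts E" using assms by auto
  then have "prod_list (map Ed w) * (V b * V v) \<approx> prod_list (map Ed w) * (if b = v then V v else 0)"
    using assms by (intro eqv_left V_V fc_prod_list) (auto intro!: Ed_C simp: awalk_def)
  then show ?thesis by (auto simp: path_def mult.assoc)
qed

lemma path_Ed: assumes "awalk a w b" "e \<in> arcs E"
  shows "path w b * Ed e \<approx> (if b = tail E e then path (w @ [e]) (head E e) else 0)"
proof -
  have w: "prod_list (map Ed w) \<in> C" using assms by (intro fc_prod_list) (auto intro!: Ed_C simp: awalk_def)
  have b: "b \<in> verts E" using assms by auto
  have *: "prod_list (map Ed w) * (V b * Ed e) \<approx> prod_list (map Ed w) * (if b = tail E e then Ed e else 0)"
    using assms b w by (intro eqv_left V_Ed') auto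
  have "prod_list (map Ed w) * Ed e \<approx> prod_list (map Ed w) * (Ed e * V (head E e))"
    using assms by (intro eqv_left w eqv_sym[OF Ed_V])
  with * show ?thesis by (auto simp: path_def mult.assoc intro: eqv_trans)
qed

lemma V_path: assumes "awalk a w b" "v \<in> verts E"
  shows "V v * path w b \<approx> (if v = a then path w b else 0)"
proof (cases w)
  case Nil
  with assms show ?thesis using V_V[of v b] by (auto simp: path_def awalk_Nil_iff split: if_splits)
next
  case (Cons e u)
  then have e: "e \<in> arcs E" "tail E e = a" and u: "awalk (head E e) u b" 
    using assms(1) by (auto simp: awalk_Cons_iff)
  have "V v * Ed e * path u b \<approx> (if v = tail E e then Ed e else 0) * path u b"
    using e assms by (intro eqv_right path_C[OF u] V_Ed') auto
  then show ?thesis using e by (auto simp: Cons path_def mult.assoc)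
qed

lemma Ed_path: assumes "awalk a w b" "e \<in> arcs E"
  shows "Ed e * path w b \<approx> (if head E e = a then path (e # w) b else 0)"
proof -
  have "Ed e * path w b \<approx> Ed e * V (head E e) * path w b"
    using assms by (intro eqv_right path_C[OF assms(1)] eqv_sym[OF Ed_V])
  also have "\<dots> = Ed e * (V (head E e) * path w b)" by (simp add: mult.assoc)
  also have "\<dots> \<approx> Ed e * (if head E e = a then path w b else 0)"
    using assms by (intro eqv_left Ed_C V_path) auto
  finally show ?thesis by (auto simp: path_def mult.assoc)
qed

lemma paths_mult:
  assumes "x \<in> Paths" "l \<in> C" "r \<in> C"
    and walk: "\<And>a w b. awalk a w b \<Longrightarrow> l * path w b * r \<in> Paths"
  shows "l * x * r \<in> Paths"
  using assms(1)
proof (induction rule: path_span.induct)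
  case (paths_ideal x)
  then show ?case using assms by (intro path_span.paths_ideal I_left I_right)
next
  case (paths_walk a w b c)
  have "l * (single 0 c * path w b) * r = single 0 c * (l * path w b * r)"
    by (simp only: mult.assoc free_scalars.sc_left_commute[of l])
  then show ?case using paths_scale[OF walk[OF paths_walk]] by simp
next
  case (paths_add x y)
  then show ?case by (auto simp: distrib_left distrib_right intro: path_span.paths_add)
qed

lemma paths_right_V:
  assumes "x \<in> Paths" "v \<in> verts E" shows "x * V v \<in> Paths"
proof -
  have "path w b * V v \<in> Paths" if "awalk a w b" for a w b
    using paths_eqv[OF _ path_V[OF that assms(2)]] paths_walk1[OF that] paths_zero by (cases "b = v") auto
  then show ?thesis using paths_mult[OF assms(1) fc_one V_C[OF assms(2)]] by simp
qed

lemma paths_right_Ed: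
  assumes "x \<in> Paths" "e \<in> arcs E" shows "x * Ed e \<in> Paths"
proof -
  have "path w b * Ed e \<in> Paths" if w: "awalk a w b" for a w b
  proof (rule paths_eqv[OF _ path_Ed[OF w assms(2)]])
    have "b = tail E e \<Longrightarrow> awalk a (w @ [e]) (head E e)"
      using w assms(2) by (auto simp: awalk_Cons_iff awalk_Nil_iff)
    then show "(if b = tail E e then path (w @ [e]) (head E e) else 0) \<in> Paths"
      by (auto intro: paths_walk1 paths_zero)
  qed
  then show ?thesis using paths_mult[OF assms(1) fc_one Ed_C[OF assms(2)]] by simp
qed

lemma paths_left_V:
  assumes "x \<in> Paths" "v \<in> verts E" shows "V v * x \<in> Paths"
proof -
  have "V v * path w b \<in> Paths" if "awalk a w b" for a w b
    using paths_eqv[OF _ V_path[OF that assms(2)]] paths_walk1[OF that] paths_zero by (cases "v = a") auto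
  then show ?thesis using paths_mult[OF assms(1) V_C[OF assms(2)] fc_one] by simp
qed

lemma paths_left_Ed:
  assumes "x \<in> Paths" "e \<in> arcs E" shows "Ed e * x \<in> Paths"
proof -
  have "Ed e * path w b \<in> Paths" if w: "awalk a w b" for a w b
  proof (rule paths_eqv[OF _ Ed_path[OF w assms(2)]])
    have "head E e = a \<Longrightarrow> awalk (tail E e) (e # w) b"
      using w assms(2) by (auto simp: awalk_Cons_iff)
    then show "(if head E e = a then path (e # w) b else 0) \<in> Paths"
      by (auto intro: paths_walk1 paths_zero)
  qed
  then show ?thesis using paths_mult[OF assms(1) Ed_C[OF assms(2)] fc_one] by simp
qed

text \<open>
  The ghost edge either cancels the first edge or kills the path.
\<close>

lemma Gh_path_Cons: assumes "awalk a (f # w) b" "e \<in> arcs E" shows "Gh e * path (f # w) b \<in> Paths"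
proof -
  have f: "f \<in> arcs E" and w: "awalk (head E f) w b" using assms(1) by (auto simp: awalk_Cons_iff)
  have "Gh e * Ed f * path w b \<approx> (if e = f then V (head E e) else 0) * path w b"
    using assms f by (intro eqv_right path_C[OF w] Gh_Ed)
  also have "\<dots> \<approx> (if e = f then path w b else 0)"
    using V_path[OF w, of "head E f"] f by (auto intro: eqv_refl fc_zero)
  finally have *: "Gh e * Ed f * path w b \<approx> (if e = f then path w b else 0)" .
  have "(if e = f then path w b else 0) \<in> Paths" using w by (auto intro: paths_walk1 paths_zero)
  from paths_eqv[OF this *] show ?thesis by (simp add: path_def mult.assoc)
qed

text \<open>
  A ghost edge need not preserve the span of the paths, since it survives in front of a path of
  length \<open>0\<close>.  One more edge on the right removes it there as well.
\<close>

lemma Gh_paths_Ed: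
  assumes "x \<in> Paths" "e \<in> arcs E" "f \<in> arcs E"
  shows "Gh e * x * Ed f \<in> Paths"
proof (rule paths_mult[OF assms(1) Gh_C[OF assms(2)] Ed_C[OF assms(3)]])
  fix a w b assume walk: "awalk a w b"
  show "Gh e * path w b * Ed f \<in> Paths"
  proof (cases w)
    case Nil
    have b: "b \<in> verts E" using walk by auto
    have "Gh e * (V b * Ed f) \<approx> Gh e * (if b = tail E f then Ed f else 0)"
      using assms b by (intro eqv_left Gh_C V_Ed') auto
    also have "\<dots> \<approx> (if b = tail E f \<and> e = f then V (head E e) else 0)"
      using Gh_Ed[of e f] assms by (auto intro: eqv_refl fc_zero)
    finally have *: "Gh e * (V b * Ed f) \<approx> (if b = tail E f \<and> e = f then V (head E e) else 0)" .
    have "awalk (head E e) [] (head E e)" using assms by (simp add: awalk_Nil_iff)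
    then have "(if b = tail E f \<and> e = f then V (head E e) else 0) \<in> Paths"
      using paths_walk1[of "head E e" "[]"] by (auto simp: path_def paths_zero)
    from paths_eqv[OF this *] show ?thesis by (simp add: Nil path_def mult.assoc)
  next
    case (Cons g u)
    then show ?thesis using Gh_path_Cons walk assms by (intro paths_right_Ed) auto
  qed
qed

text \<open>
  The only possible remainder is a ghost edge in front of the sink \<open>v\<close>, and this is \<open>0\<close> because
  the corresponding edge cannot start at \<open>v\<close>.
\<close>

lemma Gh_paths_sink:
  assumes "x \<in> Paths" "e \<in> arcs E" "v \<in> verts E" "\<not> regular E v"
  shows "Gh e * x * V v \<in> Paths"
proof (rule paths_mult[OF assms(1) Gh_C[OF assms(2)] V_C[OF assms(3)]])
  fix a w b assume walk: "awalk a w b"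
  show "Gh e * path w b * V v \<in> Paths"
  proof (cases w)
    case Nil
    have b: "b \<in> verts E" using walk by auto
    have "Gh e * (V b * V v) \<approx> Gh e * (if b = v then V v else 0)"
      using V_V[of b v] assms b by (intro eqv_left Gh_C) (auto split: if_splits)
    also have "tail E e \<noteq> v" using assms by (auto simp: regular_def out_arcs_def)
    then have "Gh e * (if b = v then V v else 0) \<approx> 0"
      using Gh_V'[of e v] assms by (auto intro: eqv_refl fc_zero)
    finally show ?thesis using paths_eqv[OF paths_zero] by (simp add: Nil path_def mult.assoc)
  next
    case (Cons g u)
    then show ?thesis using Gh_path_Cons walk assms by (intro paths_right_V) auto
  qed
qed

section \<open>Clearing ghost edges\<close>

abbreviation D :: "nat \<Rightarrow> ('k, ('v, 'e) lpa_gen) free_alg set" where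
  "D \<equiv> ghost_filtration E"

lemma D_C: "x \<in> D k \<Longrightarrow> x \<in> C"
  by (cases k) (auto simp: paths_C)

lemma D_Suc: "D k \<subseteq> D (Suc k)"
  by (induction k) (auto intro: paths_right_Ed paths_right_V paths_C)

lemma D_mono: "k \<le> l \<Longrightarrow> x \<in> D k \<Longrightarrow> x \<in> D l"
  using lift_Suc_mono_le[of D k l] D_Suc by blast

lemma D_add: "x \<in> D k \<Longrightarrow> y \<in> D k \<Longrightarrow> x + y \<in> D k"
  by (induction k arbitrary: x y) (auto simp: algebra_simps intro: paths_add fc_add)

lemma D_scale: "x \<in> D k \<Longrightarrow> single 0 c * x \<in> D k"
  by (induction k arbitrary: x) (auto simp: mult.assoc intro: paths_scale fc_mult fc_const)

lemma D_left_V: "x \<in> D k \<Longrightarrow> v \<in> verts E \<Longrightarrow> V v * x \<in> D k"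
  by (induction k arbitrary: x) (auto simp: mult.assoc intro: paths_left_V fc_mult V_C)

lemma D_left_Ed: "x \<in> D k \<Longrightarrow> e \<in> arcs E \<Longrightarrow> Ed e * x \<in> D k"
  by (induction k arbitrary: x) (auto simp: mult.assoc intro: paths_left_Ed fc_mult Ed_C)

lemma D_eqv: "x \<in> D k \<Longrightarrow> y \<approx> x \<Longrightarrow> y \<in> D k"
proof (induction k arbitrary: x y)
  case (Suc k)
  then show ?case
    using eqv_C(1)[OF Suc.prems(2)] paths_eqv[OF _ eqv_right[OF V_C Suc.prems(2)]]
      Suc.IH[OF _ eqv_right[OF Ed_C Suc.prems(2)]] by auto
qed (auto intro: paths_eqv)

text \<open>
  Each ghost edge on the left costs one level; vertices and edges cost none.
\<close>

lemma D_left_Gh: "x \<in> D k \<Longrightarrow> e \<in> arcs E \<Longrightarrow> Gh e * x \<in> D (Suc k)"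
proof (induction k arbitrary: x)
  case 0
  then show ?case by (auto intro: Gh_paths_Ed Gh_paths_sink fc_mult Gh_C paths_C)
next
  case (Suc k)
  have "Gh e * x * Ed f \<in> D (Suc k)" if "f \<in> arcs E" for f
    using Suc.IH[of "x * Ed f"] Suc.prems that by (simp add: mult.assoc)
  moreover have "Gh e * x * V v \<in> Paths" if v: "v \<in> verts E" "\<not> regular E v" for v
  proof -
    have "Gh e * (x * V v) * V v \<in> Paths"
      using Suc.prems v by (intro Gh_paths_sink) auto
    moreover have "Gh e * x * V v \<approx> Gh e * (x * V v) * V v"
    proof -
      have "Gh e * x * V v \<approx> Gh e * x * (V v * V v)"
        using v Suc.prems by (intro eqv_left fc_mult Gh_C eqv_sym[OF V_V_same] D_C[OF Suc.prems(1)])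
      then show ?thesis by (simp add: mult.assoc)
    qed
    ultimately show ?thesis using paths_eqv by blast
  qed
  ultimately show ?case using Suc.prems by (auto intro: fc_mult Gh_C)
qed

lemma D_word: "set (g # gs) \<subseteq> lpa_gens E \<Longrightarrow> \<exists>k. prod_list (map gen (g # gs)) \<in> D k"
proof (induction gs arbitrary: g)
  case Nil
  then show ?case unfolding lpa_gens_def
  proof (simp, elim disjE imageE)
    fix v assume "g = Vertex v" "v \<in> verts E"
    then have "gen g \<in> D 0" using paths_walk1[of v "[]" v] by (simp add: path_def awalk_Nil_iff)
    then show "\<exists>k. gen g \<in> D k" by blast
  next
    fix e assume e: "g = Edge e" "e \<in> arcs E"
    then have "path [e] (head E e) \<in> Paths" 
      by (intro paths_walk1[of "tail E e"]) (simp add: awalk_simps)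
    then have "gen g \<in> D 0" using paths_eqv[OF _ eqv_sym[OF Ed_V]] e by (simp add: path_def)
    then show "\<exists>k. gen g \<in> D k" by blast
  next
    fix e assume e: "g = Ghost e" "e \<in> arcs E"
    then have "path [] (tail E e) \<in> D 0" 
      using paths_walk1[of "tail E e"] by (simp add: awalk_simps)
    then have "Gh e * V (tail E e) \<in> D 1" using D_left_Gh[of _ 0 e] e by (simp add: path_def)
    then have "gen g \<in> D 1" using D_eqv[OF _ eqv_sym[OF Gh_V]] e by blast
    then show "\<exists>k. gen g \<in> D k" by blast
  qed
next
  case (Cons h gs)
  then obtain k where k: "prod_list (map gen (h # gs)) \<in> D k" by auto
  have "g \<in> lpa_gens E" using Cons by auto
  then have "gen g * prod_list (map gen (h # gs)) \<in> D (Suc k)"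
    unfolding lpa_gens_def using D_left_Gh[OF k] D_left_Ed[OF k] D_left_V[OF k] D_mono[of k "Suc k"]
    by (auto simp del: ghost_filtration.simps)
  then show ?case by (metis list.simps(9) prod_list.Cons)
qed

text \<open>
  The number of ghost edges of a word bounds its level, and a sum lies in the highest level of
  its terms.
\<close>

lemma aug_in_D: "x \<in> augmentation_ideal (lpa_gens E) \<Longrightarrow> \<exists>k. x \<in> D k"
proof (induction rule: aug_sum_induct)
  case zero
  then show ?case by (metis ghost_filtration.simps(1) paths_zero)
next
  case (word g gs c)
  then show ?case using D_word D_scale by metis
next
  case (add x y)
  then obtain k l where "x \<in> D k" "y \<in> D l" by auto
  then have "x + y \<in> D (max k l)"
    using D_mono[of k "max k l" x] D_mono[of l "max k l" y] by (intro D_add) auto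
  then show ?case by blast
qed

end

section \<open>Leavitt families\<close>

lemma aug_iff: "x \<in> augmentation_ideal X \<longleftrightarrow> x \<in> polys X \<and> 0 \<notin> keys x"
  by (simp add: augmentation_ideal_def in_keys_iff)

lemma aug_zero: "0 \<in> augmentation_ideal X"
  by (simp add: augmentation_ideal_def fc_zero)

lemma aug_add: "x \<in> augmentation_ideal X \<Longrightarrow> y \<in> augmentation_ideal X \<Longrightarrow> x + y \<in> augmentation_ideal X"
  by (simp add: augmentation_ideal_def fc_add lookup_add)

lemma aug_diff: "x \<in> augmentation_ideal X \<Longrightarrow> y \<in> augmentation_ideal X \<Longrightarrow> x - y \<in> augmentation_ideal X"
  by (simp add: augmentation_ideal_def fc_diff lookup_minus)

lemma aug_gen: "x \<in> X \<Longrightarrow> gen x \<in> augmentation_ideal X"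
  unfolding augmentation_ideal_def by (simp add: fc_gen) (simp add: gen_def lookup_single zero_free_monoid_def when_def)

lemma free_monoid_add_eq_0: "(u :: 'g free_monoid) + v = 0 \<longleftrightarrow> u = 0 \<and> v = 0"
  by (cases u; cases v) (simp add: zero_free_monoid_def plus_free_monoid_def)

lemma aug_mult_left: "x \<in> polys X \<Longrightarrow> y \<in> augmentation_ideal X \<Longrightarrow> x * y \<in> augmentation_ideal X"
  unfolding aug_iff using keys_mult[of x y] by (fastforce simp: fc_mult free_monoid_add_eq_0)

lemma aug_mult_right: "x \<in> augmentation_ideal X \<Longrightarrow> y \<in> polys X \<Longrightarrow> x * y \<in> augmentation_ideal X"
  unfolding aug_iff using keys_mult[of x y] by (fastforce simp: fc_mult free_monoid_add_eq_0)

lemma aug_sum: "(\<And>i. i \<in> A \<Longrightarrow> f i \<in> augmentation_ideal X) \<Longrightarrow> sum f A \<in> augmentation_ideal X"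
  by (induction A rule: infinite_finite_induct) (auto simp: aug_zero aug_add)

text \<open>
  Elements of an algebra that satisfy the defining relations; by the universal property this is
  the same as a homomorphism from the Leavitt path algebra, which is \<open>val\<close> below on
  representatives.
\<close>

locale leavitt_family = lpa E K + central_scalars sc
  for E :: "('v, 'e) pre_digraph" and K :: "'k :: field itself" and sc :: "'k \<Rightarrow> 'a :: ring_1" +
  fixes p :: "'v \<Rightarrow> 'a" and s g :: "'e \<Rightarrow> 'a"
  assumes p_p: "v \<in> verts E \<Longrightarrow> w \<in> verts E \<Longrightarrow> p v * p w = (if v = w then p v else 0)"
    and p_s: "e \<in> arcs E \<Longrightarrow> p (tail E e) * s e = s e"
    and s_p: "e \<in> arcs E \<Longrightarrow> s e * p (head E e) = s e"
    and p_g: "e \<in> arcs E \<Longrightarrow> p (head E e) * g e = g e"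
    and g_p: "e \<in> arcs E \<Longrightarrow> g e * p (tail E e) = g e"
    and g_s: "e \<in> arcs E \<Longrightarrow> f \<in> arcs E \<Longrightarrow> g e * s f = (if e = f then p (head E e) else 0)"
    and ck: "regular E v \<Longrightarrow> p v = (\<Sum>e\<in>out_arcs E v. s e * g e)"
begin

definition val :: "('k, ('v, 'e) lpa_gen) free_alg \<Rightarrow> 'a" where
  "val = ev (case_lpa_gen p s g)"

lemma val_simps [simp]:
  "val 0 = 0" "val 1 = 1" "val (x + y) = val x + val y" "val (x - y) = val x - val y"
  "val (- x) = - val x" "val (x * y) = val x * val y" "val (sum f A) = (\<Sum>i\<in>A. val (f i))"
  "val (V v) = p v" "val (Ed e) = s e" "val (Gh e) = g e" "val (single 0 c) = sc c"
  by (simp_all add: val_def ev_add ev_diff ev_uminus ev_mult ev_sum ev_single zero_free_monoid_def)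

text \<open>
  The kernel of \<open>val\<close> is an ideal that contains the relators.
\<close>

lemma val_I: assumes "x \<in> I" shows "val x = 0"
proof -
  let ?N = "{x \<in> C. val x = 0}"
  have "ideal ?N (free_algebra (lpa_gens E))"
  proof (rule idealI)
    show "ring (free_algebra (lpa_gens E) :: ('k, ('k, ('v, 'e) lpa_gen) free_alg) module)"
      by (rule free_algebra_ring)
    then interpret fa: ring "free_algebra (lpa_gens E) :: ('k, ('k, ('v, 'e) lpa_gen) free_alg) module" .
    have minus: "\<ominus>\<^bsub>free_algebra (lpa_gens E)\<^esub> x = - x" if "x \<in> C" for x
      using that by (intro fa.minus_equality) (auto simp: fc_uminus)
    show "subgroup ?N (add_monoid (free_algebra (lpa_gens E)))"
      by (rule fa.add.subgroupI) (use fc_zero in \<open>auto simp: fc_intros minus a_inv_def[symmetric]\<close>)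
  qed (auto simp: fc_intros)
  moreover have "lpa_relators E \<subseteq> ?N"
  proof
    fix x :: "('k, ('v, 'e) lpa_gen) free_alg"
    assume x: "x \<in> lpa_relators E"
    then have "val x = 0"
      by cases (simp_all add: p_p p_s s_p p_g g_p g_s ck[symmetric])
    with x show "x \<in> ?N" using relators_in_C by auto
  qed
  ultimately have "I \<subseteq> ?N"
    unfolding lpa_ideal_def by (intro ring.genideal_minimal free_algebra_ring)
  with assms show ?thesis by auto
qed

lemma val_eqv: "x \<approx> y \<Longrightarrow> val x = val y"
  using val_I[of "x - y"] by (simp add: eqv_def)

text \<open>
  The image of the Leavitt path algebra.
\<close>

definition S :: "'a set" where
  "S = val ` augmentation_ideal (lpa_gens E)"

lemma S_zero: "0 \<in> S"
  unfolding S_def using aug_zero by (metis imageI val_simps(1))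

lemma S_add: "x \<in> S \<Longrightarrow> y \<in> S \<Longrightarrow> x + y \<in> S"
  unfolding S_def by clarify (metis aug_add imageI val_simps(3))

lemma S_diff: "x \<in> S \<Longrightarrow> y \<in> S \<Longrightarrow> x - y \<in> S"
  unfolding S_def by clarify (metis aug_diff imageI val_simps(4))

lemma S_mult: "x \<in> S \<Longrightarrow> y \<in> S \<Longrightarrow> x * y \<in> S"
  unfolding S_def by clarify (metis aug_mult_right aug_C imageI val_simps(6))

lemma S_scale: "x \<in> S \<Longrightarrow> sc c * x \<in> S"
  unfolding S_def by clarify (metis aug_mult_left fc_const imageI val_simps(6,11))

lemma S_sum: "(\<And>i. i \<in> A \<Longrightarrow> f i \<in> S) \<Longrightarrow> sum f A \<in> S"
  by (induction A rule: infinite_finite_induct) (auto intro: S_zero S_add)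

lemma S_p: "v \<in> verts E \<Longrightarrow> p v \<in> S"
  and S_s: "e \<in> arcs E \<Longrightarrow> s e \<in> S"
  and S_g: "e \<in> arcs E \<Longrightarrow> g e \<in> S"
proof -
  have "val (gen x) \<in> S" if "x \<in> lpa_gens E" for x
    unfolding S_def by (intro imageI aug_gen that)
  from this[of "Vertex v"] this[of "Edge e"] this[of "Ghost e"]
  show "v \<in> verts E \<Longrightarrow> p v \<in> S" "e \<in> arcs E \<Longrightarrow> s e \<in> S" "e \<in> arcs E \<Longrightarrow> g e \<in> S"
    by (simp_all add: lpa_gens_def)
qed

text \<open>
  The identity element of \<open>S\<close>, in general different from \<open>1\<close>.
\<close>

definition unit :: 'a where "unit = (\<Sum>v\<in>verts E. p v)"

lemma val_one_V: "val one_V = unit"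
  by (simp add: one_V_def unit_def)

lemma S_unit: assumes "x \<in> S" shows "unit * x = x" "x * unit = x"
  using assms val_eqv[OF one_V_unit(1)] val_eqv[OF one_V_unit(2)]
  by (auto simp: S_def val_one_V)

lemma unit_in_S: "unit \<in> S"
  unfolding unit_def by (intro S_sum S_p)

definition pw :: "'e list \<Rightarrow> 'v \<Rightarrow> 'a" where
  "pw w b = prod_list (map s w) * p b"

lemma val_path [simp]: "val (path w b) = pw w b"
proof -
  have "val (prod_list (map Ed w)) = prod_list (map s w)" by (induction w) auto
  then show ?thesis by (simp add: path_def pw_def)
qed

lemma p_pw: "awalk a w b \<Longrightarrow> v \<in> verts E \<Longrightarrow> p v * pw w b = (if v = a then pw w b else 0)"
  using val_eqv[OF V_path[of a w b v]] by (auto split: if_splits)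

lemma pw_p: "awalk a w b \<Longrightarrow> v \<in> verts E \<Longrightarrow> pw w b * p v = (if b = v then pw w b else 0)"
  using val_eqv[OF path_V[of a w b v]] by (auto split: if_splits)

lemma pw_Nil [simp]: "pw [] b = p b"
  and pw_Cons [simp]: "pw (e # w) b = s e * pw w b"
  by (simp_all add: pw_def mult.assoc)

text \<open>
  It suffices to compare paths with common endpoints, as the vertices separate all others.
\<close>

definition path_independent :: bool where
  "path_independent \<longleftrightarrow> (\<forall>a b W c. finite W \<longrightarrow> W \<subseteq> {w. awalk a w b} \<longrightarrow>
     (\<Sum>w\<in>W. sc (c w) * pw w b) = 0 \<longrightarrow> (\<forall>w\<in>W. c w = 0))"

lemma path_independentD: "path_independent \<Longrightarrow> finite W \<Longrightarrow> (\<And>w. w \<in> W \<Longrightarrow> awalk a w b) \<Longrightarrow>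
     (\<Sum>w\<in>W. sc (c w) * pw w b) = 0 \<Longrightarrow> w \<in> W \<Longrightarrow> c w = 0"
  unfolding path_independent_def by blast

text \<open>
  The coefficients \<open>c\<close> vanish outside \<open>W\<close>, so that two such combinations can be added on the
  union of their supports.
\<close>

lemma paths_normal_form:
  assumes "x \<in> Paths" "a \<in> verts E" "b \<in> verts E"
  shows "\<exists>W c. finite W \<and> (\<forall>w\<in>W. awalk a w b) \<and> (\<forall>w. w \<notin> W \<longrightarrow> c w = 0) \<and>
     V a * x * V b \<approx> (\<Sum>w\<in>W. single 0 (c w) * path w b)"
  using assms(1)
proof (induction rule: path_span.induct)
  case (paths_ideal x)
  then have "V a * x * V b \<approx> 0"
    using assms unfolding eqv_0_iff by (intro I_left I_right V_C)
  then show ?case by (intro exI[of _ "{}"] exI[of _ "\<lambda>_. 0"]) auto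
next
  case (paths_walk a' w b' c)
  have eq: "V a * (single 0 c * path w b') * V b = single 0 c * (V a * path w b' * V b)"
    by (simp only: mult.assoc free_scalars.sc_left_commute[of "V a"])
  have "V a * path w b' * V b \<approx> (if a = a' then path w b' else 0) * V b"
    using assms paths_walk by (intro eqv_right V_path V_C) auto
  also have "\<dots> \<approx> (if a = a' \<and> b' = b then path w b else 0)"
    using path_V[OF paths_walk, of b] assms by (auto intro: eqv_refl fc_zero)
  finally have *: "V a * (single 0 c * path w b') * V b
     \<approx> single 0 c * (if a = a' \<and> b' = b then path w b else 0)"
    unfolding eq by (intro eqv_left fc_const)
  show ?case
  proof (cases "a = a' \<and> b' = b")
    case True
    then show ?thesis using * paths_walk
      by (intro exI[of _ "{w}"] exI[of _ "\<lambda>u. if u = w then c else 0"]) auto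
  next
    case False
    then show ?thesis using * by (intro exI[of _ "{}"] exI[of _ "\<lambda>_. 0"]) auto
  qed
next
  case (paths_add x y)
  then obtain W c U d where W: "finite W" "\<forall>w\<in>W. awalk a w b" "\<forall>w. w \<notin> W \<longrightarrow> c w = 0"
       "V a * x * V b \<approx> (\<Sum>w\<in>W. single 0 (c w) * path w b)"
    and U: "finite U" "\<forall>w\<in>U. awalk a w b" "\<forall>w. w \<notin> U \<longrightarrow> d w = 0"
       "V a * y * V b \<approx> (\<Sum>w\<in>U. single 0 (d w) * path w b)" by blast
  have "(\<Sum>w\<in>W. single 0 (c w) * path w b) + (\<Sum>w\<in>U. single 0 (d w) * path w b)
    = (\<Sum>w\<in>W \<union> U. single 0 (c w) * path w b) + (\<Sum>w\<in>W \<union> U. single 0 (d w) * path w b)"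
    using W U by (intro arg_cong2[where f = "(+)"] sum.mono_neutral_left) auto
  also have "\<dots> = (\<Sum>w\<in>W \<union> U. single 0 (c w + d w) * path w b)"
    by (simp add: single_add distrib_right sum.distrib)
  finally have "V a * (x + y) * V b \<approx> (\<Sum>w\<in>W \<union> U. single 0 (c w + d w) * path w b)"
    using eqv_add[OF W(4) U(4)] by (simp add: distrib_left distrib_right)
  then show ?case using W U by (intro exI[of _ "W \<union> U"] exI[of _ "\<lambda>w. c w + d w"]) auto
qed

lemma path_independent_paths:
  assumes "path_independent" "x \<in> Paths" "val x = 0"
  shows "one_V * x * one_V \<in> I"
proof -
  have "V a * x * V b \<approx> 0" if ab: "a \<in> verts E" "b \<in> verts E" for a b
  proof -
    obtain W c where W: "finite W" "\<forall>w\<in>W. awalk a w b" 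
       "V a * x * V b \<approx> (\<Sum>w\<in>W. single 0 (c w) * path w b)"
      using paths_normal_form[OF assms(2) ab] by blast
    have "(\<Sum>w\<in>W. sc (c w) * pw w b) = 0"
      using val_eqv[OF W(3)] assms(3) by simp
    then have "\<forall>w\<in>W. c w = 0"
      using path_independentD[OF assms(1) W(1)] W(2) by blast
    then show ?thesis using W(3) by simp
  qed
  then have "(\<Sum>a\<in>verts E. \<Sum>b\<in>verts E. V a * x * V b) \<approx> (\<Sum>a\<in>verts E. \<Sum>b\<in>verts E. 0)"
    by (intro eqv_sum) auto
  then show ?thesis
    by (simp add: one_V_def sum_distrib_left sum_distrib_right eqv_0_iff sum.swap[of "\<lambda>a b. V a * x * V b"])
qed

text \<open>
  Induction on the level: if \<open>x\<close> is in the kernel, so are all \<open>x e\<close>, which have lower level; then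
  \<open>x v = \<Sum> (x e) e\<^sup>*\<close> vanishes at every regular vertex.  Elements of a level need not lie in the
  augmentation ideal (the constant \<open>1\<close> has level \<open>1\<close>), so the claim is about \<open>one_V * x * one_V\<close>.
\<close>

lemma path_independent_D:
  assumes "path_independent" "x \<in> D k" "val x = 0"
  shows "one_V * x * one_V \<in> I"
  using assms(2,3)
proof (induction k arbitrary: x)
  case 0
  then show ?case using path_independent_paths assms(1) by simp
next
  case (Suc k)
  have x: "one_V * x \<in> C" using Suc.prems(1) by (intro fc_mult one_V_C D_C)
  have Ed: "one_V * x * Ed e \<approx> 0" if e: "e \<in> arcs E" for e
  proof -
    have "one_V * x * Ed e \<approx> one_V * x * (Ed e * one_V)"
      using e by (intro eqv_left x eqv_sym[OF one_V_gen(2)]) (simp add: lpa_gens_def)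
    also have "one_V * x * (Ed e * one_V) = one_V * (x * Ed e) * one_V" by (simp add: mult.assoc)
    also have "\<dots> \<approx> 0" using Suc e by (simp add: eqv_0_iff)
    finally show ?thesis .
  qed
  have V: "one_V * x * V v \<approx> 0" if v: "v \<in> verts E" for v
  proof (cases "regular E v")
    case True
    have "one_V * x * V v \<approx> one_V * x * (\<Sum>e\<in>out_arcs E v. Ed e * Gh e)"
      using True by (intro eqv_left x CK)
    also have "\<dots> = (\<Sum>e\<in>out_arcs E v. one_V * x * Ed e * Gh e)"
      by (simp add: sum_distrib_left mult.assoc)
    also have "\<dots> \<approx> (\<Sum>e\<in>out_arcs E v. 0 * Gh e)"
      using Ed Gh_C by (intro eqv_sum eqv_right) auto
    finally show ?thesis by simp
  next
    case False
    have "one_V * x * V v \<approx> one_V * x * (V v * one_V)"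
      using v by (intro eqv_left x eqv_sym[OF one_V_gen(2)]) (simp add: lpa_gens_def)
    also have "one_V * x * (V v * one_V) = one_V * (x * V v) * one_V" by (simp add: mult.assoc)
    also have "\<dots> \<approx> 0" using Suc.prems v False assms(1) by (simp add: eqv_0_iff path_independent_paths)
    finally show ?thesis .
  qed
  have "(\<Sum>v\<in>verts E. one_V * x * V v) \<approx> (\<Sum>v\<in>verts E. 0)"
    using V by (intro eqv_sum)
  then show ?case by (simp add: one_V_def sum_distrib_left eqv_0_iff)
qed

text \<open>
  A representation that separates the paths separates the whole Leavitt path algebra.
\<close>

theorem val_faithful:
  assumes "path_independent" "x \<in> augmentation_ideal (lpa_gens E)" "val x = 0"
  shows "x \<in> I"
proof -
  obtain k where "x \<in> D k" using aug_in_D assms by blast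
  then have "one_V * x * one_V \<approx> 0" using path_independent_D assms by (simp add: eqv_0_iff)
  moreover have "one_V * x * one_V \<approx> x * one_V" using one_V_unit assms one_V_C by (intro eqv_right)
  moreover have "x * one_V \<approx> x" using one_V_unit assms by blast
  ultimately have "x \<approx> 0" by (meson eqv_sym eqv_trans)
  then show ?thesis by (simp add: eqv_0_iff)
qed

section \<open>Path polynomials\<close>

definition DS :: "nat \<Rightarrow> 'a set" where "DS k = val ` D k"

lemma S_in_DS: "x \<in> S \<Longrightarrow> \<exists>k. x \<in> DS k"
  unfolding S_def DS_def using aug_in_D by blast

lemma DS_mono: "k \<le> l \<Longrightarrow> x \<in> DS k \<Longrightarrow> x \<in> DS l"
  unfolding DS_def using D_mono by blast

lemma finite_S_in_DS: assumes "finite A" "A \<subseteq> S" shows "\<exists>k. A \<subseteq> DS k"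
  using assms
proof (induction rule: finite_induct)
  case (insert x A)
  then obtain k where "A \<subseteq> DS k" by auto
  moreover obtain l where "x \<in> DS l" using S_in_DS insert by blast
  ultimately have "insert x A \<subseteq> DS (max k l)"
    using DS_mono[of k "max k l"] DS_mono[of l "max k l"] by auto
  then show ?case by blast
qed simp

lemma DS_step: "x \<in> DS (Suc k) \<Longrightarrow> e \<in> arcs E \<Longrightarrow> x * s e \<in> DS k"
  unfolding DS_def by (force simp: image_iff)

lemma DS_sink: "x \<in> DS (Suc k) \<Longrightarrow> v \<in> verts E \<Longrightarrow> \<not> regular E v \<Longrightarrow> x * p v \<in> DS 0"
  unfolding DS_def by (force simp: image_iff)

text \<open>
  The path algebra is handled through the free algebra on the edges: the elements of \<open>P\<close> with
  range \<open>b\<close> are the \<open>ev s q * p b\<close> with \<open>q\<close> a combination of words that are walks to \<open>b\<close>.  The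
  range is recorded in \<open>b\<close> since the empty word does not determine it.
\<close>

definition walk_poly :: "'v \<Rightarrow> ('k, 'e) free_alg \<Rightarrow> bool" where
  "walk_poly b q \<longleftrightarrow> (\<forall>z\<in>keys q. \<exists>a. awalk a (letters z) b)"

lemma DS_0_poly: assumes "x \<in> DS 0" "b \<in> verts E"
  shows "\<exists>q. walk_poly b q \<and> x * p b = ev s q * p b"
proof -
  obtain y where y: "y \<in> Paths" "x = val y" using assms by (auto simp: DS_def)
  from y(1) have "\<exists>q. walk_poly b q \<and> val y * p b = ev s q * p b"
  proof (induction rule: path_span.induct)
    case (paths_ideal x)
    then show ?case by (intro exI[of _ 0]) (simp add: val_I walk_poly_def)
  next
    case (paths_walk a w b' c)
    show ?case
    proof (cases "b' = b")
      case True
      with paths_walk p_p[of b b] assms show ?thesis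
        by (intro exI[of _ "single (Word w) c"])
          (auto simp: walk_poly_def ev_single pw_def mult.assoc)
    next
      case False
      then show ?thesis using paths_walk pw_p[of a w b' b] assms
        by (intro exI[of _ 0]) (auto simp: walk_poly_def mult.assoc)
    qed
  next
    case (paths_add x y)
    then obtain q r where "walk_poly b q" "val x * p b = ev s q * p b"
      "walk_poly b r" "val y * p b = ev s r * p b" by blast
    then show ?case using keys_add[of q r]
      by (intro exI[of _ "q + r"]) (auto simp: walk_poly_def ev_add distrib_right)
  qed
  then show ?thesis by (simp add: y)
qed

text \<open>
  A vertex \<open>p a\<close> on the left selects the terms that start at \<open>a\<close>, so independence of the paths from
  \<open>a\<close> to \<open>b\<close> for each \<open>a\<close> gives independence of all paths to \<open>b\<close>.
\<close>

lemma walk_poly_inj: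
  assumes "path_independent" "walk_poly b q" "ev s q * p b = 0"
  shows "q = 0"
proof (rule ccontr)
  assume "q \<noteq> 0"
  then obtain z where z: "z \<in> keys q" by (metis keys_eq_empty ex_in_conv)
  then obtain a where a: "awalk a (letters z) b" using assms by (auto simp: walk_poly_def)
  then have av: "a \<in> verts E" by auto
  let ?W = "letters ` {z \<in> keys q. awalk a (letters z) b}"
  have inj: "inj_on letters A" for A :: "'e free_monoid set"
    by (auto intro: inj_onI free_monoid.expand)
  have "0 = p a * (ev s q * p b)" using assms by simp
  also have "\<dots> = (\<Sum>z\<in>keys q. sc (lookup q z) * (p a * pw (letters z) b))"
    unfolding ev_def sum_distrib_right sum_distrib_left pw_def
    by (intro sum.cong refl) (simp only: mult.assoc sc_left_commute[of "p a"])
  also have "\<dots> = (\<Sum>z\<in>{z \<in> keys q. awalk a (letters z) b}. sc (lookup q z) * pw (letters z) b)"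
  proof (rule sum.mono_neutral_cong_right)
    show "\<forall>z\<in>keys q - {z \<in> keys q. awalk a (letters z) b}.
       sc (lookup q z) * (p a * pw (letters z) b) = 0"
    proof
      fix z assume "z \<in> keys q - {z \<in> keys q. awalk a (letters z) b}"
      then obtain a' where "awalk a' (letters z) b" "a \<noteq> a'" using assms(2) by (auto simp: walk_poly_def)
      then show "sc (lookup q z) * (p a * pw (letters z) b) = 0"
        using p_pw[of a' "letters z" b a] av by simp
    qed
  qed (auto simp: p_pw av)
  also have "\<dots> = (\<Sum>w\<in>?W. sc (lookup q (Word w)) * pw w b)"
    by (subst sum.reindex[OF inj]) simp
  finally have "(\<Sum>w\<in>?W. sc (lookup q (Word w)) * pw w b) = 0" by simp
  moreover have "finite ?W" by simp
  moreover have "awalk a w b" if "w \<in> ?W" for w using that by blast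
  moreover have "letters z \<in> ?W" using z a by blast
  ultimately have "lookup q (Word (letters z)) = 0"
    by (intro path_independentD[OF assms(1), where c = "\<lambda>w. lookup q (Word w)"])
  then have "lookup q z = 0" by simp
  with z show False by (simp add: in_keys_iff)
qed

end

section \<open>Linear endomorphisms of a function space\<close>

typedef (overloaded) ('x, 'k) lin_endo =
  "{f :: ('x \<Rightarrow> 'k :: field) \<Rightarrow> 'x \<Rightarrow> 'k.
     (\<forall>u v. f (\<lambda>x. u x + v x) = (\<lambda>x. f u x + f v x)) \<and> (\<forall>c u. f (\<lambda>x. c * u x) = (\<lambda>x. c * f u x))}"
  morphisms endo_apply Abs_lin_endo
  by (rule exI[of _ "\<lambda>u. u"]) simp

setup_lifting type_definition_lin_endo

instantiation lin_endo :: (type, field) ring_1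
begin

lift_definition zero_lin_endo :: "('a, 'b) lin_endo" is "\<lambda>u x. 0" by simp
lift_definition one_lin_endo :: "('a, 'b) lin_endo" is "\<lambda>u. u" by simp
lift_definition plus_lin_endo :: "('a, 'b) lin_endo \<Rightarrow> ('a, 'b) lin_endo \<Rightarrow> ('a, 'b) lin_endo"
  is "\<lambda>f g u x. f u x + g u x" by (auto simp: algebra_simps)
lift_definition minus_lin_endo :: "('a, 'b) lin_endo \<Rightarrow> ('a, 'b) lin_endo \<Rightarrow> ('a, 'b) lin_endo"
  is "\<lambda>f g u x. f u x - g u x" by (auto simp: algebra_simps)
lift_definition uminus_lin_endo :: "('a, 'b) lin_endo \<Rightarrow> ('a, 'b) lin_endo"
  is "\<lambda>f u x. - f u x" by (auto simp: algebra_simps)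
lift_definition times_lin_endo :: "('a, 'b) lin_endo \<Rightarrow> ('a, 'b) lin_endo \<Rightarrow> ('a, 'b) lin_endo"
  is "\<lambda>f g u. f (g u)" by auto

instance
proof
  show "(0 :: ('a, 'b) lin_endo) \<noteq> 1"
    by transfer (metis zero_neq_one)
qed (transfer; auto simp: algebra_simps fun_eq_iff)+

end

lift_definition endo_scalar :: "'k :: field \<Rightarrow> ('x, 'k) lin_endo" is "\<lambda>c u x. c * u x"
  by (auto simp: algebra_simps)

interpretation endo: central_scalars "endo_scalar :: 'k :: field \<Rightarrow> ('x, 'k) lin_endo"
  by standard (transfer; auto simp: algebra_simps fun_eq_iff)+

text \<open>
  Composition with a partial map, extended by \<open>0\<close>.  By the following lemma, products become
  compositions in the order in which the operators are written, so relations between such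
  operators reduce to equations between partial maps.
\<close>

lift_definition pullback :: "('x \<Rightarrow> 'x option) \<Rightarrow> ('x, 'k :: field) lin_endo"
  is "\<lambda>\<phi> u x. case \<phi> x of None \<Rightarrow> 0 | Some y \<Rightarrow> u y"
  by (auto split: option.splits simp: fun_eq_iff)

lemma pullback_mult: "pullback \<phi> * pullback \<psi> = pullback (\<lambda>x. Option.bind (\<phi> x) \<psi>)"
  by transfer (auto simp: fun_eq_iff split: option.splits bind_splits)

lemma pullback_empty: "pullback (\<lambda>x. None) = 0"
  by transfer simp

lemma endo_apply_sum: "endo_apply (sum h A) u x = (\<Sum>i\<in>A. endo_apply (h i) u x)"
  by (induction A rule: infinite_finite_induct) (auto simp: zero_lin_endo.rep_eq plus_lin_endo.rep_eq)

lemma lin_endo_eqI: "(\<And>u x. endo_apply f u x = endo_apply h u x) \<Longrightarrow> f = h"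
  by (meson endo_apply_inject ext)

section \<open>Branching representations\<close>

lemma mult_add_div_eq: "i < d \<Longrightarrow> (d * n + i) div d = (n :: nat)"
  by simp

text \<open>
  Let \<open>E\<close> act on functions on pairs \<open>(v, n)\<close> of a vertex and a natural number.  If \<open>d\<close> edges leave
  \<open>v\<close>, then the numbers at \<open>v\<close> are split according to their residues modulo \<open>d\<close>, and the \<open>i\<close>-th
  edge identifies the numbers at its range with the class of \<open>i\<close> by \<open>n \<mapsto> d n + i\<close>.  An integer
  \<open>k\<close> is added to record the degree; without it, a path and its square could act in the same way.
  The vertices in \<open>Z\<close> act as \<open>0\<close>; the conditions on \<open>Z\<close> say that the remaining vertices and edges
  still satisfy the Cuntz--Krieger relations.
\<close>

locale branching = lpa E K for E :: "('v, 'e) pre_digraph" and K :: "'k :: field itself" +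
  fixes Z :: "'v set"
  assumes Z_hereditary: "e \<in> arcs E \<Longrightarrow> tail E e \<in> Z \<Longrightarrow> head E e \<in> Z"
    and Z_saturated: "regular E v \<Longrightarrow> v \<notin> Z \<Longrightarrow> \<exists>e\<in>out_arcs E v. head E e \<notin> Z"
begin

definition live :: "'v \<Rightarrow> 'e set" where
  "live v = {e \<in> out_arcs E v. head E e \<notin> Z}"

abbreviation deg :: "'v \<Rightarrow> nat" where "deg v \<equiv> card (live v)"

definition idx :: "'e \<Rightarrow> nat" where
  "idx e = (SOME h. bij_betw h (live (tail E e)) {0..<deg (tail E e)}) e"

lemma finite_live [simp]: "finite (live v)"
  by (simp add: live_def)

lemma idx_bij: "bij_betw idx (live v) {0..<deg v}"
proof -
  have "bij_betw (SOME h. bij_betw h (live v) {0..<deg v}) (live v) {0..<deg v}"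
    using ex_bij_betw_finite_nat[OF finite_live] by (rule someI_ex)
  moreover have "idx e = (SOME h. bij_betw h (live v) {0..<deg v}) e" if "e \<in> live v" for e
    using that by (auto simp: idx_def live_def)
  ultimately show ?thesis by (subst bij_betw_cong)
qed

lemma idx_less: "e \<in> live v \<Longrightarrow> idx e < deg v"
  using idx_bij[of v] by (auto simp: bij_betw_def)

lemma idx_inj: "e \<in> live v \<Longrightarrow> f \<in> live v \<Longrightarrow> idx e = idx f \<Longrightarrow> e = f"
  using idx_bij[of v] by (auto simp: bij_betw_def inj_on_def)

lemma idx_surj: "i < deg v \<Longrightarrow> \<exists>e\<in>live v. idx e = i"
  using bij_betw_imp_surj_on[OF idx_bij, of v] by (metis atLeastLessThan_iff imageE zero_le)

lemma liveI: "e \<in> arcs E \<Longrightarrow> head E e \<notin> Z \<Longrightarrow> e \<in> live (tail E e)"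
  by (simp add: live_def)

text \<open>
  \<open>edge_map\<close> removes an edge from the front of \<open>(u, n, k)\<close> where this is possible, and \<open>ghost_map\<close>
  is the inverse partial map.  Under \<open>pullback\<close> they give the edge and the ghost edge.
\<close>

fun vertex_map :: "'v \<Rightarrow> 'v \<times> nat \<times> int \<Rightarrow> ('v \<times> nat \<times> int) option" where
  "vertex_map v (u, n, k) = (if u = v \<and> v \<notin> Z then Some (u, n, k) else None)"

fun edge_map :: "'e \<Rightarrow> 'v \<times> nat \<times> int \<Rightarrow> ('v \<times> nat \<times> int) option" where
  "edge_map e (u, n, k) =
     (if u = tail E e \<and> head E e \<notin> Z \<and> n mod deg u = idx e then Some (head E e, n div deg u, k - 1) else None)"

fun ghost_map :: "'e \<Rightarrow> 'v \<times> nat \<times> int \<Rightarrow> ('v \<times> nat \<times> int) option" where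
  "ghost_map e (u, n, k) =
     (if u = head E e \<and> head E e \<notin> Z then Some (tail E e, deg (tail E e) * n + idx e, k + 1) else None)"

definition bp :: "'v \<Rightarrow> ('v \<times> nat \<times> int, 'k) lin_endo" where "bp v = pullback (vertex_map v)"
definition bs :: "'e \<Rightarrow> ('v \<times> nat \<times> int, 'k) lin_endo" where "bs e = pullback (edge_map e)"
definition bg :: "'e \<Rightarrow> ('v \<times> nat \<times> int, 'k) lin_endo" where "bg e = pullback (ghost_map e)"

lemma pullback_cong: "(\<And>u n k. \<phi> (u, n, k) = \<psi> (u, n, k)) \<Longrightarrow> pullback \<phi> = pullback \<psi>"
  by (rule arg_cong[of _ _ pullback]) auto

text \<open>
  Every point over \<open>v\<close> has exactly one residue, hence lies in the part of exactly one edge.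
\<close>

lemma branching_ck:
  assumes "regular E v"
  shows "bp v = (\<Sum>e\<in>out_arcs E v. bs e * bg e)"
proof (rule lin_endo_eqI)
  fix u :: "'v \<times> nat \<times> int \<Rightarrow> 'k" and x :: "'v \<times> nat \<times> int"
  obtain w n k where x: "x = (w, n, k)" by (cases x)
  have val: "endo_apply (bs e * bg e) u x = (if w = v \<and> head E e \<notin> Z \<and> n mod deg v = idx e then u x else 0)"
    if "e \<in> out_arcs E v" for e
  proof -
    have "deg v * (n div deg v) + idx e = n" if "n mod deg v = idx e"
      using that by (metis mult_div_mod_eq)
    then show ?thesis using that
      by (auto simp: bs_def bg_def pullback_mult pullback.rep_eq x live_def[symmetric])
  qed
  show "endo_apply (bp v) u x = endo_apply (\<Sum>e\<in>out_arcs E v. bs e * bg e) u x"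
  proof (cases "w = v \<and> v \<notin> Z")
    case True
    then have "live v \<noteq> {}" using Z_saturated[OF assms] by (auto simp: live_def)
    then have "n mod deg v < deg v" by (simp add: card_gt_0_iff)
    then obtain f where f: "f \<in> live v" "idx f = n mod deg v" using idx_surj by blast
    have "(\<Sum>e\<in>out_arcs E v. endo_apply (bs e * bg e) u x) = (\<Sum>e\<in>out_arcs E v. if e = f then u x else 0)"
      using True f idx_inj by (intro sum.cong) (auto simp: val live_def)
    also have "\<dots> = u x" using f by (simp add: live_def)
    finally show ?thesis using True by (simp add: endo_apply_sum bp_def pullback.rep_eq x)
  next
    case False
    have "(\<Sum>e\<in>out_arcs E v. endo_apply (bs e * bg e) u x) = 0"
      using False Z_hereditary by (intro sum.neutral) (auto simp: val)
    then show ?thesis using False by (auto simp: endo_apply_sum bp_def pullback.rep_eq x)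
  qed
qed

sublocale leavitt_family E K endo_scalar bp bs bg
proof (unfold_locales, goal_cases)
  case (1 v w)
  then show ?case by (auto simp: bp_def pullback_mult simp flip: pullback_empty intro!: pullback_cong)
next
  case (2 e)
  then show ?case using Z_hereditary by (auto simp: bp_def bs_def pullback_mult intro!: pullback_cong)
next
  case (3 e)
  then show ?case by (auto simp: bp_def bs_def pullback_mult intro!: pullback_cong)
next
  case (4 e)
  then show ?case by (auto simp: bp_def bg_def pullback_mult intro!: pullback_cong)
next
  case (5 e)
  then show ?case using Z_hereditary by (auto simp: bp_def bg_def pullback_mult intro!: pullback_cong)
next
  case (6 e f)
  have "edge_map f (tail E e, deg (tail E e) * n + idx e, k + 1) =
     (if e = f then Some (head E e, n, k) else None)" if "head E e \<notin> Z" for n k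
  proof -
    have e: "e \<in> live (tail E e)" using 6 that by (intro liveI)
    then show ?thesis using 6 that idx_less[OF e] idx_inj[OF e, of f] liveI[of f]
      by (auto simp: mult_add_div_eq)
  qed
  then show ?case
    by (auto simp: bs_def bp_def bg_def pullback_mult simp flip: pullback_empty intro!: pullback_cong)
next
  case (7 v)
  then show ?case by (rule branching_ck)
qed

lemma bp_nonzero: assumes "v \<notin> Z" shows "bp v \<noteq> 0"
proof
  assume "bp v = 0"
  from arg_cong[OF this, of "\<lambda>h. endo_apply h (\<lambda>_. 1) (v, 0, 0)"]
  show False using assms by (simp add: bp_def pullback.rep_eq zero_lin_endo.rep_eq)
qed

lemma bp_zero: assumes "v \<in> Z" shows "bp v = 0"
  unfolding bp_def using assms by (simp flip: pullback_empty) (rule pullback_cong, simp)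

fun walk_map :: "'e list \<Rightarrow> 'v \<Rightarrow> 'v \<times> nat \<times> int \<Rightarrow> ('v \<times> nat \<times> int) option" where
  "walk_map [] b x = vertex_map b x"
| "walk_map (e # w) b x = Option.bind (edge_map e x) (walk_map w b)"

lemma pw_pullback: "pw w b = pullback (walk_map w b)"
proof (induction w)
  case Nil
  have "walk_map [] b = vertex_map b" by (rule ext) simp
  then show ?case by (simp only: pw_Nil) (simp only: bp_def)
next
  case (Cons e w)
  have "walk_map (e # w) b = (\<lambda>x. Option.bind (edge_map e x) (walk_map w b))" by (rule ext) simp
  moreover have "pw (e # w) b = bs e * pullback (walk_map w b)" by (simp only: pw_Cons Cons)
  moreover have "bs e * pullback (walk_map w b) = pullback (\<lambda>x. Option.bind (edge_map e x) (walk_map w b))"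
    by (simp only: bs_def pullback_mult)
  ultimately show ?case by simp
qed

lemma walk_map_degree: "walk_map w b (u, n, k) = Some (u', n', k') \<Longrightarrow> k = k' + int (length w)"
  by (induction w arbitrary: u n k) (fastforce split: if_splits)+

text \<open>
  The successive residues of \<open>n\<close> determine the edges of the walk.
\<close>

lemma walk_map_inj:
  assumes "length w = length w'" "set w \<subseteq> arcs E" "set w' \<subseteq> arcs E"
    "walk_map w b x = Some y" "walk_map w' b x = Some y"
  shows "w = w'"
  using assms
proof (induction w w' arbitrary: x rule: list_induct2)
  case (Cons e w f w')
  obtain u n k where x: "x = (u, n, k)" by (cases x)
  have "e = f" using Cons.prems idx_inj[of e u f] liveI[of e] liveI[of f]
    by (auto simp: x split: if_splits)
  with Cons show ?case by (auto simp: x split: if_splits)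
qed simp

lemma walk_map_exists:
  assumes "awalk a w b" "Z = {}"
  shows "\<exists>n k. walk_map w b (a, n, k) = Some (b, 0, 0)"
proof -
  have noZ: "v \<notin> Z" for v using assms(2) by simp
  from assms(1) show ?thesis
  proof (induction w arbitrary: a)
    case Nil
    then show ?case using noZ by (intro exI[of _ 0]) (simp add: awalk_Nil_iff)
  next
    case (Cons e w)
    then have e: "e \<in> arcs E" "tail E e = a" "awalk (head E e) w b" by (auto simp: awalk_Cons_iff)
    then obtain n k where "walk_map w b (head E e, n, k) = Some (b, 0, 0)" using Cons by blast
    moreover have "idx e < deg a" using idx_less[OF liveI[OF e(1) noZ]] e by simp
    ultimately show ?case using e noZ
      by (intro exI[of _ "deg a * n + idx e"] exI[of _ "k + 1"]) (simp add: mult_add_div_eq)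
  qed
qed

text \<open>
  For a given path \<open>w\<close> choose a point that \<open>w\<close> maps to \<open>(b, 0, 0)\<close>.  By \<open>walk_map_degree\<close> any other
  path with the same value there has the same length, so it equals \<open>w\<close>.  Evaluating the
  combination at this point on the indicator function of \<open>(b, 0, 0)\<close> isolates the coefficient.
\<close>

lemma branching_independent: assumes "Z = {}" shows "path_independent"
  unfolding path_independent_def
proof (intro allI impI ballI)
  fix a b W and c :: "'e list \<Rightarrow> 'k" and w
  assume W: "finite W" "W \<subseteq> {w. awalk a w b}" and sum0: "(\<Sum>w\<in>W. endo_scalar (c w) * pw w b) = 0"
    and w: "w \<in> W"
  obtain n k where nk: "walk_map w b (a, n, k) = Some (b, 0, 0)"
    using walk_map_exists[of a w b] W w assms by blast
  define u :: "'v \<times> nat \<times> int \<Rightarrow> 'k" where "u = (\<lambda>y. if y = (b, 0, 0) then 1 else 0)"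
  have other: "walk_map w' b (a, n, k) \<noteq> Some (b, 0, 0)" if w': "w' \<in> W" "w' \<noteq> w" for w'
  proof
    assume eq: "walk_map w' b (a, n, k) = Some (b, 0, 0)"
    have "length w' = length w" using walk_map_degree[OF eq] walk_map_degree[OF nk] by simp
    moreover have "set w' \<subseteq> arcs E" "set w \<subseteq> arcs E" using W w w' by (auto simp: awalk_def)
    ultimately show False using walk_map_inj eq nk w' by blast
  qed
  have "0 = endo_apply (\<Sum>w\<in>W. endo_scalar (c w) * pw w b) u (a, n, k)"
    using sum0 by (simp add: zero_lin_endo.rep_eq)
  also have "\<dots> = (\<Sum>w'\<in>W. if w' = w then c w else 0)"
    unfolding endo_apply_sum
    by (intro sum.cong refl)
      (auto simp: times_lin_endo.rep_eq endo_scalar.rep_eq pw_pullback pullback.rep_eq nk u_def other split: option.splits)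
  also have "\<dots> = c w" using W w by simp
  finally show "c w = 0" by simp
qed

end

section \<open>Leading words\<close>

lemma ex_strict_well_order: "\<exists>r :: 'e rel. wf r \<and> trans r \<and> total r \<and> irrefl r"
proof -
  obtain r :: "'e rel" where r: "Well_order r" "Field r = UNIV" by (rule exE[OF well_ordering[where 'a = 'e]]) (elim conjE)
  have lin: "Linear_order r" and "wf (r - Id)" using r(1) by (auto simp: well_order_on_def)
  moreover have "trans (r - Id)"
    using lin unfolding linear_order_on_def partial_order_on_def preorder_on_def
    by (intro trans_diff_Id) blast+
  moreover have "total (r - Id)"
    using lin r(2) unfolding linear_order_on_def by simp
  moreover have "irrefl (r - Id)" by (simp add: irrefl_def)
  ultimately show ?thesis by blast
qed

definition letter_less :: "'e rel" where
  "letter_less = (SOME r. wf r \<and> trans r \<and> total r \<and> irrefl r)"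

lemma letter_less: "wf (letter_less :: 'e rel)" "trans (letter_less :: 'e rel)"
    "total (letter_less :: 'e rel)" "irrefl (letter_less :: 'e rel)"
  using someI_ex[OF ex_strict_well_order[where 'e = 'e]] by (simp_all add: letter_less_def)

text \<open>
  Words are compared by length first and then lexicographically, which is compatible with
  concatenation on both sides and well-founded.
\<close>

definition word_less :: "'e list rel" where "word_less = lenlex letter_less"

lemma wf_word_less: "wf word_less"
  and trans_word_less: "trans word_less"
  and irrefl_word_less: "(w, w) \<notin> word_less"
  unfolding word_less_def
  using letter_less lenlex_irreflexive[of letter_less w] by (auto intro: lenlex_transI simp: irrefl_def)

lemma word_less_total: "u = w \<or> (u, w) \<in> word_less \<or> (w, u) \<in> word_less"
  using total_lenlex[OF letter_less(3)] unfolding word_less_def total_on_def by auto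

definition word_le :: "'e list \<Rightarrow> 'e list \<Rightarrow> bool" where
  "word_le u w \<longleftrightarrow> u = w \<or> (u, w) \<in> word_less"

text \<open>
  The second part, applied to two leading words, says that their product arises in only one way
  from terms of the two factors.
\<close>

lemma word_le_append:
  assumes "word_le x w" "word_le y u"
  shows "word_le (x @ y) (w @ u)" "x @ y = w @ u \<Longrightarrow> x = w \<and> y = u"
proof -
  have len: "length x \<le> length w" "length y \<le> length u"
    using assms by (auto simp: word_le_def word_less_def dest: lenlex_length)
  show "word_le (x @ y) (w @ u)"
  proof (cases "length x < length w \<or> length y < length u")
    case True
    then have "length (x @ y) < length (w @ u)" using len by auto
    then show ?thesis by (simp add: word_le_def word_less_def lenlex_conv)
  next
    case False
    then have len': "length x = length w" "length y = length u" using len by auto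
    have "(x @ y, w @ u) \<in> word_less" if "(x, w) \<in> word_less"
      using that len' lenlex_append1 by (auto simp: word_less_def)
    moreover have "(w @ y, w @ u) \<in> word_less" if "(y, u) \<in> word_less"
      using that by (subst (asm) lenlex_append2[OF letter_less(4), of w, folded word_less_def, symmetric]) assumption
    ultimately show ?thesis using assms by (auto simp: word_le_def)
  qed
  show "x = w \<and> y = u" if "x @ y = w @ u"
  proof -
    have "length x + length y = length w + length u" using that by (metis length_append)
    then show ?thesis using len that by simp
  qed
qed

lemma word_le_antisym: "word_le x w \<Longrightarrow> word_le w x \<Longrightarrow> x = w"
  unfolding word_le_def using trans_word_less irrefl_word_less by (metis transD)

lemma finite_max_word:
  assumes "finite A" "A \<noteq> {}" shows "\<exists>m\<in>A. \<forall>x\<in>A. word_le (f x) (f m)"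
  using assms
proof (induction rule: finite_ne_induct)
  case (insert x A)
  then obtain m where m: "m \<in> A" "\<forall>x\<in>A. word_le (f x) (f m)" by blast
  have tr: "word_le a b \<Longrightarrow> word_le b c \<Longrightarrow> word_le a c" for a b c :: "'b list"
    unfolding word_le_def using trans_word_less by (metis transD)
  show ?case
  proof (cases "word_le (f x) (f m)")
    case True
    then show ?thesis using m by auto
  next
    case False
    then have "word_le (f m) (f x)" using word_less_total by (auto simp: word_le_def)
    then show ?thesis using m tr by (intro bexI[of _ x]) (auto simp: word_le_def[of "f x" "f x"])
  qed
qed (simp add: word_le_def)

definition is_lead :: "('k :: field, 'e) free_alg \<Rightarrow> 'e list \<Rightarrow> bool" where
  "is_lead q w \<longleftrightarrow> Word w \<in> keys q \<and> (\<forall>z\<in>keys q. word_le (letters z) w)"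

lemma is_lead_exists: assumes "q \<noteq> 0" shows "\<exists>w. is_lead q w"
proof -
  obtain m where "m \<in> keys q" "\<forall>z\<in>keys q. word_le (letters z) (letters m)"
    using finite_max_word[of "keys q" letters] assms by (auto simp: keys_eq_empty)
  then show ?thesis by (intro exI[of _ "letters m"]) (simp add: is_lead_def)
qed

lemma is_lead_single: "c \<noteq> 0 \<Longrightarrow> is_lead (single (Word w) c) w"
  by (simp add: is_lead_def word_le_def)

lemma keys_mult_obtain:
  assumes "z \<in> keys (q * r)"
  obtains x y where "x \<in> keys q" "y \<in> keys r" "letters z = letters x @ letters y"
  using assms keys_mult[of q r] by (fastforce simp: plus_free_monoid_def)

lemma lookup_lead_mult:
  assumes q: "is_lead q w" and r: "is_lead r u"
  shows "lookup (q * r) (Word (w @ u)) =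
    lookup q (Word w) * lookup r (Word u)"
proof -
  let ?s = "single (Word w) (lookup q (Word w))"
  let ?t = "single (Word u) (lookup r (Word u))"
  have *: "lookup (x * y) (Word (w @ u)) = 0"
    if "keys x \<subseteq> keys q" "keys y \<subseteq> keys r"
      "Word w \<notin> keys x \<or> Word u \<notin> keys y" for x y
  proof (rule ccontr)
    assume "lookup (x * y) (Word (w @ u)) \<noteq> 0"
    then have "Word (w @ u) \<in> keys (x * y)" by (simp add: in_keys_iff)
    then obtain a b where ab: "a \<in> keys x" "b \<in> keys y" "w @ u = letters a @ letters b"
      by (rule keys_mult_obtain) auto
    then have "letters a = w \<and> letters b = u"
      using word_le_append(2)[of "letters a" w "letters b" u] that q r by (auto simp: is_lead_def)
    then show False using ab that(3) by auto
  qed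
  have sub: "keys (q - ?s) \<subseteq> keys q - {Word w}"
    "keys (r - ?t) \<subseteq> keys r - {Word u}"
    by (auto simp: in_keys_iff lookup_minus lookup_single when_def split: if_splits)
  \<comment> \<open>Only the product of the two leading terms contributes to the coefficient in question.\<close>
  have "q * r = ?s * ?t + ?s * (r - ?t) + (q - ?s) * r" by (simp add: algebra_simps)
  moreover have "lookup (?s * (r - ?t)) (Word (w @ u)) = 0"
    by (rule *) (use sub q in \<open>auto simp: is_lead_def split: if_splits\<close>)
  moreover have "lookup ((q - ?s) * r) (Word (w @ u)) = 0"
    by (rule *) (use sub in auto)
  ultimately show ?thesis by (simp add: lookup_add mult_single plus_free_monoid_def)
qed

lemma is_lead_mult: assumes "is_lead q w" "is_lead r u" shows "is_lead (q * r) (w @ u)"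
  unfolding is_lead_def
proof (intro conjI ballI)
  show "Word (w @ u) \<in> keys (q * r)"
    using assms lookup_lead_mult[OF assms] by (auto simp: is_lead_def in_keys_iff)
  fix z assume "z \<in> keys (q * r)"
  then show "word_le (letters z) (w @ u)"
    using assms by (elim keys_mult_obtain) (auto simp: is_lead_def intro: word_le_append(1))
qed

section \<open>Decomposing an idempotent\<close>

context leavitt_family
begin

text \<open>
  The matrices \<open>a\<close> and \<open>l\<close> are mutually inverse isomorphisms between the right ideal \<open>\<epsilon> S\<close> and
  the direct sum of the right ideals \<open>p (\<nu> i) S\<close>.
\<close>

definition frame :: "'a \<Rightarrow> 'i set \<Rightarrow> ('i \<Rightarrow> 'v) \<Rightarrow> ('i \<Rightarrow> 'a) \<Rightarrow> ('i \<Rightarrow> 'a) \<Rightarrow> bool" where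
  "frame \<epsilon> J \<nu> a l \<longleftrightarrow> finite J \<and>
     (\<forall>i\<in>J. \<nu> i \<in> verts E \<and> a i \<in> S \<and> l i \<in> S \<and> a i * p (\<nu> i) = a i \<and> p (\<nu> i) * l i = l i) \<and>
     (\<forall>i\<in>J. \<forall>j\<in>J. l i * a j = (if i = j then p (\<nu> i) else 0)) \<and>
     \<epsilon> = (\<Sum>i\<in>J. a i * l i)"

lemma pw_S: assumes "awalk a w b" shows "pw w b \<in> S"
  using assms
proof (induction w arbitrary: a)
  case Nil
  then show ?case by (auto simp: awalk_Nil_iff intro: S_p)
next
  case (Cons e w)
  then show ?case by (auto simp: awalk_Cons_iff intro: S_mult S_s)
qed

lemma walk_poly_S: assumes "walk_poly b q" shows "ev s q * p b \<in> S"
proof -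
  have "ev s q * p b = (\<Sum>z\<in>keys q. sc (lookup q z) * pw (letters z) b)"
    unfolding ev_def sum_distrib_right pw_def by (simp add: mult.assoc)
  moreover have "pw (letters z) b \<in> S" if "z \<in> keys q" for z
    using assms that pw_S by (auto simp: walk_poly_def)
  ultimately show ?thesis by (auto intro!: S_sum S_scale)
qed

definition walk_poly_from :: "'v \<Rightarrow> 'v \<Rightarrow> ('k, 'e) free_alg \<Rightarrow> bool" where
  "walk_poly_from a b q \<longleftrightarrow> (\<forall>z\<in>keys q. awalk a (letters z) b)"

lemma walk_poly_zero: "walk_poly b 0" by (simp add: walk_poly_def)

lemma walk_poly_diff: "walk_poly b q \<Longrightarrow> walk_poly b r \<Longrightarrow> walk_poly b (q - r)"
  using keys_diff[of q r] by (auto simp: walk_poly_def)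

lemma walk_poly_add: "walk_poly b q \<Longrightarrow> walk_poly b r \<Longrightarrow> walk_poly b (q + r)"
  using keys_add[of q r] by (auto simp: walk_poly_def)

lemma walk_poly_sum: "(\<And>i. i \<in> A \<Longrightarrow> walk_poly b (f i)) \<Longrightarrow> walk_poly b (sum f A)"
  by (induction A rule: infinite_finite_induct) (auto simp: walk_poly_zero walk_poly_add)

lemma walk_poly_mult: assumes "walk_poly c q" "walk_poly_from c b r" shows "walk_poly b (q * r)"
  unfolding walk_poly_def
proof
  fix z assume "z \<in> keys (q * r)"
  then obtain x y where xy: "x \<in> keys q" "y \<in> keys r" "letters z = letters x @ letters y"
    by (rule keys_mult_obtain)
  then obtain a where "awalk a (letters x) c" using assms by (auto simp: walk_poly_def)
  then show "\<exists>a. awalk a (letters z) b" using xy assms by (auto simp: walk_poly_from_def)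
qed

text \<open>
  Multiplication by \<open>p v\<close> on the left discards the words that do not start at \<open>v\<close>.
\<close>

lemma walk_poly_restrict:
  assumes "walk_poly b q" "v \<in> verts E"
  shows "\<exists>r. walk_poly_from v b r \<and> p v * (ev s q * p b) = ev s r * p b"
proof (induction q rule: poly_mapping_sum_induct)
  case zero
  then show ?case by (intro exI[of _ 0]) (simp add: walk_poly_from_def)
next
  case (single z c)
  then obtain a where a: "awalk a (letters z) b" using assms by (auto simp: walk_poly_def)
  have *: "p v * (ev s (single z c) * p b) = sc c * (p v * pw (letters z) b)"
    by (simp add: ev_single pw_def mult.assoc sc_left_commute[of "p v"])
  show ?case
  proof (cases "v = a")
    case True
    then show ?thesis using a * p_pw[OF a assms(2)]
      by (intro exI[of _ "single z c"])
        (simp add: walk_poly_from_def ev_single pw_def mult.assoc)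
  next
    case False
    then show ?thesis using * p_pw[OF a assms(2)] by (intro exI[of _ 0]) (simp add: walk_poly_from_def)
  qed
next
  case (add q r)
  then obtain q' r' where "walk_poly_from v b q'" "p v * (ev s q * p b) = ev s q' * p b"
     "walk_poly_from v b r'" "p v * (ev s r * p b) = ev s r' * p b" by blast
  then show ?case using keys_add[of q' r']
    by (intro exI[of _ "q' + r'"]) (auto simp: walk_poly_from_def ev_add distrib_left distrib_right)
qed

lemma walk_poly_from_p:
  assumes "walk_poly_from v b q" "v \<in> verts E"
  shows "p v * (ev s q * p b) = ev s q * p b"
proof -
  have "ev s q * p b = (\<Sum>z\<in>keys q. sc (lookup q z) * pw (letters z) b)"
    unfolding ev_def sum_distrib_right pw_def by (simp add: mult.assoc)
  moreover have "p v * (\<Sum>z\<in>keys q. sc (lookup q z) * pw (letters z) b)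
      = (\<Sum>z\<in>keys q. sc (lookup q z) * pw (letters z) b)"
    unfolding sum_distrib_left
  proof (rule sum.cong)
    fix z assume "z \<in> keys q"
    then have "p v * pw (letters z) b = pw (letters z) b"
      using assms p_pw by (auto simp: walk_poly_from_def)
    then show "p v * (sc (lookup q z) * pw (letters z) b) = sc (lookup q z) * pw (letters z) b"
      by (metis sc_left_commute)
  qed simp
  ultimately show ?thesis by simp
qed

end

locale idempotent_in_family = leavitt_family E K sc p s g
  for E :: "('v, 'e) pre_digraph" and K :: "'k :: field itself" and sc :: "'k \<Rightarrow> 'a :: ring_1"
    and p s g +
  fixes \<epsilon> :: 'a
  assumes independent: path_independent
    and \<epsilon>_S: "\<epsilon> \<in> S" and \<epsilon>_idem: "\<epsilon> * \<epsilon> = \<epsilon>"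
begin

text \<open>
  Together, the \<open>M b\<close> represent the right ideal of the elements of the path algebra that \<open>\<epsilon>\<close>
  fixes.
\<close>

definition M :: "'v \<Rightarrow> ('k, 'e) free_alg set" where
  "M b = {q. walk_poly b q \<and> \<epsilon> * (ev s q * p b) = ev s q * p b}"

definition leads :: "('e list \<times> 'v) set" where
  "leads = {(w, b). b \<in> verts E \<and> (\<exists>q\<in>M b. is_lead q w)}"

text \<open>
  The leading paths without a proper prefix that is again a leading path.  A path is given by
  its word and its range, and a prefix must end where the remaining walk starts.
\<close>

definition base :: "('e list \<times> 'v) set" where
  "base = {(w, b) \<in> leads. \<forall>w' b' u. (w', b') \<in> leads \<longrightarrow> w = w' @ u \<longrightarrow> awalk b' u b \<longrightarrow> u = []}"

definition base_poly :: "'e list \<times> 'v \<Rightarrow> ('k, 'e) free_alg" where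
  "base_poly \<beta> = (SOME q. q \<in> M (snd \<beta>) \<and> is_lead q (fst \<beta>))"

text \<open>
  Generators of \<open>\<epsilon> S\<close>, free up to the vertex that each has as its range.
\<close>

definition base_gen :: "'e list \<times> 'v \<Rightarrow> 'a" where
  "base_gen \<beta> = ev s (base_poly \<beta>) * p (snd \<beta>)"

lemma base_leads: "\<beta> \<in> base \<Longrightarrow> \<beta> \<in> leads"
  by (auto simp: base_def)

lemma base_verts: "\<beta> \<in> base \<Longrightarrow> snd \<beta> \<in> verts E"
  by (auto simp: base_def leads_def)

lemma base_poly: assumes "\<beta> \<in> base" shows "base_poly \<beta> \<in> M (snd \<beta>)" "is_lead (base_poly \<beta>) (fst \<beta>)"
proof -
  have "\<exists>q. q \<in> M (snd \<beta>) \<and> is_lead q (fst \<beta>)"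
    using base_leads[OF assms] by (auto simp: leads_def)
  from someI_ex[OF this] show "base_poly \<beta> \<in> M (snd \<beta>)" "is_lead (base_poly \<beta>) (fst \<beta>)"
    unfolding base_poly_def by auto
qed

lemma lead_has_base_prefix:
  assumes "(w, b) \<in> leads"
  shows "\<exists>w' b' u. (w', b') \<in> base \<and> w = w' @ u \<and> awalk b' u b"
  using assms
proof (induction "length w" arbitrary: w b rule: less_induct)
  case less
  show ?case
  proof (cases "(w, b) \<in> base")
    case True
    then show ?thesis using less.prems
      by (intro exI[of _ w] exI[of _ b] exI[of _ "[]"]) (auto simp: awalk_Nil_iff leads_def)
  next
    case False
    then obtain w' b' u where *: "(w', b') \<in> leads" "w = w' @ u" "awalk b' u b" "u \<noteq> []"
      using less.prems by (auto simp: base_def)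
    then obtain w'' b'' u' where **: "(w'', b'') \<in> base" "w' = w'' @ u'" "awalk b'' u' b'"
      using less.hyps[of w' b'] by auto
    then show ?thesis using *
      by (intro exI[of _ w''] exI[of _ b''] exI[of _ "u' @ u"]) auto
  qed
qed

lemma awalk_start_unique:
  assumes "awalk a u b" "awalk a' u b" shows "a = a'"
  using assms by (cases u) (auto simp: awalk_Nil_iff awalk_Cons_iff)

text \<open>
  Of two prefixes of the same path the shorter is a prefix of the longer, so they coincide if
  both are minimal.  The walks \<open>u\<close> and \<open>u'\<close> to a common vertex ensure that prefixes are meant as
  paths: the remaining words agree, hence so do the vertices where they start.
\<close>

lemma base_prefix_free_aux:
  assumes "(w, v) \<in> base" "(w', v') \<in> base" "w @ u = w' @ u'" "awalk v u b" "awalk v' u' b" "length w \<le> length w'"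
  shows "(w, v) = (w', v')"
proof -
  obtain z where z: "w' = w @ z" "u = z @ u'"
    using assms(3,6) by (auto simp: append_eq_append_conv2)
  then obtain c where c: "awalk v z c" "awalk c u' b" using assms(4) by (auto simp: awalk_append_iff)
  then have "c = v'" using awalk_start_unique assms(5) by blast
  then have vz: "awalk v z v'" using c by simp
  have "z = []" using assms(2) z vz base_leads[OF assms(1)] by (auto simp: base_def)
  then show ?thesis using z vz by (auto simp: awalk_Nil_iff)
qed

lemma base_prefix_free:
  assumes "(w, v) \<in> base" "(w', v') \<in> base" "w @ u = w' @ u'" "awalk v u b" "awalk v' u' b"
  shows "(w, v) = (w', v')"
  using base_prefix_free_aux[of w v w' v' u u' b] base_prefix_free_aux[of w' v' w v u' u b] assms
  by (cases "length w \<le> length w'") auto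

lemma M_mult_walk:
  assumes "q \<in> M c" "awalk c u b"
  shows "q * single (Word u) d \<in> M b"
    "ev s (q * single (Word u) d) * p b = (ev s q * p c) * (sc d * pw u b)"
proof -
  have c: "c \<in> verts E" using assms by auto
  have "(ev s q * p c) * (sc d * pw u b) = ev s q * (sc d * (p c * pw u b))"
    by (simp only: mult.assoc sc_left_commute[of "p c"])
  also have "p c * pw u b = pw u b" using assms c p_pw by auto
  finally show *: "ev s (q * single (Word u) d) * p b = (ev s q * p c) * (sc d * pw u b)"
    by (simp add: ev_mult ev_single pw_def mult.assoc)
  have "walk_poly b (q * single (Word u) d)"
    using assms by (intro walk_poly_mult[of c]) (auto simp: M_def walk_poly_from_def)
  then show "q * single (Word u) d \<in> M b"
    using assms unfolding M_def mem_Collect_eq * by (simp flip: mult.assoc)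
qed

lemma M_diff: "q \<in> M b \<Longrightarrow> r \<in> M b \<Longrightarrow> q - r \<in> M b"
  by (auto simp: M_def walk_poly_diff ev_diff left_diff_distrib right_diff_distrib)

text \<open>
  The right ideal of \<open>S\<close> that the elements \<open>base_gen\<close> generate.  The coefficient functions vanish
  outside \<open>J\<close>, so that two of them can be added.
\<close>

definition N :: "'a set" where
  "N = {x. \<exists>J l. finite J \<and> J \<subseteq> base \<and> (\<forall>\<beta>. l \<beta> \<in> S \<and> p (snd \<beta>) * l \<beta> = l \<beta>) \<and>
     (\<forall>\<beta>. \<beta> \<notin> J \<longrightarrow> l \<beta> = 0) \<and> x = (\<Sum>\<beta>\<in>J. base_gen \<beta> * l \<beta>)}"

lemma N_zero: "0 \<in> N"
  unfolding N_def by (auto intro!: exI[of _ "{}"] exI[of _ "\<lambda>_. 0"] S_zero)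

lemma N_add: assumes "x \<in> N" "y \<in> N" shows "x + y \<in> N"
proof -
  obtain J l where J: "finite J" "J \<subseteq> base" "\<And>\<beta>. l \<beta> \<in> S" "\<And>\<beta>. p (snd \<beta>) * l \<beta> = l \<beta>"
     "\<And>\<beta>. \<beta> \<notin> J \<Longrightarrow> l \<beta> = 0" "x = (\<Sum>\<beta>\<in>J. base_gen \<beta> * l \<beta>)"
    using assms(1) unfolding N_def by blast
  obtain J' l' where J': "finite J'" "J' \<subseteq> base" "\<And>\<beta>. l' \<beta> \<in> S" "\<And>\<beta>. p (snd \<beta>) * l' \<beta> = l' \<beta>"
     "\<And>\<beta>. \<beta> \<notin> J' \<Longrightarrow> l' \<beta> = 0" "y = (\<Sum>\<beta>\<in>J'. base_gen \<beta> * l' \<beta>)"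
    using assms(2) unfolding N_def by blast
  have "x = (\<Sum>\<beta>\<in>J \<union> J'. base_gen \<beta> * l \<beta>)" unfolding J(6)
    using J J' by (intro sum.mono_neutral_left) auto
  moreover have "y = (\<Sum>\<beta>\<in>J \<union> J'. base_gen \<beta> * l' \<beta>)" unfolding J'(6)
    using J J' by (intro sum.mono_neutral_left) auto
  ultimately have "x + y = (\<Sum>\<beta>\<in>J \<union> J'. base_gen \<beta> * (l \<beta> + l' \<beta>))"
    by (simp add: distrib_left sum.distrib)
  then show ?thesis unfolding N_def mem_Collect_eq using J J'
    by (intro exI[of _ "J \<union> J'"] exI[of _ "\<lambda>\<beta>. l \<beta> + l' \<beta>"]) (auto simp: S_add distrib_left)
qed

lemma N_sum: "(\<And>i. i \<in> A \<Longrightarrow> f i \<in> N) \<Longrightarrow> sum f A \<in> N"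
  by (induction A rule: infinite_finite_induct) (auto intro: N_zero N_add)

lemma N_right: assumes "x \<in> N" "y \<in> S" shows "x * y \<in> N"
proof -
  obtain J l where J: "finite J" "J \<subseteq> base" "\<And>\<beta>. l \<beta> \<in> S" "\<And>\<beta>. p (snd \<beta>) * l \<beta> = l \<beta>"
     "\<And>\<beta>. \<beta> \<notin> J \<Longrightarrow> l \<beta> = 0" "x = (\<Sum>\<beta>\<in>J. base_gen \<beta> * l \<beta>)"
    using assms(1) unfolding N_def by blast
  then show ?thesis unfolding N_def mem_Collect_eq using assms(2)
    by (intro exI[of _ J] exI[of _ "\<lambda>\<beta>. l \<beta> * y"])
      (auto simp: S_mult sum_distrib_right mult.assoc simp flip: mult.assoc[of "p _"])
qed

lemma N_base_gen: assumes "\<beta> \<in> base" "y \<in> S" "p (snd \<beta>) * y = y" shows "base_gen \<beta> * y \<in> N"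
  unfolding N_def mem_Collect_eq using assms
  by (intro exI[of _ "{\<beta>}"] exI[of _ "\<lambda>\<gamma>. if \<gamma> = \<beta> then y else 0"]) (auto simp: S_zero)

text \<open>
  Division with remainder: subtracting a multiple of the base element whose leading path is a
  prefix of that of \<open>q\<close> lowers the leading word, and the order on words is well-founded.
\<close>

lemma M_in_N: assumes "b \<in> verts E" "q \<in> M b" shows "ev s q * p b \<in> N"
proof (cases "q = 0")
  case True
  then show ?thesis by (simp add: N_zero)
next
  case False
  then obtain w where "is_lead q w" using is_lead_exists by blast
  with assms(2) show ?thesis
  proof (induction w arbitrary: q rule: wf_induct_rule[OF wf_word_less])
    case (1 w)
    have "(w, b) \<in> leads" using 1 assms by (auto simp: leads_def)
    then obtain w' b' u where base: "(w', b') \<in> base" and w: "w = w' @ u" and u: "awalk b' u b"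
      using lead_has_base_prefix by blast
    let ?m = "base_poly (w', b')"
    \<comment> \<open>The scalar \<open>d\<close> makes the leading terms of \<open>q\<close> and \<open>?t\<close> below cancel.\<close>
    define d where "d = lookup q (Word w) / lookup ?m (Word w')"
    have m: "?m \<in> M b'" "is_lead ?m w'" using base_poly[OF base] by auto
    have ql: "lookup q (Word w) \<noteq> 0" "lookup ?m (Word w') \<noteq> 0"
      using 1 m by (auto simp: is_lead_def in_keys_iff)
    then have d: "d \<noteq> 0" by (simp add: d_def)
    let ?t = "?m * single (Word u) d"
    have lt: "is_lead ?t w" unfolding w by (intro is_lead_mult m is_lead_single d)
    have "lookup ?t (Word w) = lookup q (Word w)"
      unfolding w using lookup_lead_mult[OF m(2) is_lead_single[OF d, of u]] ql
      by (simp add: d_def w)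
    then have l0: "lookup (q - ?t) (Word w) = 0" by (simp add: lookup_minus)
    have t: "?t \<in> M b" "ev s ?t * p b = base_gen (w', b') * (sc d * pw u b)"
      using M_mult_walk[OF m(1) u] by (auto simp: base_gen_def)
    have q': "q - ?t \<in> M b" using 1 t by (intro M_diff)
    have "p b' * pw u b = pw u b" using p_pw[OF u, of b'] awalk_hd_in_verts[OF u] by simp
    then have "p b' * (sc d * pw u b) = sc d * pw u b" by (metis sc_left_commute)
    then have tN: "ev s ?t * p b \<in> N"
      unfolding t(2) using base u by (intro N_base_gen S_scale pw_S) auto
    have "ev s (q - ?t) * p b \<in> N"
    proof (cases "q - ?t = 0")
      case True
      then show ?thesis by (simp only: ev_zero mult_zero_left N_zero)
    next
      case False
      then obtain w2 where w2: "is_lead (q - ?t) w2" using is_lead_exists by blast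
      then have "Word w2 \<in> keys q \<union> keys ?t"
        using keys_diff[of q ?t] by (auto simp: is_lead_def)
      then have "word_le w2 w" using 1(3) lt by (auto simp: is_lead_def)
      moreover have "w2 \<noteq> w" using w2 l0 by (auto simp: is_lead_def in_keys_iff)
      ultimately have "(w2, w) \<in> word_less" by (auto simp: word_le_def)
      then show ?thesis using 1(1)[of w2 "q - ?t"] q' w2 by blast
    qed
    from N_add[OF this tN] show ?case by (simp add: ev_diff left_diff_distrib)
  qed
qed

lemma DS_0_in_N:
  assumes "x \<in> DS 0" "\<epsilon> * x = x" "b \<in> verts E" shows "x * p b \<in> N"
proof -
  obtain q where q: "walk_poly b q" "x * p b = ev s q * p b" using DS_0_poly assms by blast
  have "\<epsilon> * (x * p b) = x * p b" using assms(2) by (simp flip: mult.assoc)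
  then have "q \<in> M b" using q by (simp add: M_def)
  then show ?thesis using M_in_N assms q by simp
qed

lemma sum_unit: "x \<in> S \<Longrightarrow> x = (\<Sum>v\<in>verts E. x * p v)"
  using S_unit(2)[of x] by (simp add: unit_def sum_distrib_left)

text \<open>
  Ghost edges are cleared as in \<open>path_independent_D\<close>: with \<open>x\<close>, also \<open>x e\<close> is fixed by \<open>\<epsilon>\<close>, and \<open>x\<close>
  is recovered from the \<open>x e\<close> by multiplication on the right, which does not leave \<open>N\<close>.
\<close>

lemma fixed_in_N: "x \<in> S \<Longrightarrow> x \<in> DS k \<Longrightarrow> \<epsilon> * x = x \<Longrightarrow> x \<in> N"
proof (induction k arbitrary: x)
  case 0
  then show ?case by (subst sum_unit) (auto intro: N_sum DS_0_in_N)
next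
  case (Suc k)
  have "x * p v \<in> N" if v: "v \<in> verts E" for v
  proof (cases "regular E v")
    case True
    have "x * s e * g e \<in> N" if "e \<in> arcs E" for e
      using that Suc by (intro N_right S_g Suc.IH) (auto intro: S_mult S_s DS_step simp flip: mult.assoc)
    then show ?thesis unfolding ck[OF True] sum_distrib_left mult.assoc[symmetric]
      by (intro N_sum) auto
  next
    case False
    then have "x * p v * p v \<in> N" using Suc.prems v
      by (intro DS_0_in_N) (auto simp flip: mult.assoc intro: DS_sink)
    then show ?thesis using p_p[of v v] v by (simp add: mult.assoc)
  qed
  then show ?case using Suc.prems by (subst sum_unit) (auto intro: N_sum)
qed

text \<open>
  The leading words of the nonzero summands are distinct, since they extend distinct base paths.
  Hence the largest of them is not cancelled.
\<close>

lemma base_independent_poly: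
  assumes "finite J" "J \<subseteq> base" "\<And>\<beta>. \<beta> \<in> J \<Longrightarrow> walk_poly_from (snd \<beta>) b (r \<beta>)"
    "(\<Sum>\<beta>\<in>J. base_poly \<beta> * r \<beta>) = 0"
  shows "\<forall>\<beta>\<in>J. r \<beta> = 0"
proof (rule ccontr)
  assume "\<not> ?thesis"
  then have ne: "{\<beta> \<in> J. r \<beta> \<noteq> 0} \<noteq> {}" by auto
  define u where "u \<beta> = (SOME w. is_lead (r \<beta>) w)" for \<beta>
  have u: "is_lead (r \<beta>) (u \<beta>)" if "r \<beta> \<noteq> 0" for \<beta>
    using someI_ex[OF is_lead_exists[OF that]] by (simp add: u_def)
  define lam where "lam \<beta> = fst \<beta> @ u \<beta>" for \<beta>
  have lam: "is_lead (base_poly \<beta> * r \<beta>) (lam \<beta>)" if "\<beta> \<in> J" "r \<beta> \<noteq> 0" for \<beta>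
    unfolding lam_def using that assms(2) by (intro is_lead_mult base_poly u) auto
  obtain \<beta> where \<beta>: "\<beta> \<in> J" "r \<beta> \<noteq> 0" and max: "\<And>\<gamma>. \<gamma> \<in> J \<Longrightarrow> r \<gamma> \<noteq> 0 \<Longrightarrow> word_le (lam \<gamma>) (lam \<beta>)"
    using finite_max_word[OF _ ne, of lam] assms(1) by auto
  have other: "lookup (base_poly \<gamma> * r \<gamma>) (Word (lam \<beta>)) = 0" if \<gamma>: "\<gamma> \<in> J" "\<gamma> \<noteq> \<beta>" for \<gamma>
  proof (rule ccontr)
    assume "lookup (base_poly \<gamma> * r \<gamma>) (Word (lam \<beta>)) \<noteq> 0"
    then have key: "Word (lam \<beta>) \<in> keys (base_poly \<gamma> * r \<gamma>)" by (simp add: in_keys_iff)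
    then have r: "r \<gamma> \<noteq> 0" by auto
    have "word_le (lam \<beta>) (lam \<gamma>)" using key lam[OF \<gamma>(1) r] by (auto simp: is_lead_def)
    then have "lam \<beta> = lam \<gamma>" using max[OF \<gamma>(1) r] word_le_antisym by blast
    moreover have "awalk (snd \<beta>) (u \<beta>) b" "awalk (snd \<gamma>) (u \<gamma>) b"
      using u[OF \<beta>(2)] u[OF r] assms(3)[OF \<beta>(1)] assms(3)[OF \<gamma>(1)]
      by (fastforce simp: is_lead_def walk_poly_from_def)+
    ultimately have "\<beta> = \<gamma>"
      using base_prefix_free[of "fst \<beta>" "snd \<beta>" "fst \<gamma>" "snd \<gamma>" "u \<beta>" "u \<gamma>" b] \<beta> \<gamma> assms(2)
      by (auto simp: lam_def prod_eq_iff)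
    then show False using \<gamma> by simp
  qed
  have "0 = lookup (\<Sum>\<gamma>\<in>J. base_poly \<gamma> * r \<gamma>) (Word (lam \<beta>))" using assms(4) by simp
  also have "\<dots> = (\<Sum>\<gamma>\<in>J. if \<gamma> = \<beta> then lookup (base_poly \<beta> * r \<beta>) (Word (lam \<beta>)) else 0)"
    unfolding lookup_sum using other by (intro sum.cong) auto
  also have "\<dots> = lookup (base_poly \<beta> * r \<beta>) (Word (lam \<beta>))" using assms(1) \<beta> by simp
  finally show False using lam[OF \<beta>] by (auto simp: is_lead_def in_keys_iff)
qed

lemma base_independent_0:
  assumes J: "finite J" "J \<subseteq> base"
    and l: "\<And>\<beta>. \<beta> \<in> J \<Longrightarrow> l \<beta> \<in> DS 0 \<and> p (snd \<beta>) * l \<beta> = l \<beta>"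
    and sum0: "(\<Sum>\<beta>\<in>J. base_gen \<beta> * l \<beta>) = 0" and b: "b \<in> verts E" and "\<beta> \<in> J"
  shows "l \<beta> * p b = 0"
proof -
  have "\<exists>r. walk_poly_from (snd \<beta>) b r \<and> l \<beta> * p b = ev s r * p b" if \<beta>: "\<beta> \<in> J" for \<beta>
  proof -
    obtain q where q: "walk_poly b q" "l \<beta> * p b = ev s q * p b" using DS_0_poly l[OF \<beta>] b by blast
    have v: "snd \<beta> \<in> verts E" using \<beta> J base_verts by blast
    from walk_poly_restrict[OF q(1) v] show ?thesis
      using l[OF \<beta>] by (simp flip: q(2) mult.assoc)
  qed
  then obtain r where r: "\<And>\<beta>. \<beta> \<in> J \<Longrightarrow> walk_poly_from (snd \<beta>) b (r \<beta>) \<and> l \<beta> * p b = ev s (r \<beta>) * p b"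
    by metis
  have "ev s (base_poly \<beta> * r \<beta>) * p b = base_gen \<beta> * (l \<beta> * p b)" if "\<beta> \<in> J" for \<beta>
    using r[OF that] walk_poly_from_p[of "snd \<beta>" b "r \<beta>"] base_verts[OF subsetD[OF J(2) that]]
    by (simp add: base_gen_def ev_mult mult.assoc)
  then have "ev s (\<Sum>\<beta>\<in>J. base_poly \<beta> * r \<beta>) * p b = (\<Sum>\<beta>\<in>J. base_gen \<beta> * l \<beta>) * p b"
    by (simp add: ev_sum sum_distrib_right mult.assoc)
  then have "ev s (\<Sum>\<beta>\<in>J. base_poly \<beta> * r \<beta>) * p b = 0" by (simp add: sum0)
  moreover have "walk_poly b (\<Sum>\<beta>\<in>J. base_poly \<beta> * r \<beta>)"
  proof (rule walk_poly_sum)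
    fix \<beta> assume "\<beta> \<in> J"
    then show "walk_poly b (base_poly \<beta> * r \<beta>)"
      using base_poly(1)[OF subsetD[OF J(2)]] r by (intro walk_poly_mult[of "snd \<beta>"]) (auto simp: M_def)
  qed
  ultimately have "(\<Sum>\<beta>\<in>J. base_poly \<beta> * r \<beta>) = 0" using walk_poly_inj[OF independent] by blast
  then have "r \<beta> = 0" using base_independent_poly[OF J, of b r] r \<open>\<beta> \<in> J\<close> by blast
  then show ?thesis using r \<open>\<beta> \<in> J\<close> by simp
qed

text \<open>
  Ghost edges are cleared from all coefficients at the same time; this is why they are assumed
  to lie in a common level.
\<close>

lemma base_independent_DS:
  assumes J: "finite J" "J \<subseteq> base"
    and "\<And>\<beta>. \<beta> \<in> J \<Longrightarrow> l \<beta> \<in> S \<and> l \<beta> \<in> DS k \<and> p (snd \<beta>) * l \<beta> = l \<beta>"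
    and "(\<Sum>\<beta>\<in>J. base_gen \<beta> * l \<beta>) = 0" and "\<beta> \<in> J"
  shows "l \<beta> = 0"
  using assms(3-)
proof (induction k arbitrary: l \<beta>)
  case 0
  have "l \<beta> = (\<Sum>b\<in>verts E. l \<beta> * p b)" using 0 by (intro sum_unit) auto
  also have "\<dots> = 0" using 0 base_independent_0[OF J, of l] by (intro sum.neutral ballI) auto
  finally show ?case .
next
  case (Suc k)
  have sum0: "(\<Sum>\<beta>\<in>J. base_gen \<beta> * (l \<beta> * y)) = 0" for y
    using Suc.prems(2) by (simp flip: sum_distrib_right mult.assoc)
  have "l \<beta> * p v = 0" if v: "v \<in> verts E" for v
  proof (cases "regular E v")
    case True
    have "l \<beta> * s e = 0" if e: "e \<in> arcs E" for e
    proof (rule Suc.IH[of "\<lambda>\<beta>. l \<beta> * s e"])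
      fix \<gamma> assume \<gamma>: "\<gamma> \<in> J"
      then show "l \<gamma> * s e \<in> S \<and> l \<gamma> * s e \<in> DS k \<and> p (snd \<gamma>) * (l \<gamma> * s e) = l \<gamma> * s e"
        using Suc.prems(1)[OF \<gamma>] e by (auto intro: S_mult S_s DS_step simp flip: mult.assoc)
    qed (use sum0 Suc.prems in auto)
    then show ?thesis unfolding ck[OF True] sum_distrib_left mult.assoc[symmetric]
      by (intro sum.neutral) auto
  next
    case False
    have "l \<beta> * p v * p v = 0"
    proof (rule base_independent_0[OF J, of "\<lambda>\<beta>. l \<beta> * p v"])
      fix \<gamma> assume \<gamma>: "\<gamma> \<in> J"
      then show "l \<gamma> * p v \<in> DS 0 \<and> p (snd \<gamma>) * (l \<gamma> * p v) = l \<gamma> * p v"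
        using Suc.prems(1)[OF \<gamma>] v False by (auto intro: DS_sink simp flip: mult.assoc)
    qed (use sum0 Suc.prems v in auto)
    then show ?thesis using p_p[of v v] v by (simp add: mult.assoc)
  qed
  moreover have "l \<beta> = (\<Sum>b\<in>verts E. l \<beta> * p b)" using Suc.prems by (intro sum_unit) auto
  ultimately show ?case by simp
qed

lemma base_independent:
  assumes J: "finite J" "J \<subseteq> base"
    and l: "\<And>\<beta>. \<beta> \<in> J \<Longrightarrow> l \<beta> \<in> S \<and> p (snd \<beta>) * l \<beta> = l \<beta>"
    and "(\<Sum>\<beta>\<in>J. base_gen \<beta> * l \<beta>) = 0" and "\<beta> \<in> J"
  shows "l \<beta> = 0"
proof -
  obtain k where "l ` J \<subseteq> DS k" using finite_S_in_DS[of "l ` J"] J l by blast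
  then show ?thesis using base_independent_DS[OF J, of l k] assms by blast
qed

lemma base_gen: assumes "\<beta> \<in> base"
  shows "base_gen \<beta> \<in> S" "\<epsilon> * base_gen \<beta> = base_gen \<beta>" "base_gen \<beta> * p (snd \<beta>) = base_gen \<beta>"
  using base_poly(1)[OF assms] walk_poly_S p_p[of "snd \<beta>" "snd \<beta>"] base_verts[OF assms]
  by (auto simp: base_gen_def M_def mult.assoc)

text \<open>
  An expansion \<open>\<epsilon> = \<Sum> base_gen \<beta> * l \<beta>\<close> exists because \<open>\<epsilon>\<close> fixes itself.  Multiplying it by
  \<open>base_gen \<gamma>\<close>, which \<open>\<epsilon>\<close> fixes, and comparing coefficients shows that the \<open>l \<beta>\<close> are dual to the
  \<open>base_gen \<gamma>\<close>.
\<close>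

theorem idempotent_frame: "\<exists>(J :: ('e list \<times> 'v) set) \<nu> a l. frame \<epsilon> J \<nu> a l"
proof -
  obtain k where "\<epsilon> \<in> DS k" using S_in_DS \<epsilon>_S by blast
  then have "\<epsilon> \<in> N" using fixed_in_N \<epsilon>_S \<epsilon>_idem by blast
  then obtain J l where J: "finite J" "J \<subseteq> base" "\<And>\<beta>. l \<beta> \<in> S" "\<And>\<beta>. p (snd \<beta>) * l \<beta> = l \<beta>"
     "\<epsilon> = (\<Sum>\<beta>\<in>J. base_gen \<beta> * l \<beta>)"
    unfolding N_def by blast
  have dual: "l \<beta> * base_gen \<gamma> = (if \<beta> = \<gamma> then p (snd \<beta>) else 0)" if \<beta>: "\<beta> \<in> J" and \<gamma>: "\<gamma> \<in> J" for \<beta> \<gamma>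
  proof -
    have \<gamma>b: "\<gamma> \<in> base" using \<gamma> J by blast
    \<comment> \<open>The coefficients of \<open>\<epsilon> * base_gen \<gamma> - base_gen \<gamma> = 0\<close>.\<close>
    define d where "d \<beta> = l \<beta> * base_gen \<gamma> - (if \<beta> = \<gamma> then p (snd \<gamma>) else 0)" for \<beta>
    have "(\<Sum>\<beta>\<in>J. base_gen \<beta> * d \<beta>) = (\<Sum>\<beta>\<in>J. base_gen \<beta> * l \<beta>) * base_gen \<gamma> - (\<Sum>\<beta>\<in>J. if \<beta> = \<gamma> then base_gen \<gamma> * p (snd \<gamma>) else 0)"
      unfolding d_def right_diff_distrib sum_subtractf sum_distrib_right
      by (intro arg_cong2[where f = minus] sum.cong) (auto simp: mult.assoc)
    also have "\<dots> = 0" using J \<gamma> base_gen[OF \<gamma>b] by (simp flip: J(5))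
    finally have sum0: "(\<Sum>\<beta>\<in>J. base_gen \<beta> * d \<beta>) = 0" .
    have "d \<beta> = 0"
    proof (rule base_independent[OF J(1,2) _ sum0 \<beta>])
      fix \<beta> assume "\<beta> \<in> J"
      then have "snd \<gamma> \<in> verts E" using base_verts \<gamma>b by blast
      then show "d \<beta> \<in> S \<and> p (snd \<beta>) * d \<beta> = d \<beta>"
        using J(3)[of \<beta>] J(4)[of \<beta>] J(3)[of \<gamma>] J(4)[of \<gamma>] base_gen[OF \<gamma>b] p_p[of "snd \<gamma>" "snd \<gamma>"] unfolding d_def
        by (auto simp: S_zero intro!: S_diff S_mult S_p simp: right_diff_distrib simp flip: mult.assoc)
    qed
    then show ?thesis by (auto simp: d_def)
  qed
  have "frame \<epsilon> J snd base_gen l"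
    unfolding frame_def using J dual base_gen base_verts by auto
  then show ?thesis by blast
qed

end

section \<open>Frames and supports\<close>

context leavitt_family
begin

lemma frame_finite: "frame \<epsilon> J \<nu> a l \<Longrightarrow> finite J"
  and frame_sum: "frame \<epsilon> J \<nu> a l \<Longrightarrow> \<epsilon> = (\<Sum>i\<in>J. a i * l i)"
  by (simp_all add: frame_def)

lemma frameD:
  assumes "frame \<epsilon> J \<nu> a l" "i \<in> J"
  shows "\<nu> i \<in> verts E" "a i \<in> S" "l i \<in> S" "a i * p (\<nu> i) = a i" "p (\<nu> i) * l i = l i"
    "l i * a i = p (\<nu> i)" "\<And>j. j \<in> J \<Longrightarrow> i \<noteq> j \<Longrightarrow> l i * a j = 0" "\<epsilon> * a i = a i" "l i * \<epsilon> = l i"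
proof -
  note f = assms(1)[unfolded frame_def]
  show *: "\<nu> i \<in> verts E" "a i \<in> S" "l i \<in> S" "a i * p (\<nu> i) = a i" "p (\<nu> i) * l i = l i"
    "l i * a i = p (\<nu> i)" "\<And>j. j \<in> J \<Longrightarrow> i \<noteq> j \<Longrightarrow> l i * a j = 0"
    using f assms(2) by auto
  have "\<epsilon> * a i = (\<Sum>j\<in>J. a j * (l j * a i))"
    unfolding frame_sum[OF assms(1)] by (simp add: sum_distrib_right mult.assoc)
  also have "\<dots> = (\<Sum>j\<in>J. if j = i then a i * p (\<nu> i) else 0)"
    using f assms(2) by (intro sum.cong) auto
  finally show "\<epsilon> * a i = a i" using f assms(2) * by simp
  have "l i * \<epsilon> = (\<Sum>j\<in>J. l i * a j * l j)"
    unfolding frame_sum[OF assms(1)] by (simp add: sum_distrib_left mult.assoc)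
  also have "\<dots> = (\<Sum>j\<in>J. if j = i then p (\<nu> i) * l i else 0)"
    using f assms(2) by (intro sum.cong) auto
  finally show "l i * \<epsilon> = l i" using f assms(2) * by simp
qed

text \<open>
  If \<open>\<epsilon>S\<close> is a direct sum of right ideals \<open>vS\<close> and each of these is again such a sum, then the
  two decompositions can be composed.
\<close>

lemma frame_refine:
  assumes f: "frame \<epsilon> J \<nu> a l"
    and r: "\<And>i. i \<in> J \<Longrightarrow> frame (p (\<nu> i)) (T i) (\<nu>' i) (x i) (y i)"
  shows "frame \<epsilon> (Sigma J T) (\<lambda>(i, t). \<nu>' i t) (\<lambda>(i, t). a i * x i t) (\<lambda>(i, t). y i t * l i)"
proof -
  have fT: "finite (T i)" if "i \<in> J" for i using frame_finite[OF r[OF that]] .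
  show ?thesis
    unfolding frame_def
  proof (intro conjI ballI)
    show "finite (Sigma J T)" using frame_finite[OF f] fT by auto
  next
    fix it assume "it \<in> Sigma J T"
    then obtain i t where it: "it = (i, t)" "i \<in> J" "t \<in> T i" by auto
    note fi = frameD[OF f it(2)] and ri = frameD[OF r[OF it(2)] it(3)]
    show "(case it of (i, t) \<Rightarrow> \<nu>' i t) \<in> verts E" using it ri by simp
    show "(case it of (i, t) \<Rightarrow> a i * x i t) \<in> S" using it fi ri by (simp add: S_mult)
    show "(case it of (i, t) \<Rightarrow> y i t * l i) \<in> S" using it fi ri by (simp add: S_mult)
    show "(case it of (i, t) \<Rightarrow> a i * x i t) * p (case it of (i, t) \<Rightarrow> \<nu>' i t) = (case it of (i, t) \<Rightarrow> a i * x i t)"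
      using it ri by (simp add: mult.assoc)
    show "p (case it of (i, t) \<Rightarrow> \<nu>' i t) * (case it of (i, t) \<Rightarrow> y i t * l i) = (case it of (i, t) \<Rightarrow> y i t * l i)"
      using it ri by (simp flip: mult.assoc)
    fix js assume "js \<in> Sigma J T"
    then obtain j u where js: "js = (j, u)" "j \<in> J" "u \<in> T j" by auto
    have *: "y i t * l i * (a j * x j u) = y i t * (l i * a j) * x j u" by (simp add: mult.assoc)
    show "(case it of (i, t) \<Rightarrow> y i t * l i) * (case js of (i, t) \<Rightarrow> a i * x i t) =
       (if it = js then p (case it of (i, t) \<Rightarrow> \<nu>' i t) else 0)"
    proof (cases "i = j")
      case True
      have "y i t * (l i * a j) * x j u = y i t * x i u" using fi True ri by simp
      then show ?thesis using * it js ri(6) ri(7)[of u] True by auto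
    next
      case False
      then show ?thesis using * it js fi(7) by auto
    qed
  next
    have "(\<Sum>it\<in>Sigma J T. (case it of (i, t) \<Rightarrow> a i * x i t) * (case it of (i, t) \<Rightarrow> y i t * l i))
        = (\<Sum>(i, t)\<in>Sigma J T. a i * (x i t * y i t) * l i)"
      by (intro sum.cong) (auto simp: mult.assoc)
    also have "\<dots> = (\<Sum>i\<in>J. \<Sum>t\<in>T i. a i * (x i t * y i t) * l i)"
      using frame_finite[OF f] fT by (intro sum.Sigma[symmetric]) blast+
    also have "\<dots> = (\<Sum>i\<in>J. a i * p (\<nu> i) * l i)"
      using frame_sum[OF r] by (intro sum.cong) (simp_all flip: sum_distrib_left sum_distrib_right)
    also have "\<dots> = \<epsilon>" using frameD(4)[OF f] frame_sum[OF f] by simp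
    finally show "\<epsilon> = (\<Sum>it\<in>Sigma J T. (case it of (i, t) \<Rightarrow> a i * x i t) * (case it of (i, t) \<Rightarrow> y i t * l i))"
      by simp
  qed
qed

lemma frame_reindex:
  assumes h: "bij_betw h J' J" and f: "frame \<epsilon> J \<nu> a l"
  shows "frame \<epsilon> J' (\<nu> \<circ> h) (a \<circ> h) (l \<circ> h)"
proof -
  have mem: "h i \<in> J" if "i \<in> J'" for i using h that by (auto simp: bij_betw_def)
  have inj: "h i = h j \<longleftrightarrow> i = j" if "i \<in> J'" "j \<in> J'" for i j
    using h that by (auto simp: bij_betw_def inj_on_def)
  have "(\<Sum>i\<in>J'. (a \<circ> h) i * (l \<circ> h) i) = (\<Sum>i\<in>J. a i * l i)"
    using sum.reindex_bij_betw[OF h, of "\<lambda>i. a i * l i"] by simp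
  moreover have "finite J'" using bij_betw_finite[OF h] frame_finite[OF f] by blast
  ultimately show ?thesis
    unfolding frame_def
  proof (intro conjI ballI)
    fix i j assume i: "i \<in> J'" and j: "j \<in> J'"
    show "(l \<circ> h) i * (a \<circ> h) j = (if i = j then p ((\<nu> \<circ> h) i) else 0)"
      using frameD(6,7)[OF f mem[OF i]] mem[OF j] inj[OF i j] by auto
  qed (use frameD[OF f mem] frame_sum[OF f] in auto)
qed

lemma frame_cong:
  assumes "frame \<epsilon> J \<nu> a l" "\<And>i. i \<in> J \<Longrightarrow> \<nu> i = \<nu>' i"
  shows "frame \<epsilon> J \<nu>' a l"
  unfolding frame_def
proof (intro conjI ballI)
  fix i j assume i: "i \<in> J" and j: "j \<in> J"
  show "l i * a j = (if i = j then p (\<nu>' i) else 0)"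
    using frameD(6,7)[OF assms(1) i] j assms(2)[OF i] by auto
qed (use frameD[OF assms(1)] frame_sum[OF assms(1)] frame_finite[OF assms(1)] assms(2) in auto)

text \<open>
  Only the set of the vertices that occur matters for the choice of \<open>T\<close>, not how often they
  occur; natural numbers as indices are no restriction, because frames are finite.
\<close>

definition supp :: "'a \<Rightarrow> 'v set \<Rightarrow> bool" where
  "supp \<epsilon> T \<longleftrightarrow> (\<exists>(J :: nat set) \<nu> a l. frame \<epsilon> J \<nu> a l \<and> \<nu> ` J = T)"

lemma suppI: assumes "frame \<epsilon> J \<nu> a l" shows "supp \<epsilon> (\<nu> ` J)"
proof -
  obtain h where h: "bij_betw h {0..<card J} J"
    using ex_bij_betw_nat_finite[OF frame_finite[OF assms]] by blast
  have "(\<nu> \<circ> h) ` {0..<card J} = \<nu> ` J" using bij_betw_imp_surj_on[OF h] by (metis image_comp)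
  then show ?thesis unfolding supp_def using frame_reindex[OF h assms] by blast
qed

lemma supp_trans:
  assumes "supp \<epsilon> T" "\<And>v. v \<in> T \<Longrightarrow> supp (p v) (\<tau> v)"
  shows "supp \<epsilon> (\<Union>v\<in>T. \<tau> v)"
proof -
  obtain J :: "nat set" and \<nu> a l where f: "frame \<epsilon> J \<nu> a l" and T: "\<nu> ` J = T"
    using assms(1) by (auto simp: supp_def)
  have "\<forall>v\<in>T. \<exists>(J :: nat set) \<nu> a l. frame (p v) J \<nu> a l \<and> \<nu> ` J = \<tau> v"
    using assms(2) unfolding supp_def by blast
  then obtain J' :: "'v \<Rightarrow> nat set" and \<nu>' a' l'
    where f': "\<forall>v\<in>T. frame (p v) (J' v) (\<nu>' v) (a' v) (l' v) \<and> \<nu>' v ` J' v = \<tau> v"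
    by (metis (no_types))
  have "frame \<epsilon> (Sigma J (\<lambda>i. J' (\<nu> i))) (\<lambda>(i, t). \<nu>' (\<nu> i) t) (\<lambda>(i, t). a i * a' (\<nu> i) t) (\<lambda>(i, t). l' (\<nu> i) t * l i)"
    using f f' T by (intro frame_refine) auto
  from suppI[OF this] have "supp \<epsilon> ((\<lambda>(i, t). \<nu>' (\<nu> i) t) ` Sigma J (\<lambda>i. J' (\<nu> i)))" .
  moreover have "(\<lambda>(i, t). \<nu>' (\<nu> i) t) ` Sigma J (\<lambda>i. J' (\<nu> i)) = (\<Union>i\<in>J. \<nu>' (\<nu> i) ` J' (\<nu> i))"
    by force
  moreover have "\<dots> = (\<Union>v\<in>T. \<tau> v)" using f' T by auto
  ultimately show ?thesis by simp
qed

lemma supp_vertex: assumes "v \<in> verts E" shows "supp (p v) {v}"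
proof -
  have "frame (p v) {()} (\<lambda>_. v) (\<lambda>_. p v) (\<lambda>_. p v)"
    unfolding frame_def using assms p_p[of v v] by (auto intro: S_p)
  from suppI[OF this] show ?thesis by simp
qed

text \<open>
  The Cuntz--Krieger relation at \<open>v\<close> is a frame formed by the edges and ghost edges at \<open>v\<close>.
\<close>

lemma supp_regular: assumes "regular E v" shows "supp (p v) (head E ` out_arcs E v)"
proof -
  have "frame (p v) (out_arcs E v) (head E) s g"
    unfolding frame_def using ck[OF assms]
    by (auto intro: S_s S_g simp: s_p p_g g_s)
  from suppI[OF this] show ?thesis .
qed

lemma supp_nonempty: "supp \<epsilon> T \<Longrightarrow> \<epsilon> \<noteq> 0 \<Longrightarrow> T \<noteq> {}"
  unfolding supp_def frame_def by auto

lemma supp_verts: "supp \<epsilon> T \<Longrightarrow> T \<subseteq> verts E"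
  unfolding supp_def frame_def by auto

end

section \<open>Hair extensions and restriction graphs\<close>

lemma hair_simps [simp]:
  "verts (hair_extension F n) = {(v, j). v \<in> verts F \<and> j < n v}"
  "tail (hair_extension F n) (Inl e) = (tail F e, 0)"
  "head (hair_extension F n) (Inl e) = (head F e, 0)"
  "tail (hair_extension F n) (Inr (v, j)) = (v, j)"
  "head (hair_extension F n) (Inr (v, j)) = (v, j - 1)"
  "Inl e \<in> arcs (hair_extension F n) \<longleftrightarrow> e \<in> arcs F"
  "Inr (v, j) \<in> arcs (hair_extension F n) \<longleftrightarrow> v \<in> verts F \<and> 1 \<le> j \<and> j < n v"
  by (auto simp: hair_extension_def)

lemma hair_arc_cases:
  assumes "x \<in> arcs (hair_extension F n)"
  obtains e where "x = Inl e" "e \<in> arcs F" | v j where "x = Inr (v, Suc j)" "v \<in> verts F" "Suc j < n v"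
proof (cases x)
  case (Inl e)
  then show ?thesis using assms that by simp
next
  case (Inr vj)
  obtain v j where vj: "vj = (v, j)" by (cases vj)
  then have "v \<in> verts F" "1 \<le> j" "j < n v" using assms Inr by auto
  then show ?thesis using that(2)[of v "j - 1"] Inr vj by simp
qed

lemma fin_digraph_hair:
  assumes "fin_digraph F" "\<And>v. v \<in> verts F \<Longrightarrow> 1 \<le> n v"
  shows "fin_digraph (hair_extension F n)"
proof -
  interpret F: fin_digraph F by fact
  have "{(v, j). v \<in> verts F \<and> j < n v} = Sigma (verts F) (\<lambda>v. {..<n v})" by auto
  then have fin: "finite {(v, j). v \<in> verts F \<and> j < n v}" by simp
  moreover have "{(v, j). v \<in> verts F \<and> 1 \<le> j \<and> j < n v} \<subseteq> {(v, j). v \<in> verts F \<and> j < n v}" by auto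
  ultimately have "finite {(v, j). v \<in> verts F \<and> 1 \<le> j \<and> j < n v}" using finite_subset by blast
  then have "finite (arcs (hair_extension F n))" by (simp add: hair_extension_def)
  moreover have "tail (hair_extension F n) x \<in> verts (hair_extension F n)"
    "head (hair_extension F n) x \<in> verts (hair_extension F n)" if "x \<in> arcs (hair_extension F n)" for x
    using that assms(2) by (auto elim!: hair_arc_cases simp: Suc_le_eq)
  ultimately show ?thesis using fin by unfold_locales auto
qed

lemma out_arcs_hair_0: "out_arcs (hair_extension F n) (v, 0) = Inl ` out_arcs F v"
proof -
  have "x \<in> out_arcs (hair_extension F n) (v, 0) \<longleftrightarrow> x \<in> Inl ` out_arcs F v" for x
    unfolding out_arcs_def by (auto elim!: hair_arc_cases)
  then show ?thesis by blast
qed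

lemma out_arcs_hair_Suc:
  assumes "v \<in> verts F" "Suc j < n v"
  shows "out_arcs (hair_extension F n) (v, Suc j) = {Inr (v, Suc j)}"
proof -
  have "x \<in> out_arcs (hair_extension F n) (v, Suc j) \<longleftrightarrow> x = Inr (v, Suc j)" for x
    unfolding out_arcs_def using assms by (auto elim!: hair_arc_cases)
  then show ?thesis by blast
qed

lemma regular_hair_0:
  assumes "v \<in> verts F" "1 \<le> n v"
  shows "regular (hair_extension F n) (v, 0) \<longleftrightarrow> regular F v"
  using assms by (auto simp: regular_def out_arcs_hair_0)

lemma (in wf_digraph) hereditaryI:
  assumes "T \<subseteq> verts G" "\<And>e. e \<in> arcs G \<Longrightarrow> tail G e \<in> T \<Longrightarrow> head G e \<in> T"
  shows "hereditary G T"
  unfolding hereditary_def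
proof (intro conjI ballI allI impI)
  fix v w assume v: "v \<in> T" and "v \<rightarrow>\<^sup>*\<^bsub>G\<^esub> w"
  from this(2) show "w \<in> T"
  proof (induction rule: reachable_induct)
    case (step x y)
    then show ?case using assms(2) by (auto simp: arcs_ends_def arc_to_ends_def)
  qed (rule v)
qed fact

lemma (in wf_digraph) hereditary_head:
  assumes "hereditary G T" "e \<in> arcs G" "tail G e \<in> T"
  shows "head G e \<in> T"
proof -
  have "tail G e \<rightarrow>\<^bsub>G\<^esub> head G e" using assms by (auto intro!: dominatesI simp: arc_to_ends_def)
  then have "tail G e \<rightarrow>\<^sup>*\<^bsub>G\<^esub> head G e" by (rule reachable_adjI)
  then show ?thesis using assms unfolding hereditary_def by blast
qed

lemma restriction_simps [simp]:
  "verts (restriction_graph F T) = T"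
  "arcs (restriction_graph F T) = {e \<in> arcs F. tail F e \<in> T}"
  "tail (restriction_graph F T) = tail F" "head (restriction_graph F T) = head F"
  by (simp_all add: restriction_graph_def)

lemma fin_digraph_restriction:
  assumes "fin_digraph F" "hereditary F T"
  shows "fin_digraph (restriction_graph F T)"
proof -
  interpret F: fin_digraph F by fact
  have "finite T" using assms(2) F.finite_verts by (auto simp: hereditary_def intro: finite_subset)
  moreover have "head F e \<in> T" if "e \<in> arcs F" "tail F e \<in> T" for e
    using F.hereditary_head[OF assms(2)] that by blast
  ultimately show ?thesis by unfold_locales auto
qed

lemma totally_looped_restriction:
  assumes "totally_looped F" "hereditary F T"
  shows "totally_looped (restriction_graph F T)"
  unfolding totally_looped_def
proof (intro allI impI)
  fix v assume v: "regular (restriction_graph F T) v"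
  then have "regular F v" "v \<in> T" using assms(2) by (auto simp: regular_def out_arcs_def hereditary_def)
  then show "\<exists>e\<in>arcs (restriction_graph F T). tail (restriction_graph F T) e = v \<and> head (restriction_graph F T) e = v"
    using assms(1) by (auto simp: totally_looped_def)
qed

section \<open>Supports in a hair extension\<close>

locale hair_family = leavitt_family E K sc p s g
  for E :: "('u \<times> nat, 'f + 'u \<times> nat) pre_digraph" and K :: "'k :: field itself"
    and sc :: "'k \<Rightarrow> 'a :: ring_1" and p s g +
  fixes F :: "('u, 'f) pre_digraph" and n :: "'u \<Rightarrow> nat"
  assumes E_hair: "E = hair_extension F n" and F_fin: "fin_digraph F"
    and n_pos: "v \<in> verts F \<Longrightarrow> 1 \<le> n v"
begin

lemma level_0: "v \<in> verts F \<Longrightarrow> (v, 0) \<in> verts E"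
  using n_pos[of v] by (auto simp: E_hair)

text \<open>
  A vertex on a hair emits one edge only, so it is equivalent to the next vertex on the hair.
\<close>

lemma supp_hair: "(v, j) \<in> verts E \<Longrightarrow> supp (p (v, j)) {(v, 0)}"
proof (induction j)
  case 0
  then show ?case by (rule supp_vertex)
next
  case (Suc j)
  have out: "out_arcs E (v, Suc j) = {Inr (v, Suc j)}"
    using Suc.prems by (auto simp: E_hair out_arcs_hair_Suc)
  then have "regular E (v, Suc j)" using Suc.prems by (simp add: regular_def)
  moreover have "head E ` out_arcs E (v, Suc j) = {(v, j)}" unfolding out by (simp add: E_hair)
  ultimately have *: "supp (p (v, Suc j)) {(v, j)}" using supp_regular by metis
  have "(v, j) \<in> verts E" using Suc.prems by (auto simp: E_hair)
  then show ?case using supp_trans[OF *, of "\<lambda>_. {(v, 0)}"] Suc.IH by simp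
qed

lemma supp_level_0: assumes "supp \<epsilon> T" shows "supp \<epsilon> (fst ` T \<times> {0})"
proof -
  have "supp \<epsilon> (\<Union>v\<in>T. {(fst v, 0)})"
  proof (rule supp_trans[OF assms])
    fix v assume "v \<in> T"
    then have "v \<in> verts E" using supp_verts[OF assms] by blast
    then show "supp (p v) {(fst v, 0)}" using supp_hair[of "fst v" "snd v"] by simp
  qed
  moreover have "(\<Union>v\<in>T. {(fst v, 0 :: nat)}) = fst ` T \<times> {0}" by force
  ultimately show ?thesis by simp
qed

text \<open>
  Expanding \<open>v\<close> by the Cuntz--Krieger relation keeps \<open>v\<close> in the support, because of the loop at \<open>v\<close>.
\<close>

lemma supp_step:
  assumes "totally_looped F" "supp \<epsilon> (T \<times> {0})" "T \<subseteq> verts F"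
  shows "supp \<epsilon> ((T \<union> head F ` {e \<in> arcs F. tail F e \<in> T}) \<times> {0})"
proof -
  \<comment> \<open>The vertex itself is included: it is the range of a loop, or a sink that is not expanded.\<close>
  let ?\<tau> = "\<lambda>vj :: 'u \<times> nat. (insert (fst vj) (head F ` out_arcs F (fst vj))) \<times> {0 :: nat}"
  have "supp \<epsilon> (\<Union>vj\<in>T \<times> {0}. ?\<tau> vj)"
  proof (rule supp_trans[OF assms(2)])
    fix vj :: "'u \<times> nat" assume "vj \<in> T \<times> {0}"
    then obtain v where v: "vj = (v, 0)" "v \<in> T" "v \<in> verts F" using assms(3) by auto
    show "supp (p vj) (?\<tau> vj)"
    proof (cases "regular F v")
      case True
      then have "regular E (v, 0)" using v n_pos by (simp add: E_hair regular_hair_0)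
      from supp_regular[OF this] have "supp (p (v, 0)) (head E ` Inl ` out_arcs F v)"
        by (simp add: E_hair out_arcs_hair_0)
      moreover obtain e where "e \<in> arcs F" "tail F e = v" "head F e = v"
        using assms(1) True by (auto simp: totally_looped_def)
      then have "v \<in> head F ` out_arcs F v" by (force simp: out_arcs_def)
      then have "head E ` Inl ` out_arcs F v = ?\<tau> vj"
        by (force simp: E_hair v)
      ultimately show ?thesis by (simp add: v)
    next
      case False
      then have eq: "?\<tau> vj = {(v, 0)}" using v by (auto simp: regular_def)
      show ?thesis unfolding eq unfolding v(1) by (rule supp_vertex[OF level_0[OF v(3)]])
    qed
  qed
  moreover have "(\<Union>vj\<in>T \<times> {0}. ?\<tau> vj) = (T \<union> head F ` {e \<in> arcs F. tail F e \<in> T}) \<times> {0}"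
    by (auto simp: out_arcs_def)
  ultimately show ?thesis by simp
qed

lemma supp_hereditary:
  assumes "totally_looped F" "supp \<epsilon> (T \<times> {0})" "T \<subseteq> verts F"
  shows "\<exists>T'. hereditary F T' \<and> T \<subseteq> T' \<and> supp \<epsilon> (T' \<times> {0})"
  using assms(2,3)
proof (induction "card (verts F - T)" arbitrary: T rule: less_induct)
  case less
  interpret F: fin_digraph F by (rule F_fin)
  let ?T = "T \<union> head F ` {e \<in> arcs F. tail F e \<in> T}"
  show ?case
  proof (cases "?T = T")
    case True
    then have "hereditary F T" using less.prems by (intro F.hereditaryI) auto
    then show ?thesis using less.prems by blast
  next
    case False
    have sub: "?T \<subseteq> verts F" using less.prems by auto
    then have "verts F - ?T \<subset> verts F - T" using False by blast
    then have "card (verts F - ?T) < card (verts F - T)" by (intro psubset_card_mono) auto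
    from less.hyps[OF this supp_step[OF assms(1) less.prems] sub] show ?thesis by blast
  qed
qed

text \<open>
  The indices with label \<open>v\<close> are renumbered from \<open>(v, 0)\<close> to \<open>(v, m v - 1)\<close>, so that they
  become the vertices of a hair extension.
\<close>

lemma supp_frame:
  assumes "supp \<epsilon> (T \<times> {0})"
  shows "\<exists>(m :: 'u \<Rightarrow> nat) a l. (\<forall>v\<in>T. 1 \<le> m v) \<and> frame \<epsilon> {(v, j). v \<in> T \<and> j < m v} (\<lambda>i. (fst i, 0)) a l"
proof -
  obtain J :: "nat set" and \<nu> a l where f: "frame \<epsilon> J \<nu> a l" and T: "\<nu> ` J = T \<times> {0}"
    using assms by (auto simp: supp_def)
  define fib where "fib v = {i \<in> J. \<nu> i = (v, 0)}" for v
  define m where "m v = card (fib v)" for v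
  have fin: "finite (fib v)" for v using frame_finite[OF f] by (simp add: fib_def)
  have "\<exists>h. bij_betw h {0..<m v} (fib v)" for v
    unfolding m_def by (rule ex_bij_betw_nat_finite[OF fin])
  then obtain h where h: "bij_betw (h v) {0..<m v} (fib v)" for v by metis
  let ?I = "{(v, j). v \<in> T \<and> j < m v}"
  have hmem: "h v j \<in> fib v" if "j < m v" for v j
    using bij_betwE[OF h[of v]] that by auto
  have bij: "bij_betw (\<lambda>(v, j). h v j) ?I J"
    unfolding bij_betw_def
  proof
    show "inj_on (\<lambda>(v, j). h v j) ?I"
    proof (rule inj_onI, clarify)
      fix v j v' j' assume *: "j < m v" "j' < m v'" "h v j = h v' j'"
      then have "v = v'" using hmem[OF *(1)] hmem[OF *(2)] by (auto simp: fib_def)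
      then show "v = v' \<and> j = j'" using * bij_betw_imp_inj_on[OF h[of v]] by (auto simp: inj_on_def)
    qed
    show "(\<lambda>(v, j). h v j) ` ?I = J"
    proof
      show "(\<lambda>(v, j). h v j) ` ?I \<subseteq> J" using hmem by (auto simp: fib_def)
      show "J \<subseteq> (\<lambda>(v, j). h v j) ` ?I"
      proof
        fix i assume i: "i \<in> J"
        then obtain v where v: "\<nu> i = (v, 0)" "v \<in> T" using T by (metis SigmaE imageI singletonD)
        then have "i \<in> h v ` {0..<m v}" using i bij_betw_imp_surj_on[OF h[of v]] by (simp add: fib_def)
        then obtain j where "j < m v" "h v j = i" by auto
        then show "i \<in> (\<lambda>(v, j). h v j) ` ?I" using v by (auto intro!: rev_image_eqI[of "(v, j)"])
      qed
    qed
  qed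
  have "fib v \<noteq> {}" if "v \<in> T" for v
  proof -
    have "(v, 0) \<in> \<nu> ` J" using T that by simp
    then show ?thesis by (auto simp: fib_def)
  qed
  then have m: "1 \<le> m v" if "v \<in> T" for v using that fin by (simp add: m_def Suc_le_eq card_gt_0_iff)
  have fr: "frame \<epsilon> ?I (\<nu> \<circ> (\<lambda>(v, j). h v j)) (a \<circ> (\<lambda>(v, j). h v j)) (l \<circ> (\<lambda>(v, j). h v j))"
    by (rule frame_reindex[OF bij f])
  have "(\<nu> \<circ> (\<lambda>(v, j). h v j)) i = (fst i, 0)" if "i \<in> ?I" for i
    using that hmem by (auto simp: fib_def)
  then have fr': "frame \<epsilon> ?I (\<lambda>i. (fst i, 0)) (a \<circ> (\<lambda>(v, j). h v j)) (l \<circ> (\<lambda>(v, j). h v j))"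
    by (rule frame_cong[OF fr])
  have "\<forall>v\<in>T. 1 \<le> m v" using m by blast
  with fr' show ?thesis by blast
qed

end

section \<open>The corner of an idempotent with hereditary support\<close>

context leavitt_family
begin

lemma S_induct [consumes 1, case_names zero vertex edge ghost add mult scale]:
  assumes "x \<in> S" and "P 0"
    and vertex: "\<And>v. v \<in> verts E \<Longrightarrow> P (p v)"
    and edge: "\<And>e. e \<in> arcs E \<Longrightarrow> P (s e)"
    and ghost: "\<And>e. e \<in> arcs E \<Longrightarrow> P (g e)"
    and add: "\<And>x y. P x \<Longrightarrow> P y \<Longrightarrow> P (x + y)"
    and mult: "\<And>x y. P x \<Longrightarrow> P y \<Longrightarrow> P (x * y)"
    and scale: "\<And>c x. P x \<Longrightarrow> P (sc c * x)"
  shows "P x"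
proof -
  have gen: "P (val (gen x))" if "x \<in> lpa_gens E" for x
    using that vertex edge ghost by (auto simp: lpa_gens_def)
  have word: "P (val (prod_list (map gen (x # xs))))" if "set (x # xs) \<subseteq> lpa_gens E" for x xs
    using that
  proof (induction xs arbitrary: x)
    case Nil
    then show ?case using gen by simp
  next
    case (Cons y xs)
    have "P (val (gen x))" "P (val (prod_list (map gen (y # xs))))"
      using Cons gen by auto
    from mult[OF this] show ?case by simp
  qed
  obtain y where y: "y \<in> augmentation_ideal (lpa_gens E)" "x = val y" using assms(1) by (auto simp: S_def)
  from y(1) have "P (val y)"
  proof (induction rule: aug_sum_induct)
    case (word x xs c)
    then show ?case using scale[OF \<open>\<And>xs x. set (x # xs) \<subseteq> lpa_gens E \<Longrightarrow> P (val (prod_list (map gen (x # xs))))\<close>[of x xs], of c]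
      by (simp only: val_simps)
  qed (use assms(2) add in auto)
  then show ?thesis by (simp add: y)
qed

text \<open>
  Inside \<open>\<epsilon>S\<epsilon>\<close> the products \<open>a i x l j\<close> multiply like matrices with entries \<open>x\<close> from \<open>p (\<nu> i)\<close> to
  \<open>p (\<nu> j)\<close>.  So it is enough to check the relations of \<open>G\<close> for the entries \<open>\<sigma>\<close> and \<open>\<gamma>\<close>, with
  \<open>p (\<nu> i)\<close> in place of the vertex \<open>i\<close>.
\<close>

lemma twisted_family:
  fixes G :: "('i, 'x) pre_digraph"
  assumes G: "fin_digraph G" and f: "frame \<epsilon> (verts G) \<nu> a l"
    and \<sigma>: "\<And>x. x \<in> arcs G \<Longrightarrow> p (\<nu> (tail G x)) * \<sigma> x = \<sigma> x \<and> \<sigma> x * p (\<nu> (head G x)) = \<sigma> x"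
    and \<gamma>: "\<And>x. x \<in> arcs G \<Longrightarrow> p (\<nu> (head G x)) * \<gamma> x = \<gamma> x \<and> \<gamma> x * p (\<nu> (tail G x)) = \<gamma> x"
    and \<gamma>\<sigma>: "\<And>x y. x \<in> arcs G \<Longrightarrow> y \<in> arcs G \<Longrightarrow> tail G x = tail G y \<Longrightarrow>
       \<gamma> x * \<sigma> y = (if x = y then p (\<nu> (head G x)) else 0)"
    and ckG: "\<And>i. regular G i \<Longrightarrow> p (\<nu> i) = (\<Sum>x\<in>out_arcs G i. \<sigma> x * \<gamma> x)"
  shows "leavitt_family G sc (\<lambda>i. a i * l i)
    (\<lambda>x. a (tail G x) * \<sigma> x * l (head G x)) (\<lambda>x. a (head G x) * \<gamma> x * l (tail G x))"
proof -
  interpret G: fin_digraph G by (rule G)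
  note F = frameD[OF f]
  have la: "l i * (a i * y) = p (\<nu> i) * y" "l j * (a i * y) = 0"
    if "i \<in> verts G" "j \<in> verts G" "j \<noteq> i" for i j y
    using F(6)[OF that(1)] F(7)[OF that(2,1)] that(3) by (simp_all flip: mult.assoc)
  have la': "l i * (a i * y) = p (\<nu> i) * y" if "i \<in> verts G" for i y
    using F(6)[OF that(1)] by (simp flip: mult.assoc)
  have pl: "p (\<nu> i) * l i = l i" if "i \<in> verts G" for i using F(5) that by blast
  show ?thesis
  proof (unfold_locales, goal_cases)
    case (1 v w)
    then show ?case using la(2)[of w v] la'[of v] pl by (auto simp: mult.assoc)
  next
    case (2 e)
    then have "tail G e \<in> verts G" by simp
    from la'[OF this] show ?case using \<sigma>[OF 2] by (simp add: mult.assoc) (simp flip: mult.assoc)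
  next
    case (3 e)
    then have "head G e \<in> verts G" by simp
    from la'[OF this] pl[OF this] show ?case by (simp add: mult.assoc)
  next
    case (4 e)
    then have "head G e \<in> verts G" by simp
    from la'[OF this] show ?case using \<gamma>[OF 4] by (simp add: mult.assoc) (simp flip: mult.assoc)
  next
    case (5 e)
    then have "tail G e \<in> verts G" by simp
    from la'[OF this] pl[OF this] show ?case by (simp add: mult.assoc)
  next
    case (6 e f)
    then have v: "tail G e \<in> verts G" "tail G f \<in> verts G" "head G e \<in> verts G" by simp_all
    show ?case
    proof (cases "tail G e = tail G f")
      case True
      have "a (head G e) * \<gamma> e * l (tail G e) * (a (tail G f) * \<sigma> f * l (head G f))
         = a (head G e) * (\<gamma> e * p (\<nu> (tail G e)) * \<sigma> f) * l (head G f)"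
        using la'[OF v(1)] True by (simp add: mult.assoc)
      also have "\<dots> = a (head G e) * (\<gamma> e * \<sigma> f) * l (head G f)" using \<gamma> 6 by simp
      finally show ?thesis using \<gamma>\<sigma>[OF 6 True] F(4)[OF v(3)] by auto
    next
      case False
      then show ?thesis using la(2)[OF v(2,1)] by (auto simp: mult.assoc)
    qed
  next
    case (7 i)
    then have i: "i \<in> verts G" by (simp add: regular_def)
    have "(\<Sum>x\<in>out_arcs G i. a (tail G x) * \<sigma> x * l (head G x) * (a (head G x) * \<gamma> x * l (tail G x)))
       = (\<Sum>x\<in>out_arcs G i. a i * (\<sigma> x * \<gamma> x) * l i)"
    proof (rule sum.cong)
      fix x assume x: "x \<in> out_arcs G i"
      then have "head G x \<in> verts G" by auto
      from la'[OF this] show "a (tail G x) * \<sigma> x * l (head G x) * (a (head G x) * \<gamma> x * l (tail G x)) = a i * (\<sigma> x * \<gamma> x) * l i"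
        using x \<gamma>[of x] by (simp add: mult.assoc) (simp flip: mult.assoc)
    qed simp
    also have "\<dots> = a i * p (\<nu> i) * l i"
      unfolding ckG[OF 7] by (simp add: sum_distrib_left sum_distrib_right)
    finally show ?case using F(4)[OF i] by simp
  qed
qed

end

lemma hair_walk_length:
  assumes "wf_digraph (hair_extension F n)"
    and "pre_digraph.awalk (hair_extension F n) (v, i) w (v', j)" "filter isl w = []"
  shows "i = j + length w"
proof -
  interpret H: wf_digraph "hair_extension F n" by fact
  show ?thesis
    using assms(2,3)
  proof (induction w arbitrary: i)
    case Nil
    then show ?case by (simp add: H.awalk_Nil_iff)
  next
    case (Cons x w)
    then have x: "x \<in> arcs (hair_extension F n)" "tail (hair_extension F n) x = (v, i)"
      and w: "H.awalk (head (hair_extension F n) x) w (v', j)"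
      by (auto simp: H.awalk_Cons_iff)
    from x(1) show ?case
    proof (cases rule: hair_arc_cases)
      case (1 e)
      then show ?thesis using Cons.prems by simp
    next
      case (2 u k)
      then show ?thesis using x w Cons by auto
    qed
  qed
qed

text \<open>
  The part of a walk that runs along a hair is forced, because each hair vertex emits only one
  edge.  A walk along a hair alone is determined by its length, hence by its endpoints.
\<close>

lemma hair_walk_inj:
  assumes "wf_digraph (hair_extension F n)"
    and "pre_digraph.awalk (hair_extension F n) (v, i) w b" "pre_digraph.awalk (hair_extension F n) (v, i) w' b"
    and "filter isl w = filter isl w'"
  shows "w = w'"
proof -
  interpret H: wf_digraph "hair_extension F n" by fact
  show ?thesis
    using assms(2-)
  proof (induction w arbitrary: v i w')
    case Nil
    then have "b = (v, i)" by (auto simp: H.awalk_Nil_iff)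
    then show ?case using hair_walk_length[OF assms(1), of v i w' v i] Nil by simp
  next
    case (Cons x w)
    show ?case
    proof (cases w')
      case Nil
      then have "b = (v, i)" using Cons.prems by (auto simp: H.awalk_Nil_iff)
      then have "i = i + length (x # w)"
        using Nil Cons.prems by (intro hair_walk_length[OF assms(1), of v i "x # w" v i]) auto
      then show ?thesis by simp
    next
      case (Cons x' u)
      note w' = this
      have x: "x \<in> out_arcs (hair_extension F n) (v, i)" "x' \<in> out_arcs (hair_extension F n) (v, i)"
        and w: "H.awalk (head (hair_extension F n) x) w b" "H.awalk (head (hair_extension F n) x') u b"
        using Cons.prems w' by (auto simp: H.awalk_Cons_iff out_arcs_def)
      have vi: "(v, i) \<in> verts (hair_extension F n)" using Cons.prems(1) by (rule H.awalk_hd_in_verts)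
      have "x = x'" and "filter isl w = filter isl u"
      proof -
        have "x = x' \<and> filter isl w = filter isl u"
        proof (cases i)
          case 0
          then have "isl x" "isl x'" using x by (auto simp: out_arcs_hair_0)
          then show ?thesis using Cons.prems(3) w' by simp
        next
          case (Suc k)
          then have vk: "v \<in> verts F" "Suc k < n v" using vi by auto
          have "x = Inr (v, i)" "x' = Inr (v, i)"
            using x unfolding Suc out_arcs_hair_Suc[of v F k n, OF vk] by blast+
          then show ?thesis using Cons.prems(3) w' by simp
        qed
        then show "x = x'" "filter isl w = filter isl u" by auto
      qed
      moreover have "w = u"
        using Cons.IH[of "fst (head (hair_extension F n) x)" "snd (head (hair_extension F n) x)" u] w calculation by simp
      ultimately show ?thesis using w' by simp
    qed
  qed
qed

locale hair_corner = hair_family E K sc p s g F n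
  for E :: "('u \<times> nat, 'f + 'u \<times> nat) pre_digraph" and K :: "'k :: field itself"
    and sc :: "'k \<Rightarrow> 'a :: ring_1" and p s g F n +
  fixes \<epsilon> :: 'a and T :: "'u set" and m :: "'u \<Rightarrow> nat" and a l :: "'u \<times> nat \<Rightarrow> 'a"
  assumes T_hereditary: "hereditary F T" and m_pos: "v \<in> T \<Longrightarrow> 1 \<le> m v"
    and \<epsilon>_frame: "frame \<epsilon> {(v, j). v \<in> T \<and> j < m v} (\<lambda>i. (fst i, 0)) a l"
begin

abbreviation G :: "('u \<times> nat, 'f + 'u \<times> nat) pre_digraph" where
  "G \<equiv> hair_extension (restriction_graph F T) m"

text \<open>
  The matrix entries of the new family.  Edges of \<open>F\<close> keep their meaning, while hair edges become
  matrix units, whose entry is the foot of the hair.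
\<close>

definition \<sigma> :: "'f + 'u \<times> nat \<Rightarrow> 'a" where
  "\<sigma> x = (case x of Inl e \<Rightarrow> s (Inl e) | Inr vj \<Rightarrow> p (fst vj, 0))"

definition \<gamma> :: "'f + 'u \<times> nat \<Rightarrow> 'a" where
  "\<gamma> x = (case x of Inl e \<Rightarrow> g (Inl e) | Inr vj \<Rightarrow> p (fst vj, 0))"

definition pG :: "'u \<times> nat \<Rightarrow> 'a" where "pG i = a i * l i"
definition sG :: "'f + 'u \<times> nat \<Rightarrow> 'a" where "sG x = a (tail G x) * \<sigma> x * l (head G x)"
definition gG :: "'f + 'u \<times> nat \<Rightarrow> 'a" where "gG x = a (head G x) * \<gamma> x * l (tail G x)"

lemma G_verts: "verts G = {(v, j). v \<in> T \<and> j < m v}"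
  by simp

lemma frameG: "frame \<epsilon> (verts G) (\<lambda>i. (fst i, 0)) a l"
  unfolding G_verts by (rule \<epsilon>_frame)

lemma T_verts: "v \<in> T \<Longrightarrow> v \<in> verts F"
  using T_hereditary by (auto simp: hereditary_def)

lemma T_level_0: "v \<in> T \<Longrightarrow> (v, 0) \<in> verts E"
  by (intro level_0 T_verts)

lemma T_head: "e \<in> arcs F \<Longrightarrow> tail F e \<in> T \<Longrightarrow> head F e \<in> T"
  using wf_digraph.hereditary_head[OF _ T_hereditary] F_fin fin_digraph.axioms(1) by metis

lemma G_fin: "fin_digraph G"
  using fin_digraph_hair[OF fin_digraph_restriction[OF F_fin T_hereditary], of m] m_pos by simp

lemma Inl_E: "e \<in> arcs F \<Longrightarrow> Inl e \<in> arcs E" "tail E (Inl e) = (tail F e, 0)" "head E (Inl e) = (head F e, 0)"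
  by (simp_all add: E_hair)

lemma family_G: "leavitt_family G sc pG sG gG"
  unfolding pG_def[abs_def] sG_def[abs_def] gG_def[abs_def]
proof (rule twisted_family[OF G_fin frameG])
  fix x assume x: "x \<in> arcs G"
  from x show "p (fst (tail G x), 0) * \<sigma> x = \<sigma> x \<and> \<sigma> x * p (fst (head G x), 0) = \<sigma> x"
  proof (cases rule: hair_arc_cases)
    case (1 e)
    then show ?thesis using p_s[OF Inl_E(1)] s_p[OF Inl_E(1)] by (auto simp: \<sigma>_def Inl_E)
  next
    case (2 v j)
    then show ?thesis using p_p[OF T_level_0 T_level_0] by (simp add: \<sigma>_def)
  qed
  from x show "p (fst (head G x), 0) * \<gamma> x = \<gamma> x \<and> \<gamma> x * p (fst (tail G x), 0) = \<gamma> x"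
  proof (cases rule: hair_arc_cases)
    case (1 e)
    then show ?thesis using p_g[OF Inl_E(1)] g_p[OF Inl_E(1)] by (auto simp: \<gamma>_def Inl_E)
  next
    case (2 v j)
    then show ?thesis using p_p[OF T_level_0 T_level_0] by (simp add: \<gamma>_def)
  qed
  fix y assume y: "y \<in> arcs G" and t: "tail G x = tail G y"
  from x show "\<gamma> x * \<sigma> y = (if x = y then p (fst (head G x), 0) else 0)"
  proof (cases rule: hair_arc_cases)
    case (1 e)
    with y t obtain f where "y = Inl f" "f \<in> arcs F" by (elim hair_arc_cases) auto
    then show ?thesis using 1 g_s[OF Inl_E(1) Inl_E(1)] by (auto simp: \<gamma>_def \<sigma>_def Inl_E)
  next
    case (2 v j)
    with y t have "y = x" by (elim hair_arc_cases) auto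
    then show ?thesis using 2 p_p[OF T_level_0 T_level_0] by (simp add: \<sigma>_def \<gamma>_def)
  qed
next
  fix i assume reg: "regular G i"
  obtain v j where i: "i = (v, j)" by (cases i)
  have v: "v \<in> T" "j < m v" using reg by (auto simp: regular_def i)
  show "p (fst i, 0) = (\<Sum>x\<in>out_arcs G i. \<sigma> x * \<gamma> x)"
  proof (cases j)
    case 0
    have out: "out_arcs (restriction_graph F T) v = out_arcs F v" using v by (auto simp: out_arcs_def)
    then have "regular F v" using reg v T_verts[of v] by (auto simp: regular_def i 0 out_arcs_hair_0)
    then have "regular E (v, 0)" using T_verts[of v] v n_pos by (simp add: E_hair regular_hair_0)
    from ck[OF this] have "p (v, 0) = (\<Sum>x\<in>Inl ` out_arcs F v. s x * g x)"
      by (simp add: E_hair out_arcs_hair_0)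
    also have "\<dots> = (\<Sum>x\<in>Inl ` out_arcs F v. \<sigma> x * \<gamma> x)"
      by (intro sum.cong) (auto simp: \<sigma>_def \<gamma>_def)
    finally show ?thesis by (simp add: i 0 out_arcs_hair_0 out)
  next
    case (Suc k)
    then show ?thesis using v p_p[OF T_level_0 T_level_0, of v v]
      by (simp add: i out_arcs_hair_Suc \<sigma>_def \<gamma>_def)
  qed
qed

sublocale G: leavitt_family G K sc pG sG gG
  by (rule family_G)

text \<open>
  The hair edges of a walk contribute only to the index of the matrix entry.
\<close>

lemma G_pw:
  assumes "G.awalk i w b"
  shows "awalk (fst i, 0) (filter isl w) (fst b, 0) \<and> G.pw w b = a i * pw (filter isl w) (fst b, 0) * l b"
  using assms
proof (induction w arbitrary: i)
  case Nil
  then have b: "i = b" "b \<in> verts G" unfolding G.awalk_Nil_iff by blast+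
  then have "fst b \<in> T" by auto
  then show ?case using T_level_0[of "fst b"] frameD(4)[OF frameG b(2)] pG_def[of b] b(1)
    by (simp add: awalk_Nil_iff)
next
  case (Cons x w)
  then have x: "x \<in> arcs G" "tail G x = i" and w: "G.awalk (head G x) w b" by (auto simp: G.awalk_Cons_iff)
  note IH = Cons.IH[OF w]
  have h: "head G x \<in> verts G" using x by (intro G.head_in_verts)
  have "G.pw (x # w) b = a i * \<sigma> x * (l (head G x) * a (head G x)) * pw (filter isl w) (fst b, 0) * l b"
    using IH x sG_def[of x] by (simp add: mult.assoc)
  also have "l (head G x) * a (head G x) = p (fst (head G x), 0)" using frameD(6)[OF frameG h] by simp
  finally have *: "G.pw (x # w) b = a i * (\<sigma> x * (p (fst (head G x), 0) * pw (filter isl w) (fst b, 0))) * l b"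
    by (simp add: mult.assoc)
  have "(fst (head G x), 0) \<in> verts E" using h T_level_0 by auto
  then have **: "p (fst (head G x), 0) * pw (filter isl w) (fst b, 0) = pw (filter isl w) (fst b, 0)"
    using p_pw[of "(fst (head G x), 0)" "filter isl w" "(fst b, 0)" "(fst (head G x), 0)"] IH by simp
  from x(1) show ?case
  proof (cases rule: hair_arc_cases)
    case (1 e)
    then have "awalk (fst i, 0) (filter isl (x # w)) (fst b, 0)"
      using IH x by (auto simp: awalk_Cons_iff Inl_E)
    then show ?thesis using * ** 1 by (simp add: \<sigma>_def)
  next
    case (2 v j)
    then have hd: "fst (head G x) = v" "fst i = v" using x by auto
    then show ?thesis using * ** 2 IH by (simp add: \<sigma>_def)
  qed
qed

lemma G_independent:
  assumes path_independent shows "G.path_independent"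
  unfolding G.path_independent_def
proof (intro allI impI)
  fix i b W and c :: "('f + 'u \<times> nat) list \<Rightarrow> 'k"
  assume W: "finite W" "W \<subseteq> {w. G.awalk i w b}" and sum0: "(\<Sum>w\<in>W. sc (c w) * G.pw w b) = 0"
  show "\<forall>w\<in>W. c w = 0"
  proof (cases "W = {}")
    case False
    then obtain w0 where "G.awalk i w0 b" using W by blast
    then have ib: "i \<in> verts G" "b \<in> verts G"
      by (rule G.awalk_hd_in_verts, rule G.awalk_last_in_verts)
    have inj: "inj_on (filter isl) W"
    proof (rule inj_onI)
      fix w w' assume "w \<in> W" "w' \<in> W" "filter isl w = filter isl w'"
      then show "w = w'"
        using W hair_walk_inj[OF G.wf_digraph, of "fst i" "snd i" w b w'] by auto
    qed
    \<comment> \<open>Multiplying by \<open>l i\<close> and \<open>a b\<close> takes the matrix entry, which turns the combination into one of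
        paths of \<open>E\<close>.\<close>
    have "l i * (sc (c w) * G.pw w b) * a b = sc (c w) * pw (filter isl w) (fst b, 0)" if w: "w \<in> W" for w
    proof -
      have walk: "G.awalk i w b" using w W by auto
      note pw = G_pw[OF walk]
      have v: "(fst i, 0) \<in> verts E" "(fst b, 0) \<in> verts E" using ib T_level_0 by auto
      have "l i * (sc (c w) * G.pw w b) * a b = sc (c w) * ((l i * a i) * pw (filter isl w) (fst b, 0) * (l b * a b))"
        using pw by (simp add: mult.assoc sc_left_commute[of "l i"])
      also have "\<dots> = sc (c w) * pw (filter isl w) (fst b, 0)"
        using frameD(6)[OF frameG] ib p_pw[of "(fst i, 0)" "filter isl w" "(fst b, 0)" "(fst i, 0)"]
          pw_p[of "(fst i, 0)" "filter isl w" "(fst b, 0)" "(fst b, 0)"] pw v by simp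
      finally show ?thesis .
    qed
    then have "(\<Sum>w\<in>W. sc (c w) * pw (filter isl w) (fst b, 0)) = l i * (\<Sum>w\<in>W. sc (c w) * G.pw w b) * a b"
      by (simp add: sum_distrib_left sum_distrib_right)
    then have "(\<Sum>u\<in>filter isl ` W. sc (c (the_inv_into W (filter isl) u)) * pw u (fst b, 0)) = 0"
      using sum0 by (simp add: sum.reindex[OF inj] the_inv_into_f_f[OF inj])
    moreover have "awalk (fst i, 0) u (fst b, 0)" if "u \<in> filter isl ` W" for u
      using that W G_pw by blast
    ultimately have "c (the_inv_into W (filter isl) (filter isl w)) = 0" if "w \<in> W" for w
      using path_independentD[OF assms, where W = "filter isl ` W" and a = "(fst i, 0)" and b = "(fst b, 0)"
          and c = "\<lambda>u. c (the_inv_into W (filter isl) u)" and w = "filter isl w"] that W(1) by blast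
    then show ?thesis by (simp add: the_inv_into_f_f[OF inj])
  qed simp
qed

lemma image_in_corner: "x \<in> G.S \<Longrightarrow> x \<in> S \<and> \<epsilon> * x = x \<and> x * \<epsilon> = x"
proof (induction rule: G.S_induct)
  have \<sigma>S: "\<sigma> x \<in> S \<and> \<gamma> x \<in> S" if "x \<in> arcs G" for x
    using that
  proof (cases rule: hair_arc_cases)
    case (1 e)
    then have "Inl e \<in> arcs E" by (simp add: Inl_E)
    then show ?thesis using S_s S_g 1 by (simp add: \<sigma>_def \<gamma>_def)
  next
    case (2 v j)
    then show ?thesis using S_p[OF T_level_0] by (simp add: \<sigma>_def \<gamma>_def)
  qed
  have hv: "head G x \<in> verts G" "tail G x \<in> verts G" if "x \<in> arcs G" for x
    using that by (rule G.head_in_verts, rule G.tail_in_verts)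
  note F = frameD[OF frameG]
  {
    case (vertex v)
    then show ?case using F(2,3,8,9)[OF vertex] pG_def[of v] by (auto simp: S_mult mult.assoc simp flip: mult.assoc[of \<epsilon>])
  next
    case (edge e)
    then show ?case using F(2,3,8,9)[OF hv(1)[OF edge]] F(2,3,8,9)[OF hv(2)[OF edge]] \<sigma>S[OF edge]
      unfolding sG_def[of e] by (auto simp: S_mult mult.assoc simp flip: mult.assoc[of \<epsilon>])
  next
    case (ghost e)
    then show ?case using F(2,3,8,9)[OF hv(1)[OF ghost]] F(2,3,8,9)[OF hv(2)[OF ghost]] \<sigma>S[OF ghost]
      unfolding gG_def[of e] by (auto simp: S_mult mult.assoc simp flip: mult.assoc[of \<epsilon>])
  next
    case (scale c x)
    then show ?case by (auto simp: S_scale mult.assoc sc_left_commute[of \<epsilon>])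
  next
    case (mult x y)
    then show ?case by (auto simp: S_mult mult.assoc simp flip: mult.assoc[of \<epsilon>])
  }
qed (auto simp: S_zero S_add distrib_left distrib_right)

text \<open>
  The matrix units between the copies of one vertex are the images of paths along the hair and of
  their ghosts.
\<close>

lemma image_hair: "(v, j) \<in> verts G \<Longrightarrow> a (v, j) * l (v, 0) \<in> G.S \<and> a (v, 0) * l (v, j) \<in> G.S"
proof (induction j)
  case 0
  then show ?case using G.S_p[OF 0] pG_def[of "(v, 0)"] by simp
next
  case (Suc j)
  have Gv: "(v, j) \<in> verts G" "(v, Suc j) \<in> verts G" using Suc.prems by auto
  let ?x = "Inr (v, Suc j) :: 'f + 'u \<times> nat"
  have x: "?x \<in> arcs G" using Suc.prems by auto
  have "sG ?x = a (v, Suc j) * l (v, j)" "gG ?x = a (v, j) * l (v, Suc j)"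
    using frameD(4)[OF frameG Gv(1)] frameD(4)[OF frameG Gv(2)] 
    by (simp_all add: sG_def[of ?x] gG_def[of ?x] \<sigma>_def \<gamma>_def)
  then have "a (v, Suc j) * l (v, j) \<in> G.S" "a (v, j) * l (v, Suc j) \<in> G.S"
    using G.S_s[OF x] G.S_g[OF x] by simp_all
  then have "(a (v, Suc j) * l (v, j)) * (a (v, j) * l (v, 0)) \<in> G.S"
    "(a (v, 0) * l (v, j)) * (a (v, j) * l (v, Suc j)) \<in> G.S"
    using Suc.IH[OF Gv(1)] by (auto intro: G.S_mult)
  moreover have "(a (v, Suc j) * l (v, j)) * (a (v, j) * l (v, 0)) = a (v, Suc j) * l (v, 0)"
    using frameD(6)[OF frameG Gv(1)] frameD(4)[OF frameG Gv(2)] 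
    by (simp add: mult.assoc) (simp flip: mult.assoc)
  moreover have "(a (v, 0) * l (v, j)) * (a (v, j) * l (v, Suc j)) = a (v, 0) * l (v, Suc j)"
    using frameD(6)[OF frameG Gv(1)] frameD(5)[OF frameG Gv(2)] 
    by (simp add: mult.assoc) (simp flip: mult.assoc)
  ultimately show ?case by simp
qed

lemma T_G: "v \<in> T \<Longrightarrow> (v, 0) \<in> verts G"
  using m_pos[of v] by auto

text \<open>
  This is where the hereditary set enters: an edge that starts in \<open>T\<close> belongs to the restriction
  graph.
\<close>

lemma image_arc:
  assumes "e \<in> arcs E" "tail E e = (v, 0)" "v \<in> T"
  obtains u where "u \<in> T" "head E e = (u, 0)" "a (v, 0) * s e * l (u, 0) \<in> G.S" "a (u, 0) * g e * l (v, 0) \<in> G.S"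
  using assms(1)[unfolded E_hair]
proof (cases rule: hair_arc_cases)
  case (1 f)
  then have f: "tail F f = v" "Inl f \<in> arcs G" using assms by (auto simp: E_hair)
  then show ?thesis
    using that[of "head F f"] T_head[of f] 1 assms G.S_s[OF f(2)] G.S_g[OF f(2)]
    by (simp add: Inl_E sG_def[of "Inl f"] gG_def[of "Inl f"] \<sigma>_def \<gamma>_def)
next
  case (2 u k)
  then show ?thesis using assms by (simp add: E_hair)
qed

lemma l_a_cancel: "u \<in> T \<Longrightarrow> l (u, 0) * (a (u, 0) * y) = p (u, 0) * y"
  using frameD(6)[OF frameG T_G[of u]] by (simp flip: mult.assoc)

lemma image_path:
  assumes "awalk (v, 0) w (v', 0)" "v \<in> T"
  shows "v' \<in> T \<and> a (v, 0) * pw w (v', 0) * l (v', 0) \<in> G.S"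
  using assms
proof (induction w arbitrary: v)
  case Nil
  then have "v = v'" by (simp add: awalk_Nil_iff)
  then show ?case using Nil G.S_p[OF T_G, of v] frameD(4)[OF frameG T_G, of v] pG_def[of "(v, 0)"] by simp
next
  case (Cons e w)
  then have e: "e \<in> arcs E" "tail E e = (v, 0)" and w: "awalk (head E e) w (v', 0)"
    by (auto simp: awalk_Cons_iff)
  obtain u where u: "u \<in> T" "head E e = (u, 0)" "a (v, 0) * s e * l (u, 0) \<in> G.S"
    using image_arc[OF e Cons.prems(2)] by blast
  have IH: "v' \<in> T" "a (u, 0) * pw w (v', 0) * l (v', 0) \<in> G.S" using Cons.IH[of u] w u by auto
  have "(a (v, 0) * s e * l (u, 0)) * (a (u, 0) * pw w (v', 0) * l (v', 0)) \<in> G.S"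
    using u(3) IH(2) by (rule G.S_mult)
  moreover have "s e * p (u, 0) = s e" using s_p[OF e(1)] u by simp
  then have "s e * (p (u, 0) * y) = s e * y" for y by (simp flip: mult.assoc)
  then have "(a (v, 0) * s e * l (u, 0)) * (a (u, 0) * pw w (v', 0) * l (v', 0)) = a (v, 0) * pw (e # w) (v', 0) * l (v', 0)"
    by (simp add: mult.assoc l_a_cancel[OF u(1)])
  ultimately show ?case using IH by simp
qed

lemma p_l: "v \<in> T \<Longrightarrow> p (v, 0) * l (v, 0) = l (v, 0)"
  and a_p: "v \<in> T \<Longrightarrow> a (v, 0) * p (v, 0) = a (v, 0)"
  using frameD(4,5)[OF frameG T_G, of v] by simp_all

lemma image_DS_0:
  assumes "y \<in> DS 0" "v \<in> T" "v' \<in> T"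
  shows "a (v, 0) * y * l (v', 0) \<in> G.S"
proof -
  obtain x where x: "x \<in> Paths" "y = val x" using assms by (auto simp: DS_def)
  obtain W c where W: "finite W" "\<forall>w\<in>W. awalk (v, 0) w (v', 0)"
      "V (v, 0) * x * V (v', 0) \<approx> (\<Sum>w\<in>W. single 0 (c w) * path w (v', 0))"
    using paths_normal_form[OF x(1) T_level_0[OF assms(2)] T_level_0[OF assms(3)]] by blast
  have eq: "p (v, 0) * y * p (v', 0) = (\<Sum>w\<in>W. sc (c w) * pw w (v', 0))"
    using val_eqv[OF W(3)] x by simp
  have "a (v, 0) * y * l (v', 0) = (a (v, 0) * p (v, 0)) * y * (p (v', 0) * l (v', 0))"
    using assms by (simp add: a_p p_l)
  also have "\<dots> = a (v, 0) * (p (v, 0) * y * p (v', 0)) * l (v', 0)" by (simp add: mult.assoc)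
  also have "\<dots> = (\<Sum>w\<in>W. sc (c w) * (a (v, 0) * pw w (v', 0) * l (v', 0)))"
    unfolding eq sum_distrib_left sum_distrib_right
    by (simp add: mult.assoc sc_left_commute[of "a (v, 0)"])
  also have "\<dots> \<in> G.S"
    using W(2) image_path assms(2) by (intro G.S_sum G.S_scale) blast
  finally show ?thesis .
qed

text \<open>
  Ghost edges are cleared on the right; \<open>l_a_cancel\<close> inserts \<open>l (u, 0) * a (u, 0)\<close> between \<open>y e\<close> and
  its ghost edge.
\<close>

lemma image_DS:
  assumes "y \<in> DS k" "v \<in> T" "v' \<in> T"
  shows "a (v, 0) * y * l (v', 0) \<in> G.S"
  using assms
proof (induction k arbitrary: y v')
  case 0
  then show ?case by (intro image_DS_0)
next
  case (Suc k)
  have eq: "a (v, 0) * y * l (v', 0) = a (v, 0) * (y * p (v', 0)) * l (v', 0)"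
    using Suc.prems by (simp add: mult.assoc p_l)
  show ?case
  proof (cases "regular E (v', 0)")
    case True
    have "a (v, 0) * (y * (s e * g e)) * l (v', 0) \<in> G.S" if e: "e \<in> out_arcs E (v', 0)" for e
    proof -
      have e': "e \<in> arcs E" "tail E e = (v', 0)" using e by auto
      obtain u where u: "u \<in> T" "head E e = (u, 0)" "a (u, 0) * g e * l (v', 0) \<in> G.S"
        using image_arc[OF e' Suc.prems(3)] by blast
      have "(a (v, 0) * (y * s e) * l (u, 0)) * (a (u, 0) * g e * l (v', 0)) \<in> G.S"
        using u(3) by (rule G.S_mult[OF Suc.IH[OF DS_step[OF Suc.prems(1) e'(1)] Suc.prems(2) u(1)]])
      moreover have "p (u, 0) * g e = g e" using p_g[OF e'(1)] u by simp
      then have "p (u, 0) * (g e * z) = g e * z" for z by (simp flip: mult.assoc)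
      then have "(a (v, 0) * (y * s e) * l (u, 0)) * (a (u, 0) * g e * l (v', 0)) = a (v, 0) * (y * (s e * g e)) * l (v', 0)"
        by (simp add: mult.assoc l_a_cancel[OF u(1)])
      ultimately show ?thesis by simp
    qed
    then show ?thesis unfolding eq ck[OF True] sum_distrib_left sum_distrib_right
      by (intro G.S_sum)
  next
    case False
    then show ?thesis unfolding eq using Suc.prems
      by (intro image_DS_0 DS_sink T_level_0) auto
  qed
qed

text \<open>
  Expanding both factors \<open>\<epsilon>\<close> of \<open>\<epsilon> x \<epsilon>\<close> gives the sum of the \<open>a i (l i x a j) l j\<close>.  Matrix units move
  each term to level \<open>0\<close>, where \<open>image_DS\<close> applies.
\<close>

theorem image_eq_corner: "G.S = {\<epsilon> * x * \<epsilon> | x. x \<in> S}"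
proof
  show "G.S \<subseteq> {\<epsilon> * x * \<epsilon> | x. x \<in> S}"
  proof
    fix x assume "x \<in> G.S"
    then have "x \<in> S" "\<epsilon> * x * \<epsilon> = x" using image_in_corner by (simp_all add: mult.assoc)
    then show "x \<in> {\<epsilon> * x * \<epsilon> | x. x \<in> S}" by (metis (mono_tags, lifting) mem_Collect_eq)
  qed
  show "{\<epsilon> * x * \<epsilon> | x. x \<in> S} \<subseteq> G.S"
  proof clarify
    fix x assume x: "x \<in> S"
    have "a i * l i * x * (a j * l j) \<in> G.S" if i: "i \<in> verts G" and j: "j \<in> verts G" for i j
    proof -
      obtain v k v' k' where ij: "i = (v, k)" "j = (v', k')" by (metis surj_pair)
      have T: "v \<in> T" "v' \<in> T" using i j ij by auto
      have "l i * x * a j \<in> S" using frameD(2,3)[OF frameG] i j x by (intro S_mult) auto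
      then obtain r where "l i * x * a j \<in> DS r" using S_in_DS by blast
      then have "a (v, 0) * (l i * x * a j) * l (v', 0) \<in> G.S" using image_DS T by blast
      moreover have "a i * l (v, 0) \<in> G.S" "a (v', 0) * l j \<in> G.S"
        using image_hair[of v k] image_hair[of v' k'] i j unfolding ij by blast+
      ultimately have "(a i * l (v, 0)) * (a (v, 0) * (l i * x * a j) * l (v', 0)) * (a (v', 0) * l j) \<in> G.S"
        by (blast intro: G.S_mult[OF G.S_mult])
      moreover have "(a i * l (v, 0)) * (a (v, 0) * (l i * x * a j) * l (v', 0)) * (a (v', 0) * l j)
         = a i * (p (v, 0) * l i) * x * (a j * (p (v', 0) * l j))"
        by (simp add: mult.assoc l_a_cancel T)
      moreover have "p (v, 0) * l i = l i" "p (v', 0) * l j = l j"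
        using frameD(5)[OF frameG i] frameD(5)[OF frameG j] ij by simp_all
      ultimately show ?thesis by (simp add: mult.assoc)
    qed
    then have "(\<Sum>i\<in>verts G. \<Sum>j\<in>verts G. a i * l i * x * (a j * l j)) \<in> G.S"
      by (intro G.S_sum)
    moreover have "(\<Sum>i\<in>verts G. \<Sum>j\<in>verts G. a i * l i * x * (a j * l j)) = \<epsilon> * x * \<epsilon>"
      unfolding frame_sum[OF frameG] by (simp only: sum_distrib_left sum_distrib_right) (rule sum.swap)
    ultimately show "\<epsilon> * x * \<epsilon> \<in> G.S" by simp
  qed
qed

lemma G_unit: "G.unit = \<epsilon>"
  using frame_sum[OF frameG] by (simp add: G.unit_def pG_def)

end

section \<open>Classes and corners\<close>

context lpa
begin

abbreviation L :: "('k, ('k, ('v, 'e) lpa_gen) free_alg set) module" where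
  "L \<equiv> leavitt_path_algebra K E"

abbreviation A :: "('k, ('v, 'e) lpa_gen) free_alg set" where
  "A \<equiv> augmentation_ideal (lpa_gens E)"

abbreviation cls :: "('k, ('v, 'e) lpa_gen) free_alg \<Rightarrow> ('k, ('v, 'e) lpa_gen) free_alg set" where
  "cls \<equiv> lpa_class E"

lemma cls_alt: "cls q = {i + q | i. i \<in> I}"
  by (auto simp: lpa_class_def a_r_coset_def')

lemma self_in_cls: "q \<in> cls q"
  using I_zero by (force simp: cls_alt)

lemma in_cls: "q \<in> C \<Longrightarrow> r \<in> cls q \<Longrightarrow> r \<approx> q"
  by (auto simp: cls_alt eqv_def I_sub_C fc_add)

lemma cls_eqI: assumes "q \<approx> r" shows "cls q = cls r"
proof -
  have *: "cls q \<subseteq> cls r" if "q \<approx> r" for q r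
  proof
    fix z assume "z \<in> cls q"
    then obtain i where i: "z = i + q" "i \<in> I" by (auto simp: cls_alt)
    have "i + (q - r) \<in> I" using i that by (auto simp: eqv_def intro: I_add)
    moreover have "z = (i + (q - r)) + r" by (simp add: i)
    ultimately show "z \<in> cls r" unfolding cls_alt by blast
  qed
  then show ?thesis using assms eqv_sym by blast
qed

lemma carrier_L: "carrier L = cls ` A"
  by (simp add: leavitt_path_algebra_def)

lemma zero_L: "\<zero>\<^bsub>L\<^esub> = cls 0"
  by (simp add: leavitt_path_algebra_def cls_alt)

lemma one_L: "\<one>\<^bsub>L\<^esub> = cls one_V"
  by (simp add: leavitt_path_algebra_def one_V_def)

lemma mult_L: "q \<in> C \<Longrightarrow> r \<in> C \<Longrightarrow> cls q \<otimes>\<^bsub>L\<^esub> cls r = cls (q * r)"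
  using ideal.rcoset_mult_add[OF ideal_I, of q r] by (simp add: leavitt_path_algebra_def lpa_class_def)

lemma add_L: "q \<in> C \<Longrightarrow> r \<in> C \<Longrightarrow> cls q \<oplus>\<^bsub>L\<^esub> cls r = cls (q + r)"
  using ideal.a_rcos_sum[OF ideal_I, of q r] by (simp add: leavitt_path_algebra_def lpa_class_def)

lemma smult_L: assumes "q \<in> C" shows "c \<odot>\<^bsub>L\<^esub> cls q = cls (single 0 c * q)"
proof -
  have "cls (single 0 c * r) = cls (single 0 c * q)" if "r \<in> cls q" for r
    using in_cls[OF assms that] by (intro cls_eqI eqv_left fc_const)
  then have "(\<Union>r\<in>cls q. cls (single 0 c * r)) = (\<Union>r\<in>cls q. cls (single 0 c * q))"
    by (intro SUP_cong refl)
  also have "\<dots> = cls (single 0 c * q)"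
    using self_in_cls[of q] by blast
  finally show ?thesis by (simp add: leavitt_path_algebra_def)
qed

lemma one_V_A: "one_V \<in> A"
  unfolding one_V_def by (intro aug_sum aug_gen) (simp add: lpa_gens_def)

lemma L_closed:
  assumes "x \<in> carrier L" "y \<in> carrier L"
  shows "x \<otimes>\<^bsub>L\<^esub> y \<in> carrier L" "x \<oplus>\<^bsub>L\<^esub> y \<in> carrier L" "c \<odot>\<^bsub>L\<^esub> x \<in> carrier L"
proof -
  obtain q r where q: "q \<in> A" "x = cls q" and r: "r \<in> A" "y = cls r"
    using assms unfolding carrier_L by blast
  have "q * r \<in> A" "q + r \<in> A" "single 0 c * q \<in> A"
    using q r by (simp_all add: aug_mult_right aug_mult_left aug_add fc_const aug_C)
  then show "x \<otimes>\<^bsub>L\<^esub> y \<in> carrier L" "x \<oplus>\<^bsub>L\<^esub> y \<in> carrier L" "c \<odot>\<^bsub>L\<^esub> x \<in> carrier L"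
    using q r unfolding carrier_L by (simp_all add: mult_L add_L smult_L aug_C)
qed

end

context leavitt_family
begin

text \<open>
  The homomorphism induced on classes; it takes the same value on all members of a class by
  \<open>val_eqv\<close>.
\<close>

definition cval :: "('k, ('v, 'e) lpa_gen) free_alg set \<Rightarrow> 'a" where
  "cval X = val (SOME q. q \<in> X)"

lemma cval_cls: assumes "q \<in> C" shows "cval (cls q) = val q"
proof -
  have "(SOME r. r \<in> cls q) \<in> cls q" using self_in_cls by (rule someI)
  then show ?thesis unfolding cval_def using in_cls[OF assms] val_eqv by blast
qed

lemma cval_ops:
  assumes "x \<in> carrier L" "y \<in> carrier L"
  shows "cval (x \<otimes>\<^bsub>L\<^esub> y) = cval x * cval y" "cval (x \<oplus>\<^bsub>L\<^esub> y) = cval x + cval y"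
    "cval (c \<odot>\<^bsub>L\<^esub> x) = sc c * cval x"
  using assms unfolding carrier_L
  by (auto simp: mult_L add_L smult_L aug_C cval_cls fc_mult fc_add fc_const)

lemma cval_one: "cval \<one>\<^bsub>L\<^esub> = unit"
  by (simp add: one_L cval_cls one_V_C val_one_V)

lemma one_L_carrier: "\<one>\<^bsub>L\<^esub> \<in> carrier L"
  by (simp add: one_L carrier_L one_V_A)

lemma cval_image: "cval ` carrier L = S"
  unfolding carrier_L S_def image_image by (intro image_cong refl cval_cls aug_C)

lemma cval_inj: assumes path_independent shows "inj_on cval (carrier L)"
proof (rule inj_onI)
  fix x y assume "x \<in> carrier L" "y \<in> carrier L" "cval x = cval y"
  then obtain q r where q: "q \<in> A" "x = cls q" and r: "r \<in> A" "y = cls r" and "val q = val r"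
    by (auto simp: carrier_L cval_cls aug_C)
  then have "q - r \<in> I" using val_faithful[OF assms, of "q - r"] by (simp add: aug_diff)
  then show "x = y" using q r by (auto intro!: cls_eqI simp: eqv_def aug_C)
qed

end

text \<open>
  Two faithful families in the same algebra identify the corner and the second Leavitt path
  algebra with the same set of elements, so they can be compared there.
\<close>

lemma corner_iso:
  fixes E :: "('v, 'e) pre_digraph" and G :: "('v, 'e) pre_digraph" and K :: "'k :: field itself"
    and sc :: "'k \<Rightarrow> 'a :: ring_1"
  assumes "leavitt_family E sc p s g" and "leavitt_family G sc p' s' g'"
    and indE: "leavitt_family.path_independent E sc p s"
    and indG: "leavitt_family.path_independent G sc p' s'"
    and e: "idempotent_elem (leavitt_path_algebra K E) e"
    and img: "leavitt_family.S G sc p' s' g' =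
       {leavitt_family.cval sc p s g e * x * leavitt_family.cval sc p s g e | x. x \<in> leavitt_family.S E sc p s g}"
    and un: "leavitt_family.unit G p' = leavitt_family.cval sc p s g e"
  shows "corner (leavitt_path_algebra K E) e \<cong>\<^sub>a leavitt_path_algebra K G"
proof -
  interpret E: leavitt_family E K sc p s g by fact
  interpret G: leavitt_family G K sc p' s' g' by fact
  let ?B = "corner E.L e"
  have eL: "e \<in> carrier E.L" "e \<otimes>\<^bsub>E.L\<^esub> e = e" using e by (auto simp: idempotent_elem_def)
  have B: "carrier ?B = {e \<otimes>\<^bsub>E.L\<^esub> x \<otimes>\<^bsub>E.L\<^esub> e | x. x \<in> carrier E.L}"
    "\<one>\<^bsub>?B\<^esub> = e" "x \<otimes>\<^bsub>?B\<^esub> y = x \<otimes>\<^bsub>E.L\<^esub> y" "x \<oplus>\<^bsub>?B\<^esub> y = x \<oplus>\<^bsub>E.L\<^esub> y" "c \<odot>\<^bsub>?B\<^esub> x = c \<odot>\<^bsub>E.L\<^esub> x" for x y c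
    by (simp_all add: corner_def)
  have BL: "x \<in> carrier E.L" if "x \<in> carrier ?B" for x
    using that eL E.L_closed(1) unfolding B by blast
  have imgB: "E.cval ` carrier ?B = G.S"
  proof -
    have "E.cval ` carrier ?B = (\<lambda>x. E.cval (e \<otimes>\<^bsub>E.L\<^esub> x \<otimes>\<^bsub>E.L\<^esub> e)) ` carrier E.L"
      unfolding B by blast
    also have "\<dots> = (\<lambda>x. E.cval e * E.cval x * E.cval e) ` carrier E.L"
      using eL E.L_closed(1) by (intro image_cong refl) (simp add: E.cval_ops)
    also have "\<dots> = G.S" unfolding img E.cval_image[symmetric] by blast
    finally show ?thesis .
  qed
  have bijG: "bij_betw G.cval (carrier G.L) G.S"
    using G.cval_inj[OF indG] G.cval_image by (auto simp: bij_betw_def)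
  have bijB: "bij_betw E.cval (carrier ?B) G.S"
    using inj_on_subset[OF E.cval_inj[OF indE]] BL imgB by (auto simp: bij_betw_def)
  define h where "h = inv_into (carrier G.L) G.cval \<circ> E.cval"
  have hbij: "bij_betw h (carrier ?B) (carrier G.L)"
    unfolding h_def by (rule bij_betw_trans[OF bijB bij_betw_inv_into[OF bijG]])
  have h_carrier: "h x \<in> carrier G.L" if "E.cval x \<in> G.S" for x
    using that unfolding h_def comp_def by (metis G.cval_image inv_into_into)
  have h_val: "G.cval (h x) = E.cval x" if "E.cval x \<in> G.S" for x
    using that unfolding h_def comp_def by (metis G.cval_image f_inv_into_f)
  have h_eqI: "h x = y" if "E.cval x \<in> G.S" "y \<in> carrier G.L" "G.cval y = E.cval x" for x y
    using that h_carrier h_val G.cval_inj[OF indG] by (metis inj_onD)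
  have BS: "E.cval x \<in> G.S" if "x \<in> carrier ?B" for x using that imgB by blast
  have "h \<in> ring_hom ?B G.L"
  proof (rule ring_hom_memI)
    fix x assume "x \<in> carrier ?B" then show "h x \<in> carrier G.L" using h_carrier BS by blast
  next
    fix x y assume x: "x \<in> carrier ?B" and y: "y \<in> carrier ?B"
    note xy = h_carrier[OF BS[OF x]] h_carrier[OF BS[OF y]] h_val[OF BS[OF x]] h_val[OF BS[OF y]]
    show "h (x \<otimes>\<^bsub>?B\<^esub> y) = h x \<otimes>\<^bsub>G.L\<^esub> h y"
      unfolding B using xy BL[OF x] BL[OF y] BS[OF x] BS[OF y]
      by (intro h_eqI) (auto simp: E.cval_ops G.cval_ops intro: G.S_mult G.L_closed)
    show "h (x \<oplus>\<^bsub>?B\<^esub> y) = h x \<oplus>\<^bsub>G.L\<^esub> h y"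
      unfolding B using xy BL[OF x] BL[OF y] BS[OF x] BS[OF y]
      by (intro h_eqI) (auto simp: E.cval_ops G.cval_ops intro: G.S_add G.L_closed)
  next
    show "h \<one>\<^bsub>?B\<^esub> = \<one>\<^bsub>G.L\<^esub>"
      unfolding B using un G.unit_in_S by (intro h_eqI) (auto simp: G.cval_one G.one_L_carrier)
  qed
  moreover have "h (c \<odot>\<^bsub>?B\<^esub> x) = c \<odot>\<^bsub>G.L\<^esub> h x" if x: "x \<in> carrier ?B" for c x
    unfolding B using h_carrier[OF BS[OF x]] h_val[OF BS[OF x]] BL[OF x] BS[OF x]
    by (intro h_eqI) (auto simp: E.cval_ops G.cval_ops intro: G.S_scale G.L_closed)
  ultimately show ?thesis
    unfolding algebra_iso_def ring_iso_def using hbij by blast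
qed

lemma restriction_all: assumes "wf_digraph F" shows "restriction_graph F (verts F) = F"
proof -
  have "{e \<in> arcs F. tail F e \<in> verts F} = arcs F" using assms by (auto simp: wf_digraph_def)
  then show ?thesis by (simp add: restriction_graph_def)
qed

text \<open>
  The set \<open>T\<close> together with the hairs over it is hereditary, and it is saturated because a regular
  vertex of \<open>F\<close> outside \<open>T\<close> has a loop.  So there is a branching representation in which exactly
  these vertices vanish.  It kills \<open>\<epsilon> = \<Sum> a i p (\<nu> i) l i\<close>, hence the ideal generated by \<open>\<epsilon>\<close>, which
  therefore contains no vertex outside \<open>T\<close>.
\<close>

lemma full_hereditary_support:
  fixes F :: "('v, 'e) pre_digraph" and K :: "'k :: field itself" and p s g
  assumes F: "fin_digraph F" "totally_looped F" "\<forall>v\<in>verts F. 1 \<le> n v"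
    and fam: "leavitt_family (hair_extension F n) sc p s g"
    and ind: "leavitt_family.path_independent (hair_extension F n) sc p s"
    and T: "hereditary F T"
    and e: "e \<in> carrier (leavitt_path_algebra K (hair_extension F n))"
    and supp: "leavitt_family.supp (hair_extension F n) sc p s g
        (leavitt_family.cval sc p s g e) (T \<times> {0})"
    and full: "full_idempotent (leavitt_path_algebra K (hair_extension F n)) e"
  shows "T = verts F"
proof (rule ccontr)
  assume "T \<noteq> verts F"
  then obtain u where u: "u \<in> verts F" "u \<notin> T" using T by (auto simp: hereditary_def)
  interpret F: fin_digraph F by fact
  let ?E = "hair_extension F n"
  interpret E: leavitt_family ?E K sc p s g by fact
  let ?Z = "T \<times> (UNIV :: nat set)"
  interpret q: branching ?E K ?Z
  proof
    fix x assume "x \<in> arcs ?E" "tail ?E x \<in> ?Z"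
    then show "head ?E x \<in> ?Z" using F.hereditary_head[OF T] by (auto elim!: hair_arc_cases)
  next
    fix vj assume reg: "regular ?E vj" and Z: "vj \<notin> ?Z"
    obtain v j where vj: "vj = (v, j)" by (cases vj)
    have v: "v \<in> verts F" "j < n v" "v \<notin> T" using reg Z by (auto simp: regular_def vj)
    show "\<exists>x\<in>out_arcs ?E vj. head ?E x \<notin> ?Z"
    proof (cases j)
      case 0
      then have "regular F v" using reg F(3) v by (simp add: vj regular_hair_0)
      then obtain f where "f \<in> arcs F" "tail F f = v" "head F f = v"
        using F(2) by (auto simp: totally_looped_def)
      then show ?thesis using v by (intro bexI[of _ "Inl f"]) (auto simp: vj 0)
    next
      case (Suc k)
      then show ?thesis using v by (simp add: vj out_arcs_hair_Suc)
    qed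
  qed
  \<comment> \<open>Lift the frame of \<open>e\<close> to representatives, so that the representation \<open>q\<close> can be applied to it.\<close>
  obtain y where y: "y \<in> E.A" "e = E.cls y" using e by (auto simp: E.carrier_L)
  obtain J :: "nat set" and \<nu> a l where f: "E.frame (E.cval e) J \<nu> a l" and \<nu>: "\<nu> ` J = T \<times> {0}"
    using supp by (auto simp: E.supp_def)
  have "\<forall>i\<in>J. \<exists>q r. q \<in> E.A \<and> r \<in> E.A \<and> a i = E.val q \<and> l i = E.val r"
    using E.frameD(2,3)[OF f] unfolding E.S_def by blast
  then obtain \<alpha> \<beta> where \<alpha>\<beta>: "\<And>i. i \<in> J \<Longrightarrow> \<alpha> i \<in> E.A \<and> \<beta> i \<in> E.A \<and> a i = E.val (\<alpha> i) \<and> l i = E.val (\<beta> i)"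
    by metis
  let ?z = "\<Sum>i\<in>J. \<alpha> i * (E.V (\<nu> i) * \<beta> i)"
  have z: "?z \<in> E.A"
    using \<alpha>\<beta> E.frameD(1)[OF f] by (intro aug_sum aug_mult_right fc_mult E.aug_C E.V_C) auto
  have "E.val y = E.cval e" using y E.cval_cls E.aug_C by simp
  also have "\<dots> = (\<Sum>i\<in>J. a i * (p (\<nu> i) * l i))"
    using E.frame_sum[OF f] E.frameD(5)[OF f] by simp
  also have "\<dots> = E.val ?z" using \<alpha>\<beta> by simp
  finally have "y - ?z \<in> E.I" using y z by (intro E.val_faithful[OF ind]) (auto intro: aug_diff)
  then have "q.val y = q.val ?z" using q.val_I[of "y - ?z"] by simp
  also have "\<dots> = 0"
  proof -
    have "q.bp (\<nu> i) = 0" if "i \<in> J" for i using imageI[OF that, of \<nu>] unfolding \<nu> by (intro q.bp_zero) auto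
    then show ?thesis by simp
  qed
  finally have qe: "q.cval e = 0" using y q.cval_cls E.aug_C by simp
  have "x \<in> carrier E.L \<and> q.cval x = 0" if "x \<in> carrier E.L" for x
  proof -
    have "x \<in> ideal_prod E.L {r \<otimes>\<^bsub>E.L\<^esub> e | r. r \<in> carrier E.L} (carrier E.L)"
      using full that by (simp add: full_idempotent_def)
    then show ?thesis
    proof (induction rule: ideal_prod.induct)
      case (prod i j)
      then obtain r where r: "i = r \<otimes>\<^bsub>E.L\<^esub> e" "r \<in> carrier E.L" by blast
      then show ?case using prod e qe E.L_closed by (simp add: q.cval_ops)
    next
      case (sum x y)
      then show ?case using E.L_closed by (simp add: q.cval_ops)
    qed
  qed
  moreover have u0: "(u, 0) \<in> verts ?E" using u F(3) by auto
  then have "E.V (u, 0) \<in> E.A" by (intro aug_gen) (auto simp: lpa_gens_def)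
  then have "q.cval (E.cls (E.V (u, 0))) = q.val (E.V (u, 0))" "E.cls (E.V (u, 0)) \<in> carrier E.L"
    using q.cval_cls[OF E.aug_C] unfolding E.carrier_L by blast+
  ultimately have "q.val (E.V (u, 0)) = 0" by simp
  then show False using q.bp_nonzero[of "(u, 0)"] u by simp
qed

section \<open>Corners of totally looped hair extensions\<close>

theorem corollary3p11:
  fixes F :: "('v, 'e) pre_digraph"
    and n :: "'v \<Rightarrow> nat"
    and E :: "('v \<times> nat, 'e + 'v \<times> nat) pre_digraph"
    and \<epsilon> :: "('k :: field, ('v \<times> nat, 'e + 'v \<times> nat) lpa_gen) free_alg set"
  assumes "fin_digraph F" and "verts F \<noteq> {}"
    and "totally_looped F"
    and "\<forall>v\<in>verts F. 1 \<le> n v"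
    and "E = hair_extension F n"
    and "idempotent_elem (leavitt_path_algebra TYPE('k) E) \<epsilon>"
    and "\<epsilon> \<noteq> \<zero>\<^bsub>leavitt_path_algebra TYPE('k) E\<^esub>"
  shows "(\<exists>G :: ('v \<times> nat, 'e + 'v \<times> nat) pre_digraph.
            fin_digraph G \<and> verts G \<noteq> {} \<and>
            corner (leavitt_path_algebra TYPE('k) E) \<epsilon> \<cong>\<^sub>a leavitt_path_algebra TYPE('k) G) \<and>
         (\<exists>T m. hereditary F T \<and> T \<noteq> {} \<and>
            totally_looped (restriction_graph F T) \<and>
            (\<forall>v\<in>T. 1 \<le> m v) \<and>
            corner (leavitt_path_algebra TYPE('k) E) \<epsilon>
              \<cong>\<^sub>a leavitt_path_algebra TYPE('k) (hair_extension (restriction_graph F T) m)) \<and>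
         (full_idempotent (leavitt_path_algebra TYPE('k) E) \<epsilon> \<longrightarrow>
            (\<exists>m. (\<forall>v\<in>verts F. 1 \<le> m v) \<and>
               corner (leavitt_path_algebra TYPE('k) E) \<epsilon>
                 \<cong>\<^sub>a leavitt_path_algebra TYPE('k) (hair_extension F m)))"
proof -
  interpret F: fin_digraph F by fact
  interpret E: fin_digraph E unfolding assms(5) using assms(1,4) by (intro fin_digraph_hair) auto
  interpret b: branching E "TYPE('k)" "{}"
    by unfold_locales (auto simp: regular_def)
  have ind: "b.path_independent" by (rule b.branching_independent) simp
  have \<epsilon>: "\<epsilon> \<in> carrier b.L" "\<epsilon> \<otimes>\<^bsub>b.L\<^esub> \<epsilon> = \<epsilon>" using assms(6) by (auto simp: idempotent_elem_def)
  interpret b: idempotent_in_family E "TYPE('k)" endo_scalar b.bp b.bs b.bg "b.cval \<epsilon>"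
  proof
    show "b.cval \<epsilon> \<in> b.S" using \<epsilon> b.cval_image by blast
    show "b.cval \<epsilon> * b.cval \<epsilon> = b.cval \<epsilon>" using \<epsilon> by (metis b.cval_ops(1))
  qed (rule ind)
  interpret b: hair_family E "TYPE('k)" endo_scalar b.bp b.bs b.bg F n
    using assms by unfold_locales auto
  have nonzero: "b.cval \<epsilon> \<noteq> 0"
  proof
    assume "b.cval \<epsilon> = 0"
    then have "b.cval \<epsilon> = b.cval (b.cls 0)" using b.cval_cls[OF fc_zero] by simp
    moreover have "b.cls 0 \<in> carrier b.L" using aug_zero by (auto simp: b.carrier_L)
    ultimately have "\<epsilon> = b.cls 0" using b.cval_inj[OF ind] \<epsilon> by (auto simp: inj_on_def)
    then show False using assms(7) by (simp add: b.zero_L)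
  qed
  obtain J :: "(('e + 'v \<times> nat) list \<times> 'v \<times> nat) set" and \<nu> a l where "b.frame (b.cval \<epsilon>) J \<nu> a l"
    using b.idempotent_frame by blast
  then have s1: "b.supp (b.cval \<epsilon>) (fst ` \<nu> ` J \<times> {0})"
    by (intro b.supp_level_0 b.suppI)
  have "fst ` \<nu> ` J \<subseteq> verts F"
    using b.supp_verts[OF s1] by (auto simp: assms(5))
  with b.supp_hereditary[OF assms(3) s1] obtain T where T: "hereditary F T" and s2: "b.supp (b.cval \<epsilon>) (T \<times> {0})"
    by blast
  have T0: "T \<noteq> {}" using b.supp_nonempty[OF s2 nonzero] by simp
  obtain m :: "'v \<Rightarrow> nat" and a l where m: "\<forall>v\<in>T. 1 \<le> m v"
    and f: "b.frame (b.cval \<epsilon>) {(v, j). v \<in> T \<and> j < m v} (\<lambda>i. (fst i, 0)) a l"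
    using b.supp_frame[OF s2] by blast
  interpret c: hair_corner E "TYPE('k)" endo_scalar b.bp b.bs b.bg F n "b.cval \<epsilon>" T m a l
    using T m f by unfold_locales auto
  let ?G = "hair_extension (restriction_graph F T) m"
  have iso: "corner (leavitt_path_algebra TYPE('k) E) \<epsilon> \<cong>\<^sub>a leavitt_path_algebra TYPE('k) ?G"
    by (rule corner_iso[OF b.leavitt_family_axioms c.family_G ind c.G_independent[OF ind] assms(6) c.image_eq_corner c.G_unit])
  have tl: "totally_looped (restriction_graph F T)" using totally_looped_restriction assms(3) T by blast
  have "fin_digraph ?G" by (rule c.G_fin)
  moreover have "verts ?G \<noteq> {}" using T0 c.T_G by blast
  moreover have "\<exists>m. (\<forall>v\<in>verts F. 1 \<le> m v) \<and>
      corner (leavitt_path_algebra TYPE('k) E) \<epsilon> \<cong>\<^sub>a leavitt_path_algebra TYPE('k) (hair_extension F m)"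
    if full: "full_idempotent (leavitt_path_algebra TYPE('k) E) \<epsilon>"
  proof -
    have "T = verts F"
      by (rule full_hereditary_support[OF assms(1,3,4) b.leavitt_family_axioms[unfolded assms(5)]
        ind[unfolded assms(5)] T \<epsilon>(1)[unfolded assms(5)] s2[unfolded assms(5)] full[unfolded assms(5)]])
    then show ?thesis using iso m restriction_all[OF F.wf_digraph] by auto
  qed
  ultimately show ?thesis using iso T T0 tl m by blast
qed

end
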